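(* Let $W$ be an irreducible affine Coxeter group. Then $W$ is profinitely rigid; that is, whenever $H$ is a finitely generated residually finite group with $\widehat{H}\cong\widehat{W}$, one has $H\cong W$.
   Context: A Coxeter matrix on a set $S$ is a map $m:S\times S\to\{1,2,\dots,\infty\}$ with $m(s,s')=m(s',s)$ and $m(s,s')=1\Leftrightarrow s=s'$. It determines the Coxeter group $W$ with generators $S$ and relations $(ss')^{m(s,s')}=e$ for all $(s,s')$ with $m(s,s')<\infty$; $(W,S)$ is called a Coxeter system. Its Coxeter diagram is the graph on $S$ in which $s,s'$ are adjacent iff $m(s,s')\geq 3$ (edges labeled by $m(s,s')$), and $(W,S)$ is irreducible if this diagram is connected. A Coxeter group is affine if it is infinite and has a representation as a discrete affine reflection group, i.e., as a discrete group of isometries of a finite-dimensional Euclidean space generated by affine reflections. The irreducible affine Coxeter groups are classified: they are those of types $\tilde A_n$ ($n\ge 1$), $\tilde B_n$ ($n\ge 3$), $\tilde C_n$ ($n\ge 2$), $\tilde D_n$ ($n\ge 4$), $\tilde E_6,\tilde E_7,\tilde E_8,\tilde F_4,\tilde G_2$. For a group $\Gamma$, $\widehat{\Gamma}$ denotes its profinite completion. *)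

theory Defs
  imports
    "HOL-Algebra.Bij"
    "HOL-Algebra.Product_Groups"
    "HOL-Analysis.Analysis"
    "HOL-Library.Extended_Nat"
begin

section \<open>Groups given by generators and relators\<close>

text \<open>A word is a list of pairs \<open>(s, b)\<close>, standing for the letter \<open>s\<close> if \<open>b\<close> is true and for
  its formal inverse otherwise.\<close>

type_synonym 's word = "('s \<times> bool) list"

inductive_set word_equiv :: "'s set \<Rightarrow> 's word set \<Rightarrow> ('s word \<times> 's word) set"
  for S :: "'s set" and R :: "'s word set" where
  refl: "w \<in> lists (S \<times> UNIV) \<Longrightarrow> (w, w) \<in> word_equiv S R"
| sym: "(v, w) \<in> word_equiv S R \<Longrightarrow> (w, v) \<in> word_equiv S R"
| trans: "(u, v) \<in> word_equiv S R \<Longrightarrow> (v, w) \<in> word_equiv S R \<Longrightarrow> (u, w) \<in> word_equiv S R"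
| cancel: "u \<in> lists (S \<times> UNIV) \<Longrightarrow> v \<in> lists (S \<times> UNIV) \<Longrightarrow> s \<in> S \<Longrightarrow>
    (u @ [(s, b), (s, \<not> b)] @ v, u @ v) \<in> word_equiv S R"
| relator: "u \<in> lists (S \<times> UNIV) \<Longrightarrow> v \<in> lists (S \<times> UNIV) \<Longrightarrow> r \<in> R \<Longrightarrow> r \<in> lists (S \<times> UNIV) \<Longrightarrow>
    (u @ r @ v, u @ v) \<in> word_equiv S R"

definition presented_group :: "'s set \<Rightarrow> 's word set \<Rightarrow> 's word set monoid" where
  "presented_group S R =
    \<lparr>carrier = lists (S \<times> UNIV) // word_equiv S R,
     monoid.mult = (\<lambda>A B. word_equiv S R `` {a @ b | a b. a \<in> A \<and> b \<in> B}),
     one = word_equiv S R `` {[]}\<rparr>"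

lemma word_equiv_lists:
  "(v, w) \<in> word_equiv S R \<Longrightarrow> v \<in> lists (S \<times> UNIV) \<and> w \<in> lists (S \<times> UNIV)"
  by (induction rule: word_equiv.induct) auto

lemma equiv_word_equiv: "equiv (lists (S \<times> UNIV)) (word_equiv S R)"
  by (intro equivI refl_onI symI transI)
     (auto intro: word_equiv.refl word_equiv.sym word_equiv.trans dest: word_equiv_lists)

lemma word_equiv_context:
  "(v, w) \<in> word_equiv S R \<Longrightarrow> x \<in> lists (S \<times> UNIV) \<Longrightarrow> y \<in> lists (S \<times> UNIV) \<Longrightarrow>
    (x @ v @ y, x @ w @ y) \<in> word_equiv S R"
proof (induction rule: word_equiv.induct)
  case (refl w) then show ?case by (intro word_equiv.refl) auto
next
  case (sym v w) then show ?case by (blast intro: word_equiv.sym)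
next
  case (trans u v w) then show ?case by (blast intro: word_equiv.trans)
next
  case (cancel u v s b)
  then show ?case using word_equiv.cancel[of "x @ u" S "v @ y" s b R] by auto
next
  case (relator u v r)
  then show ?case using word_equiv.relator[of "x @ u" S "v @ y" r R] by auto
qed

lemma word_equiv_append:
  assumes "(v, v') \<in> word_equiv S R" "(w, w') \<in> word_equiv S R"
  shows "(v @ w, v' @ w') \<in> word_equiv S R"
  using word_equiv_context[OF assms(1), of "[]" w] word_equiv_context[OF assms(2), of v' "[]"]
    word_equiv_lists[OF assms(1)] word_equiv_lists[OF assms(2)]
  by (auto intro: word_equiv.trans)

lemma presented_group_mult:
  assumes "v \<in> lists (S \<times> UNIV)" "w \<in> lists (S \<times> UNIV)"
  shows "(word_equiv S R `` {v}) \<otimes>\<^bsub>presented_group S R\<^esub> (word_equiv S R `` {w}) =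
    word_equiv S R `` {v @ w}"
  using assms
  by (auto simp: presented_group_def)
     (blast intro: word_equiv.refl word_equiv.trans word_equiv_append)+

lemma word_equiv_inverse:
  "w \<in> lists (S \<times> UNIV) \<Longrightarrow>
    (rev (map (\<lambda>(s, b). (s, \<not> b)) w) @ w, []) \<in> word_equiv S R"
proof (induction w)
  case Nil then show ?case by (simp add: word_equiv.refl)
next
  case (Cons a w)
  obtain s b where a: "a = (s, b)" by (cases a)
  let ?r = "rev (map (\<lambda>(s, b). (s, \<not> b)) w)"
  have "?r \<in> lists (S \<times> UNIV)" using Cons.prems by (auto simp: in_lists_conv_set)
  then have "(?r @ [(s, \<not> b), (s, \<not> \<not> b)] @ w, ?r @ w) \<in> word_equiv S R"
    using Cons.prems a by (intro word_equiv.cancel) auto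
  then show ?case using Cons a by (auto intro: word_equiv.trans)
qed

lemma group_presented_group: "group (presented_group S R)"
proof (rule groupI)
  let ?G = "presented_group S R" and ?c = "\<lambda>w. word_equiv S R `` {w}"
  have cases: "\<exists>w \<in> lists (S \<times> UNIV). A = ?c w" if "A \<in> carrier ?G" for A
    using that by (auto simp: presented_group_def quotient_def)
  have mem: "?c w \<in> carrier ?G" if "w \<in> lists (S \<times> UNIV)" for w
    using that by (auto simp: presented_group_def quotient_def)
  have one: "\<one>\<^bsub>?G\<^esub> = ?c []" by (simp add: presented_group_def)
  show "\<one>\<^bsub>?G\<^esub> \<in> carrier ?G" by (simp add: one mem)
  have append: "v @ w \<in> lists (S \<times> UNIV)" if "v \<in> lists (S \<times> UNIV)" "w \<in> lists (S \<times> UNIV)" for v w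
    using that by simp
  show "x \<otimes>\<^bsub>?G\<^esub> y \<in> carrier ?G" if xy: "x \<in> carrier ?G" "y \<in> carrier ?G" for x y
  proof -
    obtain u v where "u \<in> lists (S \<times> UNIV)" "x = ?c u" "v \<in> lists (S \<times> UNIV)" "y = ?c v"
      using cases[OF xy(1)] cases[OF xy(2)] by blast
    then show ?thesis by (simp only: presented_group_mult append mem)
  qed
  show "x \<otimes>\<^bsub>?G\<^esub> y \<otimes>\<^bsub>?G\<^esub> z = x \<otimes>\<^bsub>?G\<^esub> (y \<otimes>\<^bsub>?G\<^esub> z)"
    if xyz: "x \<in> carrier ?G" "y \<in> carrier ?G" "z \<in> carrier ?G" for x y z
  proof -
    obtain u v w where "u \<in> lists (S \<times> UNIV)" "x = ?c u" "v \<in> lists (S \<times> UNIV)" "y = ?c v"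
      "w \<in> lists (S \<times> UNIV)" "z = ?c w"
      using cases[OF xyz(1)] cases[OF xyz(2)] cases[OF xyz(3)] by blast
    then show ?thesis by (simp only: presented_group_mult append append_assoc)
  qed
  show "\<one>\<^bsub>?G\<^esub> \<otimes>\<^bsub>?G\<^esub> x = x" if x: "x \<in> carrier ?G" for x
  proof -
    obtain w where "w \<in> lists (S \<times> UNIV)" "x = ?c w" using cases[OF x] by blast
    then show ?thesis by (simp only: one presented_group_mult lists.Nil append_Nil)
  qed
  show "\<exists>y \<in> carrier ?G. y \<otimes>\<^bsub>?G\<^esub> x = \<one>\<^bsub>?G\<^esub>" if x: "x \<in> carrier ?G" for x
  proof -
    obtain w where w: "w \<in> lists (S \<times> UNIV)" "x = ?c w" using cases[OF x] by blast
    let ?v = "rev (map (\<lambda>(s, b). (s, \<not> b)) w)"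
    have v: "?v \<in> lists (S \<times> UNIV)" using w(1) by (auto simp: in_lists_conv_set)
    have "?c (?v @ w) = ?c []"
      using equiv_class_eq[OF equiv_word_equiv word_equiv_inverse[OF w(1)]] .
    then show ?thesis using v w mem[OF v] one presented_group_mult[OF v w(1)] by metis
  qed
qed


section \<open>Coxeter groups\<close>

definition coxeter_matrix :: "'s set \<Rightarrow> ('s \<Rightarrow> 's \<Rightarrow> enat) \<Rightarrow> bool" where
  "coxeter_matrix S m \<longleftrightarrow>
    (\<forall>s\<in>S. \<forall>t\<in>S. 1 \<le> m s t \<and> m s t = m t s \<and> (m s t = 1 \<longleftrightarrow> s = t))"

definition coxeter_relators :: "'s set \<Rightarrow> ('s \<Rightarrow> 's \<Rightarrow> enat) \<Rightarrow> 's word set" where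
  "coxeter_relators S m =
    {concat (replicate k [(s, True), (t, True)]) | s t k. s \<in> S \<and> t \<in> S \<and> m s t = enat k}"

definition coxeter_group :: "'s set \<Rightarrow> ('s \<Rightarrow> 's \<Rightarrow> enat) \<Rightarrow> 's word set monoid" where
  "coxeter_group S m = presented_group S (coxeter_relators S m)"

definition irreducible_coxeter :: "'s set \<Rightarrow> ('s \<Rightarrow> 's \<Rightarrow> enat) \<Rightarrow> bool" where
  "irreducible_coxeter S m \<longleftrightarrow>
    (\<forall>s\<in>S. \<forall>t\<in>S. (s, t) \<in> {(u, v). u \<in> S \<and> v \<in> S \<and> 3 \<le> m u v}\<^sup>*)"


section \<open>Discrete affine reflection groups\<close>

definition affine_reflection :: "('e::euclidean_space \<Rightarrow> 'e) \<Rightarrow> bool" where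
  "affine_reflection r \<longleftrightarrow>
    (\<exists>p a. a \<noteq> 0 \<and> r = (\<lambda>x. x - (2 * ((x - p) \<bullet> a) / (a \<bullet> a)) *\<^sub>R a))"

text \<open>Affine reflections are bijective isometries, so the subgroup they generate in the group of all
  bijections consists of isometries. Discreteness refers to the topology of pointwise convergence (the library topology on
  functions), which on the isometry group of a Euclidean space coincides with the compact-open
  topology and with the Lie group topology.\<close>

definition discrete_reflection_group :: "('e::euclidean_space \<Rightarrow> 'e) monoid \<Rightarrow> bool" where
  "discrete_reflection_group \<Gamma> \<longleftrightarrow>
    (\<exists>R. (\<forall>r\<in>R. affine_reflection r) \<and> \<Gamma> = subgroup_generated (BijGroup UNIV) R) \<and>
    discrete (carrier \<Gamma>)"

text \<open>The dimension of the Euclidean space on which the group acts cannot be quantified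
  existentially in a definition; it is a type parameter.\<close>

definition affine_coxeter :: "'e::euclidean_space itself \<Rightarrow> 'w monoid \<Rightarrow> bool" where
  "affine_coxeter _ W \<longleftrightarrow> infinite (carrier W) \<and>
    (\<exists>\<Gamma> :: ('e \<Rightarrow> 'e) monoid. discrete_reflection_group \<Gamma> \<and> W \<cong> \<Gamma>)"


section \<open>Profinite completions\<close>

definition finite_index_normals :: "'a monoid \<Rightarrow> 'a set set" where
  "finite_index_normals G = {N. N \<lhd> G \<and> finite (rcosets\<^bsub>G\<^esub> N)}"

definition finitely_generated_group :: "'a monoid \<Rightarrow> bool" where
  "finitely_generated_group G \<longleftrightarrow>
    group G \<and> (\<exists>A. finite A \<and> A \<subseteq> carrier G \<and> generate G A = carrier G)"

definition residually_finite :: "'a monoid \<Rightarrow> bool" where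
  "residually_finite G \<longleftrightarrow>
    group G \<and> (\<forall>x \<in> carrier G. x \<noteq> \<one>\<^bsub>G\<^esub> \<longrightarrow> (\<exists>N \<in> finite_index_normals G. x \<notin> N))"

text \<open>The profinite completion is the inverse limit of the finite quotients. For \<open>N \<subseteq> M\<close> the
  projection from \<open>G Mod N\<close> to \<open>G Mod M\<close> sends a coset of \<open>N\<close> to the coset of \<open>M\<close> containing it,
  so compatibility of a family of cosets is inclusion.\<close>

definition profinite_completion :: "'a monoid \<Rightarrow> ('a set \<Rightarrow> 'a set) monoid" where
  "profinite_completion G =
    (product_group (finite_index_normals G) (\<lambda>N. G Mod N))
      \<lparr>carrier := {x \<in> \<Pi>\<^sub>E N \<in> finite_index_normals G. carrier (G Mod N).
        \<forall>N \<in> finite_index_normals G. \<forall>M \<in> finite_index_normals G. N \<subseteq> M \<longrightarrow> x N \<subseteq> x M}\<rparr>"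

definition profinite_topology :: "'a monoid \<Rightarrow> ('a set \<Rightarrow> 'a set) topology" where
  "profinite_topology G =
    subtopology
      (product_topology (\<lambda>N. discrete_topology (carrier (G Mod N))) (finite_index_normals G))
      (carrier (profinite_completion G))"

definition isomorphic_profinite_completions :: "'a monoid \<Rightarrow> 'b monoid \<Rightarrow> bool" where
  "isomorphic_profinite_completions G H \<longleftrightarrow>
    (\<exists>\<phi> \<in> iso (profinite_completion G) (profinite_completion H).
      homeomorphic_map (profinite_topology G) (profinite_topology H) \<phi>)"

end

theory Submission
  imports Defs "HOL-Algebra.FiniteProduct" "HOL-Algebra.Multiplicative_Group" "HOL-Number_Theory.Cong"
begin

text \<open>
  A discrete affine reflection group splits as \<open>\<Gamma> = T \<rtimes> G\<close>, where the finite group \<open>G\<close> is generated by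
  reflections and \<open>T\<close> is a lattice with a basis of coroots; discreteness is exploited through
  Zassenhaus' commutator argument, which shows that there are only finitely many mirror directions.

  A finitely generated residually finite group \<open>H\<close> with the same profinite completion sits densely
  in \<open>T^ \<rtimes> G\<close>, where \<open>T^\<close> is the completion of \<open>T\<close>, and meets \<open>T^\<close> in a finitely
  generated subgroup \<open>A\<close> that is dense in \<open>T^\<close>. For a simple reflection \<open>s\<close> the elements of \<open>A\<close> in the
  image direction of \<open>1 - s\<close> form an infinite cyclic group, generated by a profinite unit times the
  coroot of \<open>s\<close>. Adjacent simple reflections yield units with rational quotient, hence equal units up to sign, because
  a rational profinite unit is \<open>1\<close> or \<open>-1\<close>. Rescaling the coordinates by these units identifies \<open>A\<close> with \<open>T\<close> as
  \<open>G\<close>-lattices, and the extension of \<open>G\<close> by \<open>A\<close> splits because it splits modulo \<open>card G\<close>.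
\<close>

section \<open>Systems of reflections\<close>

text \<open>Two obstacles shape the argument. Lattices for a finite group that agree over all p-adic
  integers need not be isomorphic over the integers; and a finitely generated dense subgroup of the
  profinite integers need not be cyclic, as the group generated by 1 and a generic profinite integer
  shows. Reflections meet both: in a basis of coroots \<open>1 - s\<close> has rank one, so the
  lattices are compared along single lines. Finite generation of \<open>H\<close> makes the
  \<open>N\<close>-th powers of \<open>A\<close> a subgroup of finite index in \<open>H\<close>,
  whence \<open>A\<close> meets \<open>N\<close> times the completed lattice exactly in its
  \<open>N\<close>-th powers. A Nakayama argument at the prime 3 then shows that what is visible
  modulo 3 controls the whole line. The prime has to be odd because \<open>1 - s\<close> acts as 2
  on its own line. On the geometric side, the constants 1/8, 5/8 and 1/32 serve a single purpose:
  the product of two reflections with close normals is a rotation so small that taking commutators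
  with it is a contraction.\<close>

definition refl_at :: "'e::euclidean_space \<Rightarrow> 'e \<Rightarrow> 'e \<Rightarrow> 'e" where
  "refl_at a p x = x - (2 * ((x - p) \<bullet> a)) *\<^sub>R a"

text \<open>Reflections are involutions, so words without inverse letters already form a group
  (\<open>compositions_inverse\<close>).\<close>

inductive_set compositions :: "('a \<Rightarrow> 'a) set \<Rightarrow> ('a \<Rightarrow> 'a) set" for R where
  id: "id \<in> compositions R"
| step: "r \<in> R \<Longrightarrow> f \<in> compositions R \<Longrightarrow> r \<circ> f \<in> compositions R"

lemma compositions_base: "r \<in> R \<Longrightarrow> r \<in> compositions R"
  using compositions.step[OF _ compositions.id, of r R] by simp

lemma compositions_comp: "f \<in> compositions R \<Longrightarrow> g \<in> compositions R \<Longrightarrow> f \<circ> g \<in> compositions R"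
  by (induction rule: compositions.induct) (auto simp: comp_assoc intro: compositions.step)

lemma compositions_subset:
  assumes "R \<subseteq> G" "id \<in> G" "\<And>f g. f \<in> G \<Longrightarrow> g \<in> G \<Longrightarrow> f \<circ> g \<in> G"
  shows "compositions R \<subseteq> G"
proof
  fix f assume "f \<in> compositions R" then show "f \<in> G"
  proof (induction rule: compositions.induct)
    case id show ?case by (rule assms(2))
  next
    case (step r f) then show ?case using assms(1,3) by blast
  qed
qed

lemma compositions_inverse:
  assumes "\<And>r. r \<in> R \<Longrightarrow> r \<circ> r = id" "f \<in> compositions R"
  shows "\<exists>g \<in> compositions R. f \<circ> g = id \<and> g \<circ> f = id"
  using assms(2)
proof (induction rule: compositions.induct)
  case id show ?case by (rule bexI[of _ id]) (auto intro: compositions.id)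
next
  case (step r f)
  then obtain g where g: "g \<in> compositions R" "f \<circ> g = id" "g \<circ> f = id" by blast
  have "(r \<circ> f) \<circ> (g \<circ> r) = r \<circ> (f \<circ> g) \<circ> r" "(g \<circ> r) \<circ> (r \<circ> f) = g \<circ> (r \<circ> r) \<circ> f"
    by (simp_all add: comp_assoc)
  then show ?case using g compositions_comp[OF g(1) compositions_base[OF step(1)]] assms(1)[OF step(1)]
    by (metis comp_id)
qed

lemma refl_at_self: "norm a = 1 \<Longrightarrow> refl_at a p (refl_at a p x) = x"
  by (simp add: refl_at_def inner_diff_left dot_square_norm algebra_simps)

lemma refl_at_comp_self: "norm a = 1 \<Longrightarrow> refl_at a p \<circ> refl_at a p = id"
  by (auto simp: refl_at_self)

lemma inner_refl_at: "norm a = 1 \<Longrightarrow> refl_at a 0 x \<bullet> refl_at a 0 y = x \<bullet> y"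
  by (simp add: refl_at_def inner_diff_left inner_diff_right dot_square_norm inner_commute[of a y])

lemma linear_refl_at: "linear (refl_at a 0)"
  by (rule linearI) (simp_all add: refl_at_def inner_add_left algebra_simps)

lemma orthogonal_transformation_refl_at: "norm a = 1 \<Longrightarrow> orthogonal_transformation (refl_at a 0)"
  by (simp add: orthogonal_transformation_def linear_refl_at inner_refl_at)

lemma unit_inner_bounds:
  assumes "norm a = 1" "norm b = 1" "a \<noteq> b" "a \<noteq> - b"
  shows "a \<bullet> b < 1" "- 1 < a \<bullet> b"
proof -
  have "(norm (a - b))\<^sup>2 = 2 - 2 * (a \<bullet> b)" "(norm (a + b))\<^sup>2 = 2 + 2 * (a \<bullet> b)"
    using assms by (simp_all add: power2_norm_eq_inner inner_diff inner_add inner_commute norm_eq_1)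
  moreover have "norm (a - b) > 0" "norm (a + b) > 0" using assms by (auto simp: add_eq_0_iff)
  ultimately show "a \<bullet> b < 1" "- 1 < a \<bullet> b" by (smt (verit) zero_less_power)+
qed

text \<open>Perturb the vector found for the smaller set along the new element: each vector to be
  avoided excludes at most one size of the perturbation.\<close>

lemma generic_vector:
  fixes X :: "'e::euclidean_space set"
  assumes "finite X" "0 \<notin> X"
  shows "\<exists>v. \<forall>x\<in>X. v \<bullet> x \<noteq> 0"
  using assms
proof (induction X)
  case empty then show ?case by simp
next
  case (insert x X)
  then obtain v where v: "\<forall>y\<in>X. v \<bullet> y \<noteq> 0" by auto
  have "finite ((\<lambda>y. - (v \<bullet> y) / (x \<bullet> y)) ` insert x X)" using insert by simp
  then obtain t where t: "t \<notin> (\<lambda>y. - (v \<bullet> y) / (x \<bullet> y)) ` insert x X"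
    using ex_new_if_finite[OF infinite_UNIV_char_0] by blast
  have "(v + t *\<^sub>R x) \<bullet> y \<noteq> 0" if "y \<in> insert x X" for y
  proof (cases "x \<bullet> y = 0")
    case True
    then show ?thesis using that v insert(3,4) by (auto simp: inner_add_left)
  next
    case False
    have "t \<noteq> - (v \<bullet> y) / (x \<bullet> y)" using t that by blast
    then show ?thesis using False by (auto simp: inner_add_left field_simps)
  qed
  then show ?case by blast
qed

text \<open>In a linear relation move the negative coefficients to the other side. Both sides equal
  one vector \<open>y\<close> whose square is a combination of inner products of obtuse pairs with
  nonnegative coefficients, so \<open>y = 0\<close>. Pairing with \<open>v\<close> then kills each
  coefficient, because all terms on a side have the same sign.\<close>

lemma obtuse_independent:
  fixes D :: "'e::euclidean_space set"
  assumes fin: "finite D" and pos: "\<And>a. a \<in> D \<Longrightarrow> v \<bullet> a > 0"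
    and obt: "\<And>a b. a \<in> D \<Longrightarrow> b \<in> D \<Longrightarrow> a \<noteq> b \<Longrightarrow> a \<bullet> b \<le> 0"
  shows "independent D"
proof (rule independent_if_scalars_zero[OF fin])
  fix f x assume s: "(\<Sum>x\<in>D. f x *\<^sub>R x) = 0" and x: "x \<in> D"
  define P where "P = {d\<in>D. f d > 0}"
  define Q where "Q = {d\<in>D. f d < 0}"
  define y where "y = (\<Sum>d\<in>P. f d *\<^sub>R d)"
  have "(\<Sum>x\<in>D. f x *\<^sub>R x) = (\<Sum>x\<in>P \<union> Q. f x *\<^sub>R x)"
    using fin by (intro sum.mono_neutral_right) (auto simp: P_def Q_def not_less_iff_gr_or_eq)
  also have "\<dots> = y + (\<Sum>d\<in>Q. f d *\<^sub>R d)"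
    unfolding y_def using fin by (intro sum.union_disjoint) (auto simp: P_def Q_def)
  finally have y2: "y = (\<Sum>d\<in>Q. (- f d) *\<^sub>R d)" using s by (simp add: sum_negf eq_neg_iff_add_eq_0)
  have "y \<bullet> y = (\<Sum>d\<in>P. f d *\<^sub>R d) \<bullet> (\<Sum>e\<in>Q. (- f e) *\<^sub>R e)"
    using y2 y_def by simp
  also have "\<dots> = (\<Sum>d\<in>P. \<Sum>e\<in>Q. (f d * (- f e)) * (d \<bullet> e))"
    unfolding inner_sum_left by (simp only: inner_sum_right inner_scaleR_left inner_scaleR_right mult_ac)
  also have "\<dots> \<le> 0"
    by (intro sum_nonpos mult_nonneg_nonpos mult_nonneg_nonneg obt) (auto simp: P_def Q_def)
  finally have "y \<bullet> y \<le> 0" .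
  then have "y = 0" by (metis antisym inner_ge_zero inner_eq_zero_iff)
  then have "v \<bullet> y = 0" by simp
  moreover have "v \<bullet> y = (\<Sum>d\<in>P. f d * (v \<bullet> d))" by (simp add: y_def inner_sum_right)
  moreover have "v \<bullet> y = (\<Sum>d\<in>Q. (- f d) * (v \<bullet> d))" by (simp add: y2 inner_sum_right)
  ultimately have "(\<Sum>d\<in>P. f d * (v \<bullet> d)) = 0" "(\<Sum>d\<in>Q. (- f d) * (v \<bullet> d)) = 0" by simp_all
  note sums = this
  have fins: "finite P" "finite Q" using fin by (auto simp: P_def Q_def)
  have "P = {}"
  proof (rule ccontr)
    assume "P \<noteq> {}"
    then have "(\<Sum>d\<in>P. f d * (v \<bullet> d)) > 0" by (intro sum_pos fins) (simp_all add: P_def pos)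
    then show False using sums(1) by simp
  qed
  moreover have "Q = {}"
  proof (rule ccontr)
    assume "Q \<noteq> {}"
    then have "(\<Sum>d\<in>Q. (- f d) * (v \<bullet> d)) > 0"
      by (intro sum_pos fins) (simp_all add: Q_def pos mult_neg_pos)
    then show False using sums(2) by simp
  qed
  ultimately have "P = {}" "Q = {}" by blast+
  then have "\<not> f x > 0" "\<not> f x < 0" using x by (auto simp: P_def Q_def)
  then show "f x = 0" by simp
qed

text \<open>Simple roots are selected by the height \<open>v \<bullet> b\<close>: a simple root
  forms no acute angle with a lower positive root. Obtuseness is thus built in, and a root that is
  not simple descends in height under the reflection in a lower root at an acute angle to
  it.\<close>

lemma simple_system:
  fixes \<Phi> :: "'e::euclidean_space set"
  assumes fin: "finite \<Phi>" and unit: "\<And>a. a \<in> \<Phi> \<Longrightarrow> norm a = 1"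
    and closed: "\<And>a b. a \<in> \<Phi> \<Longrightarrow> b \<in> \<Phi> \<Longrightarrow> refl_at a 0 b \<in> \<Phi>"
  obtains \<Delta> where "\<Delta> \<subseteq> \<Phi>" "independent \<Delta>"
    "\<And>b. b \<in> \<Phi> \<Longrightarrow> \<exists>w \<in> compositions ((\<lambda>a. refl_at a 0) ` \<Delta>). \<exists>a\<in>\<Delta>. b = w a"
proof -
  have minus: "- a \<in> \<Phi>" if "a \<in> \<Phi>" for a
    using closed[OF that that] unit[OF that] by (simp add: refl_at_def dot_square_norm scaleR_2)
  \<comment> \<open>The differences are avoided as well, so that distinct roots have distinct
    heights.\<close>
  have "{a - b | a b. a \<in> \<Phi> \<and> b \<in> \<Phi> \<and> a \<noteq> b} \<subseteq> (\<lambda>(a, b). a - b) ` (\<Phi> \<times> \<Phi>)" by auto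
  then have "finite {a - b | a b. a \<in> \<Phi> \<and> b \<in> \<Phi> \<and> a \<noteq> b}"
    by (rule finite_subset) (simp add: fin)
  then have fin2: "finite (\<Phi> \<union> {a - b | a b. a \<in> \<Phi> \<and> b \<in> \<Phi> \<and> a \<noteq> b})"
    using fin by (rule finite_UnI[rotated])
  have nz: "0 \<notin> \<Phi> \<union> {a - b | a b. a \<in> \<Phi> \<and> b \<in> \<Phi> \<and> a \<noteq> b}" using unit[of 0] by auto
  obtain v where v: "\<forall>x \<in> \<Phi> \<union> {a - b | a b. a \<in> \<Phi> \<and> b \<in> \<Phi> \<and> a \<noteq> b}. v \<bullet> x \<noteq> 0"
    using generic_vector[OF fin2 nz] by (rule exE)
  have v0: "v \<bullet> a \<noteq> 0" if "a \<in> \<Phi>" for a using v that by blast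
  have vinj: "v \<bullet> a \<noteq> v \<bullet> b" if "a \<in> \<Phi>" "b \<in> \<Phi>" "a \<noteq> b" for a b
  proof -
    have "v \<bullet> (a - b) \<noteq> 0" using v that by blast
    then show ?thesis by (simp add: inner_diff_right)
  qed
  define Pos where "Pos = {a\<in>\<Phi>. v \<bullet> a > 0}"
  define \<Delta> where "\<Delta> = {b\<in>Pos. \<forall>a\<in>Pos. v \<bullet> a < v \<bullet> b \<longrightarrow> a \<bullet> b \<le> 0}"
  let ?W = "compositions ((\<lambda>a. refl_at a 0) ` \<Delta>)"
  have \<Delta>\<Phi>: "\<Delta> \<subseteq> \<Phi>" by (auto simp: \<Delta>_def Pos_def)
  have ind: "independent \<Delta>"
  proof (rule obtuse_independent[of _ v])
    show "finite \<Delta>" using \<Delta>\<Phi> fin finite_subset by blast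
    fix a b assume ab: "a \<in> \<Delta>" "b \<in> \<Delta>"
    show "v \<bullet> a > 0" using ab by (auto simp: \<Delta>_def Pos_def)
    assume "a \<noteq> b"
    then have "v \<bullet> a \<noteq> v \<bullet> b" using vinj[of a b] ab \<Delta>\<Phi> by blast
    then have "v \<bullet> a < v \<bullet> b \<or> v \<bullet> b < v \<bullet> a" by linarith
    then show "a \<bullet> b \<le> 0" using ab by (auto simp: \<Delta>_def inner_commute)
  qed
  have lin: "linear w" if "w \<in> ?W" for w
    using that
  proof (induction rule: compositions.induct)
    case id show ?case by (rule linear_id)
  next
    case (step r f)
    then obtain a where "r = refl_at a 0" by blast
    then show ?case using linear_compose[OF step(3) linear_refl_at] by (simp only:)
  qed
  have orth: "w x \<bullet> w y = x \<bullet> y" if "w \<in> ?W" for w x y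
    using that
  proof (induction rule: compositions.induct)
    case id show ?case by simp
  next
    case (step r f)
    then obtain a where "a \<in> \<Delta>" "r = refl_at a 0" by blast
    then show ?case using step(3) inner_refl_at[OF unit] \<Delta>\<Phi> by auto
  qed
  have invol: "r \<circ> r = id" if "r \<in> (\<lambda>a. refl_at a 0) ` \<Delta>" for r
    using that refl_at_comp_self unit \<Delta>\<Phi> by blast
  have conj: "refl_at (w a) 0 \<in> ?W" if wa: "w \<in> ?W" "a \<in> \<Delta>" for w a
  proof -
    obtain w' where w': "w' \<in> ?W" "w \<circ> w' = id"
      using compositions_inverse[OF invol wa(1)] by blast
    have "refl_at (w a) 0 x = (w \<circ> (refl_at a 0 \<circ> w')) x" for x
    proof -
      have x: "w (w' x) = x" using w'(2) by (metis comp_apply id_apply)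
      then have "x \<bullet> w a = w' x \<bullet> a" using orth[OF that(1), of "w' x" a] by simp
      then show ?thesis using x
        by (simp add: refl_at_def linear_diff[OF lin[OF that(1)]] linear_scale[OF lin[OF that(1)]])
    qed
    then have "refl_at (w a) 0 = w \<circ> (refl_at a 0 \<circ> w')" by blast
    moreover have "refl_at a 0 \<in> ?W" using that(2) by (simp add: compositions_base)
    ultimately show ?thesis using that(1) w'(1) by (simp add: compositions_comp)
  qed
  have neg: "\<exists>w\<in>?W. \<exists>a\<in>\<Delta>. - b = w a" if b: "\<exists>w\<in>?W. \<exists>a\<in>\<Delta>. b = w a" for b
  proof -
    obtain w a where w: "w \<in> ?W" "a \<in> \<Delta>" "b = w a" using b by blast
    have "refl_at a 0 a = - a" using w unit \<Delta>\<Phi> by (auto simp: refl_at_def dot_square_norm scaleR_2)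
    then have "- b = (w \<circ> refl_at a 0) a" using w lin by (simp add: linear_neg)
    then show ?thesis using w by (blast intro: compositions_comp compositions_base)
  qed
  have main: "b \<in> Pos \<Longrightarrow> \<exists>w\<in>?W. \<exists>a\<in>\<Delta>. b = w a" for b
  proof (induction "card {a\<in>Pos. v \<bullet> a < v \<bullet> b}" arbitrary: b rule: less_induct)
    case less
    have smaller: "\<exists>w\<in>?W. \<exists>a\<in>\<Delta>. c = w a" if c: "c \<in> Pos" "v \<bullet> c < v \<bullet> b" for c
    proof (rule less.hyps[OF _ c(1)], rule psubset_card_mono)
      show "finite {a \<in> Pos. v \<bullet> a < v \<bullet> b}" using fin by (simp add: Pos_def)
      show "{a \<in> Pos. v \<bullet> a < v \<bullet> c} \<subset> {a \<in> Pos. v \<bullet> a < v \<bullet> b}" using c by auto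
    qed
    show ?case
    proof (cases "b \<in> \<Delta>")
      case True then show ?thesis by (intro bexI[of _ id] bexI[of _ b]) (auto intro: compositions.id)
    next
      case False
      then obtain a where a: "a \<in> Pos" "v \<bullet> a < v \<bullet> b" "a \<bullet> b > 0"
        using less.prems unfolding \<Delta>_def mem_Collect_eq by (meson not_le)
      have \<Phi>: "a \<in> \<Phi>" "b \<in> \<Phi>" using a less.prems by (auto simp: Pos_def)
      have lt1: "a \<bullet> b < 1"
      proof (rule unit_inner_bounds(1))
        show "norm a = 1" "norm b = 1" using unit \<Phi> by blast+
        show "a \<noteq> b" using a(2) by auto
        show "a \<noteq> - b" 
        proof
          assume "a = - b"
          then have "b \<bullet> b < 0" using a(3) by simp
          then show False using inner_ge_zero[of b] by linarith
        qed
      qed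
      obtain u d where u: "u \<in> ?W" "d \<in> \<Delta>" "a = u d" using smaller[OF a(1,2)] by blast
      have sa: "refl_at a 0 \<in> ?W" using conj[OF u(1,2)] u(3) by simp
      define c where "c = refl_at a 0 b"
      have c: "c \<in> \<Phi>" using closed[OF \<Phi>] c_def by simp
      \<comment> \<open>As \<open>(a \<bullet> b) * (v \<bullet> a)\<close> lies strictly between 0
        and \<open>v \<bullet> b\<close>, the height of \<open>c\<close> lies strictly between the
        heights of \<open>- b\<close> and \<open>b\<close>. So the induction hypothesis applies to
        \<open>c\<close> or to \<open>- c\<close>.\<close>
      have "v \<bullet> c = v \<bullet> b - 2 * (a \<bullet> b) * (v \<bullet> a)"
        by (simp add: c_def refl_at_def inner_diff_right inner_commute)
      moreover have va: "v \<bullet> a > 0" using a(1) by (simp add: Pos_def)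
      then have "0 < (a \<bullet> b) * (v \<bullet> a)" using a(3) by simp
      moreover have "(a \<bullet> b) * (v \<bullet> a) < v \<bullet> b"
        using mult_strict_right_mono[OF lt1 va] a(2) by linarith
      ultimately have vc: "v \<bullet> c < v \<bullet> b" "- (v \<bullet> c) < v \<bullet> b" by auto
      have "\<exists>w\<in>?W. \<exists>a\<in>\<Delta>. c = w a"
      proof (cases "v \<bullet> c > 0")
        case True then show ?thesis using smaller[of c] c vc by (simp add: Pos_def)
      next
        case False
        then have "- c \<in> Pos" using minus[OF c] v0[OF c] by (simp add: Pos_def)
        then have "\<exists>w\<in>?W. \<exists>a\<in>\<Delta>. - c = w a" using smaller[of "- c"] vc by simp
        then show ?thesis using neg[of "- c"] by simp
      qed
      then obtain w d' where w: "w \<in> ?W" "d' \<in> \<Delta>" "c = w d'" by blast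
      have "b = (refl_at a 0 \<circ> w) d'" using w(3) refl_at_self[OF unit[OF \<Phi>(1)], of 0 b] by (simp add: c_def)
      then show ?thesis using compositions_comp[OF sa w(1)] w(2) by blast
    qed
  qed
  have "\<exists>w\<in>?W. \<exists>a\<in>\<Delta>. b = w a" if "b \<in> \<Phi>" for b
  proof (cases "v \<bullet> b > 0")
    case True then show ?thesis using main that by (simp add: Pos_def)
  next
    case False
    then have "- b \<in> Pos" using minus[OF that] v0[OF that] by (simp add: Pos_def)
    then show ?thesis using neg[OF main[of "- b"]] by simp
  qed
  then show thesis by (rule that[OF \<Delta>\<Phi> ind])
qed

section \<open>Discrete groups of motions\<close>

text \<open>Discreteness is isolation of the identity, in a form with one constant: for an affine
  map the bound \<open>\<kappa> * (1 + norm x)\<close> controls the linear and the translation part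
  at once. It is derived from the topology of pointwise convergence in
  \<open>isolated_id_motions\<close>.\<close>

locale discrete_motions =
  fixes \<Gamma> :: "('e::euclidean_space \<Rightarrow> 'e) set"
  assumes id_mem: "id \<in> \<Gamma>"
    and comp_mem: "f \<in> \<Gamma> \<Longrightarrow> g \<in> \<Gamma> \<Longrightarrow> f \<circ> g \<in> \<Gamma>"
    and inverse_mem: "f \<in> \<Gamma> \<Longrightarrow> \<exists>g\<in>\<Gamma>. f \<circ> g = id \<and> g \<circ> f = id"
    and affine: "f \<in> \<Gamma> \<Longrightarrow> \<exists>C c. orthogonal_transformation C \<and> f = (\<lambda>x. C x + c)"
    and discrete: "\<exists>\<kappa>>0. \<forall>f\<in>\<Gamma>. (\<forall>x. norm (f x - x) \<le> \<kappa> * (1 + norm x)) \<longrightarrow> f = id"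

definition almost_id :: "real \<Rightarrow> real \<Rightarrow> ('e::euclidean_space \<Rightarrow> 'e) \<Rightarrow> bool" where
  "almost_id \<kappa> \<mu> f \<longleftrightarrow> (\<exists>C c. orthogonal_transformation C \<and> f = (\<lambda>x. C x + c) \<and>
    (\<forall>x. norm (C x - x) \<le> \<kappa> * norm x) \<and> norm c \<le> \<mu>)"

lemma orthogonal_transformation_inverse:
  fixes C :: "'e::euclidean_space \<Rightarrow> 'e"
  assumes "orthogonal_transformation C"
  obtains D where "orthogonal_transformation D" "\<And>x. C (D x) = x" "\<And>x. D (C x) = x"
proof (rule that[of "inv_into UNIV C"])
  show "orthogonal_transformation (inv_into UNIV C)" by (rule orthogonal_transformation_inv[OF assms])
  show "C (inv_into UNIV C x) = x" for x using orthogonal_transformation_surj[OF assms] by (rule surj_f_inv_f)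
  show "inv_into UNIV C (C x) = x" for x using orthogonal_transformation_inj[OF assms] by (rule inv_f_f)
qed

lemma orth_norm: "orthogonal_transformation C \<Longrightarrow> norm (C x) = norm x"
  by (simp add: orthogonal_transformation_norm)

lemma orth_inner: "orthogonal_transformation C \<Longrightarrow> C x \<bullet> C y = x \<bullet> y"
  by (simp add: orthogonal_transformation_def)

lemma orth_lin: "orthogonal_transformation C \<Longrightarrow> linear C"
  by (simp add: orthogonal_transformation_def)

text \<open>The commutator with a small rotation \<open>g\<close> about the origin is a contraction, as in
  Bieberbach's theorem.\<close>

lemma almost_id_commutator:
  fixes g f :: "'e::euclidean_space \<Rightarrow> 'e"
  assumes g: "orthogonal_transformation g" "\<And>x. norm (g x - x) \<le> norm x / 8" "\<And>x. g (g' x) = x" "\<And>x. g' (g x) = x"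
    and f: "almost_id \<kappa> \<mu> f" "\<kappa> \<le> 2" "\<And>x. f (f' x) = x"
  shows "almost_id (\<kappa> / 4) (\<mu> * (5/8)) (g \<circ> f \<circ> g' \<circ> f')"
proof -
  obtain C c where C: "orthogonal_transformation C" "f = (\<lambda>x. C x + c)"
    "\<And>x. norm (C x - x) \<le> \<kappa> * norm x" "norm c \<le> \<mu>"
    using f(1) unfolding almost_id_def by blast
  obtain D where D: "orthogonal_transformation D" "\<And>x. C (D x) = x" "\<And>x. D (C x) = x"
    by (rule orthogonal_transformation_inverse[OF C(1)], rule that)
  obtain B where B: "orthogonal_transformation B" "\<And>x. g (B x) = x" "\<And>x. B (g x) = x"
    by (rule orthogonal_transformation_inverse[OF g(1)], rule that)
  have g': "g' x = B x" for x using B(3)[of "g' x"] g(3) by simp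
  have f': "f' x = D (x - c)" for x
    using f(3)[of x] D(3)[of "f' x"] unfolding C(2) by (metis add_diff_cancel_right')
  note lins = orth_lin[OF C(1)] orth_lin[OF D(1)] orth_lin[OF B(1)] orth_lin[OF g(1)]
  define E where "E = g \<circ> C \<circ> B \<circ> D"
  have E: "orthogonal_transformation E"
    unfolding E_def by (intro orthogonal_transformation_compose C D B g)
  have eq: "(g \<circ> f \<circ> g' \<circ> f') x = E x + (g c - E c)" for x
    by (simp add: E_def C(2) g' f' linear_diff[OF lins(1)] linear_diff[OF lins(2)]
        linear_diff[OF lins(3)] linear_diff[OF lins(4)] linear_add[OF lins(4)])
  have bound: "norm (E x - x) \<le> \<kappa> / 4 * norm x" for x
  proof -
    define y where "y = B (D x)"
    have x: "x = C (g y)" by (simp add: y_def B D)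
    have ny: "norm y = norm x" by (simp add: y_def orth_norm B D)
    \<comment> \<open>With \<open>x = C (g y)\<close> the displacement is \<open>g C - C g\<close>
      at \<open>y\<close>, which is the commutator of \<open>g - 1\<close> and \<open>C - 1\<close>.
      This is why the two small quantities multiply.\<close>
    have "E x - x = (g (C y - y) - (C y - y)) - (C (g y - y) - (g y - y))"
      unfolding E_def x by (simp add: B D linear_diff[OF lins(1)] linear_diff[OF lins(4)])
    also have "norm \<dots> \<le> norm (g (C y - y) - (C y - y)) + norm (C (g y - y) - (g y - y))"
      by (rule norm_triangle_ineq4)
    also have "\<dots> \<le> norm (C y - y) / 8 + \<kappa> * norm (g y - y)"
      by (intro add_mono g(2) C(3))
    also have "\<dots> \<le> \<kappa> * norm y / 8 + \<kappa> * (norm y / 8)"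
    proof (intro add_mono mult_left_mono divide_right_mono C(3) g(2))
      show "\<kappa> \<ge> 0"
      proof -
        obtain b :: 'e where "b \<in> Basis" using nonempty_Basis by blast
        then have "norm (C b - b) \<le> \<kappa>" using C(3)[of b] by simp
        then show ?thesis using norm_ge_zero order_trans by blast
      qed
    qed simp
    finally show ?thesis using ny by simp
  qed
  have "norm (g c - E c) \<le> norm (g c - c) + norm (E c - c)"
    using norm_triangle_ineq4[of "g c - c" "E c - c"] by simp
  also have "\<dots> \<le> norm c / 8 + \<kappa> / 4 * norm c" by (intro add_mono g(2) bound)
  \<comment> \<open>The trivial bound 2 for orthogonal maps is good enough: 1/8 + 2/4 = 5/8 is below
    1.\<close>
  also have "\<dots> \<le> norm c / 8 + 2 / 4 * norm c"
    by (intro add_mono mult_right_mono) (use f(2) in auto)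
  also have "\<dots> \<le> \<mu> * (5/8)" using C(4) by simp
  finally have "norm (g c - E c) \<le> \<mu> * (5/8)" .
  then show ?thesis
    unfolding almost_id_def using E eq bound by (intro exI[of _ E] exI[of _ "g c - E c"] conjI ext allI) auto
qed

lemma linear_injective_self_image:
  fixes P :: "'e::euclidean_space set"
  assumes "subspace P" "linear f" "f ` P \<subseteq> P" "\<And>x. x \<in> P \<Longrightarrow> f x = 0 \<Longrightarrow> x = 0"
  shows "f ` P = P"
proof (rule subspace_dim_equal)
  show "subspace (f ` P)" using assms by (simp add: linear_subspace_image)
  have "inj_on f P"
  proof (rule inj_onI)
    fix x y assume "x \<in> P" "y \<in> P" "f x = f y"
    then have "x - y = 0"
      using assms(4)[of "x - y"] subspace_diff[OF assms(1)] linear_diff[OF assms(2)] by simp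
    then show "x = y" by simp
  qed
  then show "dim P \<le> dim (f ` P)"
    using dim_image_eq[OF assms(2), of P] span_eq_iff[THEN iffD2, OF assms(1)] by (simp only: order_refl)
qed (use assms in auto)

text \<open>Near the identity an orthogonal map of a plane cannot be a reflection, so both
  restrictions are rotations of one plane.\<close>

lemma plane_rotations_commute:
  fixes e1 e2 :: "'e::euclidean_space"
  assumes e: "norm e1 = 1" "norm e2 = 1" "e1 \<bullet> e2 = 0"
    and A: "orthogonal_transformation A" "\<And>x. norm (A x - x) \<le> norm x / 2" "A ` span {e1, e2} \<subseteq> span {e1, e2}"
    and B: "orthogonal_transformation B" "\<And>x. norm (B x - x) \<le> norm x / 2" "B ` span {e1, e2} \<subseteq> span {e1, e2}"
    and x: "x \<in> span {e1, e2}"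
  shows "A (B x) = B (A x)"
proof -
  have rot: "\<exists>c s. C e1 = c *\<^sub>R e1 + s *\<^sub>R e2 \<and> C e2 = (- s) *\<^sub>R e1 + c *\<^sub>R e2"
    if C: "orthogonal_transformation C" "\<And>x. norm (C x - x) \<le> norm x / 2" "C ` span {e1, e2} \<subseteq> span {e1, e2}" for C
  proof -
    have "C e1 \<in> span {e1, e2}" "C e2 \<in> span {e1, e2}" using C(3) by (auto simp: span_base)
    then obtain c s t u where cs: "C e1 = c *\<^sub>R e1 + s *\<^sub>R e2" "C e2 = t *\<^sub>R e1 + u *\<^sub>R e2"
      by (auto simp: span_insert span_empty) (metis add_diff_cancel_left' add.commute diff_add_cancel)
    have ee: "e1 \<bullet> e1 = 1" "e2 \<bullet> e2 = 1" "e2 \<bullet> e1 = 0" using e by (simp_all add: norm_eq_1 inner_commute)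
    have 1: "c * c + s * s = 1" "t * t + u * u = 1" "c * t + s * u = 0"
      using orth_inner[OF C(1), of e1 e1] orth_inner[OF C(1), of e2 e2] orth_inner[OF C(1), of e1 e2] e ee
      by (simp_all add: cs inner_add_left inner_add_right algebra_simps)
    \<comment> \<open>Positivity of both diagonal entries excludes the orthogonal matrices of
      determinant -1.\<close>
    have pos: "C v \<bullet> v > 0" if "norm v = 1" for v
    proof -
      have "(norm (C v - v))\<^sup>2 = 2 - 2 * (C v \<bullet> v)"
        using orth_inner[OF C(1), of v v] that
        by (simp add: power2_norm_eq_inner inner_diff inner_commute norm_eq_1)
      moreover have "(norm (C v - v))\<^sup>2 \<le> (1/2)\<^sup>2" using C(2)[of v] that by (intro power_mono) auto
      ultimately show ?thesis by (simp add: power2_eq_square)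
    qed
    have cu: "c > 0" "u > 0" using pos[OF e(1)] pos[OF e(2)] e ee by (simp_all add: cs inner_add_left)
    have "t = - s" "u = c"
    proof -
      have "u * u = c * c"
      proof -
        have "u * u = u * u * (c * c + s * s)" using 1 by simp
        also have "\<dots> = u * u * (c * c) + (s * u) * (s * u)" by (simp add: algebra_simps)
        also have "s * u = - (c * t)" using 1(3) by simp
        also have "u * u * (c * c) + - (c * t) * - (c * t) = (c * c) * (t * t + u * u)" by (simp add: algebra_simps)
        finally show ?thesis using 1 by simp
      qed
      then have "u\<^sup>2 = c\<^sup>2" by (simp add: power2_eq_square)
      then show "u = c" using cu by (simp add: power2_eq_iff)
      then have "c * (t + s) = 0" using 1(3) by (simp add: algebra_simps)
      then show "t = - s" using cu by simp
    qed
    then show ?thesis using cs by blast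
  qed
  obtain c s where a: "A e1 = c *\<^sub>R e1 + s *\<^sub>R e2" "A e2 = (- s) *\<^sub>R e1 + c *\<^sub>R e2" using rot[OF A] by blast
  obtain c' s' where b: "B e1 = c' *\<^sub>R e1 + s' *\<^sub>R e2" "B e2 = (- s') *\<^sub>R e1 + c' *\<^sub>R e2" using rot[OF B] by blast
  interpret A: linear A by (rule orth_lin[OF A(1)])
  interpret B: linear B by (rule orth_lin[OF B(1)])
  have "A (B e1) = B (A e1)" "A (B e2) = B (A e2)"
    by (simp_all only: a b A.add A.scale B.add B.scale) (simp_all add: algebra_simps)
  then have "(A \<circ> B) x = (B \<circ> A) x"
    by (intro linear_eq_on[OF linear_compose[OF B.linear_axioms A.linear_axioms]
          linear_compose[OF A.linear_axioms B.linear_axioms] x]) (elim insertE; simp)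
  then show ?thesis by simp
qed

section \<open>Iterated commutators with a small rotation\<close>

context discrete_motions begin

text \<open>Conjugation by a translation moves a chosen point to the origin. The isolation constant
  is divided by \<open>1 + norm p\<close>, since
  \<open>1 + norm (x - p) \<le> (1 + norm p) * (1 + norm x)\<close>.\<close>

lemma translate: "discrete_motions ((\<lambda>f x. f (x + p) - p) ` \<Gamma>)"
proof
  let ?t = "\<lambda>f x. f (x + p) - p"
  have t_comp: "?t f \<circ> ?t g = ?t (f \<circ> g)" for f g :: "'e \<Rightarrow> 'e" by (simp add: comp_def)
  have t_id: "?t id = id" by (simp add: id_def)
  show "id \<in> ?t ` \<Gamma>" using imageI[OF id_mem, of ?t] by (simp only: t_id)
  fix f assume "f \<in> ?t ` \<Gamma>"
  then obtain f0 where f0: "f0 \<in> \<Gamma>" "f = ?t f0" by blast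
  show "\<exists>g\<in>?t ` \<Gamma>. f \<circ> g = id \<and> g \<circ> f = id"
  proof -
    obtain g where g: "g \<in> \<Gamma>" "f0 \<circ> g = id" "g \<circ> f0 = id" using inverse_mem[OF f0(1)] by blast
    then have "f \<circ> ?t g = id" "?t g \<circ> f = id" unfolding f0(2) t_comp by (simp_all only: t_id)
    then show ?thesis using g(1) by blast
  qed
  show "\<exists>C c. orthogonal_transformation C \<and> f = (\<lambda>x. C x + c)"
  proof -
    obtain C c where C: "orthogonal_transformation C" "f0 = (\<lambda>x. C x + c)" using affine[OF f0(1)] by blast
    then have "f = (\<lambda>x. C x + (C p + c - p))"
      by (simp add: f0(2) linear_add[OF orth_lin] algebra_simps)
    then show ?thesis using C(1) by blast
  qed
  fix g assume "g \<in> ?t ` \<Gamma>"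
  then obtain g0 where g0: "g0 \<in> \<Gamma>" "g = ?t g0" by blast
  show "f \<circ> g \<in> ?t ` \<Gamma>"
    using imageI[OF comp_mem[OF f0(1) g0(1)], of ?t] by (simp only: f0(2) g0(2) t_comp)
next
  let ?t = "\<lambda>f x. f (x + p) - p"
  obtain \<kappa> where \<kappa>: "\<kappa> > 0" "\<And>f. f \<in> \<Gamma> \<Longrightarrow> (\<forall>x. norm (f x - x) \<le> \<kappa> * (1 + norm x)) \<Longrightarrow> f = id"
    using discrete by blast
  have "f = id" if f: "f \<in> ?t ` \<Gamma>" "\<forall>x. norm (f x - x) \<le> \<kappa> / (1 + norm p) * (1 + norm x)" for f
  proof -
    obtain f0 where f0: "f0 \<in> \<Gamma>" "f = ?t f0" using f(1) by blast
    have "norm (f0 x - x) \<le> \<kappa> * (1 + norm x)" for x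
    proof -
      have "norm (f0 x - x) \<le> \<kappa> / (1 + norm p) * (1 + norm (x - p))"
        using f(2)[rule_format, of "x - p"] by (simp add: f0(2))
      also have "\<dots> \<le> \<kappa> / (1 + norm p) * ((1 + norm p) * (1 + norm x))"
      proof (rule mult_left_mono)
        have "0 \<le> norm p * norm x" by simp
        then have "1 + norm (x - p) \<le> 1 + norm x + norm p + norm p * norm x"
          using norm_triangle_ineq4[of x p] by linarith
        then show "1 + norm (x - p) \<le> (1 + norm p) * (1 + norm x)" by (simp add: algebra_simps)
        show "0 \<le> \<kappa> / (1 + norm p)" using \<kappa>(1) by simp
      qed
      also have "\<dots> = \<kappa> * (1 + norm x)"
        using norm_ge_zero[of p] by (simp add: add_nonneg_eq_0_iff)
      finally show ?thesis .
    qed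
    then have "f0 = id" using \<kappa>(2)[OF f0(1)] by blast
    then show ?thesis by (simp add: f0(2) id_def)
  qed
  moreover have "\<kappa> / (1 + norm p) > 0" using \<kappa>(1) by (simp add: add_pos_nonneg)
  ultimately show "\<exists>\<kappa>>0. \<forall>f\<in>?t ` \<Gamma>. (\<forall>x. norm (f x - x) \<le> \<kappa> * (1 + norm x)) \<longrightarrow> f = id" by blast
qed

lemma bij: "f \<in> \<Gamma> \<Longrightarrow> bij f"
  using inverse_mem o_bij by metis

lemma inv_mem:
  assumes "f \<in> \<Gamma>"
  shows "inv_into UNIV f \<in> \<Gamma>" "f (inv_into UNIV f x) = x" "inv_into UNIV f (f x) = x"
proof -
  obtain g where g: "g \<in> \<Gamma>" "f \<circ> g = id" "g \<circ> f = id" using inverse_mem[OF assms] by blast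
  have "inv_into UNIV f = g" by (rule inv_unique_comp[OF g(2,3)])
  then show "inv_into UNIV f \<in> \<Gamma>" "f (inv_into UNIV f x) = x" "inv_into UNIV f (f x) = x"
    using g(1) fun_cong[OF g(2)] fun_cong[OF g(3)] by (simp_all only: comp_apply id_apply)
qed

text \<open>Each commutator divides the bound on the linear displacement by 4 and multiplies the
  bound on the translation by 5/8, starting from the trivial bound 2. Discreteness stops the
  sequence at the identity.\<close>

lemma iterated_commutator_trivial:
  assumes g: "g \<in> \<Gamma>" "orthogonal_transformation g" "\<And>x. norm (g x - x) \<le> norm x / 8" and f: "f \<in> \<Gamma>"
  defines "K \<equiv> \<lambda>f. g \<circ> f \<circ> inv_into UNIV g \<circ> inv_into UNIV f"
  shows "\<exists>n. (K ^^ n) f = id"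
proof -
  have K_mem: "K h \<in> \<Gamma>" if "h \<in> \<Gamma>" for h
    unfolding K_def by (intro comp_mem g inv_mem(1) that)
  have mem: "(K ^^ n) f \<in> \<Gamma>" for n by (induction n) (simp_all add: f K_mem)
  obtain C c where C: "orthogonal_transformation C" "f = (\<lambda>x. C x + c)" using affine[OF f] by blast
  have K_small: "almost_id (a / 4) (b * (5/8)) (K h)" if "almost_id a b h" "a \<le> 2" "h \<in> \<Gamma>" for a b h
    unfolding K_def
    by (rule almost_id_commutator[OF g(2,3) _ _ that(1,2)]) (rule inv_mem[OF g(1)] inv_mem[OF that(3)])+
  have small: "almost_id (2 * (1/4) ^ n) (norm c * (5/8) ^ n) ((K ^^ n) f)" for n
  proof (induction n)
    case 0
    have "norm (C x - x) \<le> 2 * norm x" for x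
      using norm_triangle_ineq4[of "C x" x] orth_norm[OF C(1), of x] by simp
    then show ?case unfolding almost_id_def using C by auto
  next
    case (Suc n)
    have "2 * (1/4) ^ n \<le> (2::real)" by (simp add: power_le_one)
    moreover have "(K ^^ Suc n) f = K ((K ^^ n) f)" by simp
    moreover have "(2::real) * (1/4) ^ Suc n = 2 * (1/4) ^ n / 4"
      "norm c * (5/8) ^ Suc n = norm c * (5/8) ^ n * (5/8)" by simp_all
    ultimately show ?case using K_small[OF Suc _ mem] by (simp only:)
  qed
  obtain \<kappa> where \<kappa>: "\<kappa> > 0" "\<And>f. f \<in> \<Gamma> \<Longrightarrow> (\<forall>x. norm (f x - x) \<le> \<kappa> * (1 + norm x)) \<Longrightarrow> f = id"
    using discrete by blast
  have pos: "0 < 2 + norm c" by (simp add: add_pos_nonneg)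
  then obtain n where n: "(5/8) ^ n < \<kappa> / (2 + norm c)"
    using real_arch_pow_inv[of "\<kappa> / (2 + norm c)" "5/8"] \<kappa>(1) by auto
  have "(2 + norm c) * (5/8) ^ n \<le> \<kappa>"
    using n pos_less_divide_eq[OF pos, of "(5/8) ^ n" \<kappa>] by (simp add: mult.commute)
  moreover have "0 \<le> norm c * (5/8) ^ n" "0 \<le> (5/8 :: real) ^ n" by simp_all
  moreover have "(1/4 :: real) ^ n \<le> (5/8) ^ n" by (intro power_mono) auto
  ultimately have le: "2 * (1/4) ^ n \<le> \<kappa>" "norm c * (5/8) ^ n \<le> \<kappa>"
    unfolding distrib_right by linarith+
  obtain D d where D: "(K ^^ n) f = (\<lambda>x. D x + d)" "\<And>x. norm (D x - x) \<le> 2 * (1/4) ^ n * norm x" "norm d \<le> norm c * (5/8) ^ n"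
    using small[of n] unfolding almost_id_def by blast
  have "norm ((K ^^ n) f x - x) \<le> \<kappa> * (1 + norm x)" for x
  proof -
    have "norm ((K ^^ n) f x - x) \<le> norm (D x - x) + norm d"
      using norm_triangle_ineq[of "D x - x" d] by (simp add: D(1) algebra_simps)
    also have "\<dots> \<le> \<kappa> * norm x + \<kappa>"
      by (intro add_mono order_trans[OF D(2)] order_trans[OF D(3)] le mult_right_mono) simp
    finally show ?thesis by (simp add: algebra_simps)
  qed
  then show ?thesis using \<kappa>(2)[OF mem] by blast
qed

text \<open>The conjugate of \<open>g\<close> by \<open>f\<close> fixes exactly the image under
  \<open>f\<close> of the fixed points of \<open>g\<close>. As \<open>g\<close> commutes with this
  conjugate, that image is stable under the inverse of \<open>g\<close>.\<close>

lemma commuting_conjugate_fixes: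
  assumes g: "g \<in> \<Gamma>" and f: "f \<in> \<Gamma>" and comm: "g \<circ> (f \<circ> g \<circ> inv_into UNIV f) = (f \<circ> g \<circ> inv_into UNIV f) \<circ> g"
    and y: "g y = y"
  shows "\<exists>z. g z = z \<and> f y = g (f z)"
proof -
  define h where "h = f \<circ> g \<circ> inv_into UNIV f"
  define z where "z = inv_into UNIV f (inv_into UNIV g (f y))"
  have "h (f y) = f y" using y inv_mem[OF f] by (simp add: h_def)
  moreover have "h (inv_into UNIV g w) = inv_into UNIV g (h w)" for w
    using comm inv_mem[OF g] unfolding h_def[symmetric] by (metis comp_apply)
  ultimately have "h (inv_into UNIV g (f y)) = inv_into UNIV g (f y)" by simp
  then have "g z = z" using inv_mem[OF f] unfolding h_def z_def by (metis comp_apply)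
  moreover have "f y = g (f z)" using inv_mem[OF f] inv_mem[OF g] by (simp add: z_def)
  ultimately show ?thesis by blast
qed

text \<open>The preceding lemma at the point 0 isolates the translation part; subtracting this case
  from the one at \<open>y\<close> isolates the linear part.\<close>

lemma commuting_conjugate_linear:
  assumes g: "g \<in> \<Gamma>" "linear g" and f: "f \<in> \<Gamma>" "linear C" "f = (\<lambda>x. C x + c)"
    and comm: "g \<circ> (f \<circ> g \<circ> inv_into UNIV f) = (f \<circ> g \<circ> inv_into UNIV f) \<circ> g"
  shows "\<exists>z. g z = z \<and> c - g c = g (C z)"
    and "g y = y \<Longrightarrow> \<exists>z. g z = z \<and> C y = g (C z)"
proof -
  note lin = linear_add[OF g(2)] linear_diff[OF g(2)] linear_add[OF f(2)] linear_diff[OF f(2)]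
    linear_0[OF g(2)] linear_0[OF f(2)]
  obtain z0 where z0: "g z0 = z0" "c = g (C z0 + c)"
    using commuting_conjugate_fixes[OF g(1) f(1) comm, of 0] by (auto simp: f(3) lin)
  have c0: "c - g c = g (C z0)" using z0(2) by (simp add: lin algebra_simps)
  then show "\<exists>z. g z = z \<and> c - g c = g (C z)" using z0(1) by blast
  assume "g y = y"
  then obtain z where z: "g z = z" "C y + c = g (C z + c)"
    using commuting_conjugate_fixes[OF g(1) f(1) comm, of y] by (auto simp: f(3))
  have "C y + (c - g c) = g (C z)" using z(2) by (simp add: lin algebra_simps)
  then have "C y = g (C (z - z0))" unfolding c0 by (simp add: lin eq_diff_eq)
  moreover have "g (z - z0) = z - z0" using z(1) z0(1) by (simp add: lin)
  ultimately show "\<exists>z. g z = z \<and> C y = g (C z)" by blast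
qed

end

section \<open>Small rotations in a plane, and the mirrors that do not contain their plane's
  complement direction\<close>

locale plane_rotation = discrete_motions +
  fixes g :: "'a::euclidean_space \<Rightarrow> 'a" and e1 e2 :: 'a
  assumes e: "norm e1 = 1" "norm e2 = 1" "e1 \<bullet> e2 = 0"
    and g_mem: "g \<in> \<Gamma>" and g_orth: "orthogonal_transformation g"
    and g_small: "\<And>x. norm (g x - x) \<le> norm x / 8"
    and g_fix: "\<And>x. g x = x \<longleftrightarrow> x \<bullet> e1 = 0 \<and> x \<bullet> e2 = 0"
begin

lemma g_lin: "linear g" by (rule orth_lin[OF g_orth])

lemma ee: "e1 \<bullet> e1 = 1" "e2 \<bullet> e2 = 1" "e2 \<bullet> e1 = 0"
  using e by (simp_all add: norm_eq_1 inner_commute)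

lemma in_plane: "x \<in> span {e1, e2} \<longleftrightarrow> (\<forall>y. g y = y \<longrightarrow> x \<bullet> y = 0)"
proof
  assume "x \<in> span {e1, e2}"
  then obtain a b where "x = a *\<^sub>R e1 + b *\<^sub>R e2"
    by (auto simp: span_insert span_empty) (metis add_diff_cancel_left' add.commute diff_add_cancel)
  then show "\<forall>y. g y = y \<longrightarrow> x \<bullet> y = 0"
    by (simp add: g_fix inner_add_left inner_commute[of e1] inner_commute[of e2])
next
  assume x: "\<forall>y. g y = y \<longrightarrow> x \<bullet> y = 0"
  define y where "y = x - (x \<bullet> e1) *\<^sub>R e1 - (x \<bullet> e2) *\<^sub>R e2"
  have gy: "g y = y" by (simp add: g_fix y_def inner_diff_left e ee)
  have "y \<bullet> y = x \<bullet> y - (x \<bullet> e1) * (e1 \<bullet> y) - (x \<bullet> e2) * (e2 \<bullet> y)"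
    by (subst (1) y_def) (simp add: inner_diff_left)
  also have "\<dots> = 0"
  proof -
    have "x \<bullet> y = 0" using x gy by blast
    moreover have "y \<bullet> e1 = 0 \<and> y \<bullet> e2 = 0" using gy unfolding g_fix .
    ultimately show ?thesis by (simp add: inner_commute[of e1 y] inner_commute[of e2 y])
  qed
  finally have "y = 0" by simp
  then have "x = (x \<bullet> e1) *\<^sub>R e1 + (x \<bullet> e2) *\<^sub>R e2" by (simp add: y_def algebra_simps)
  then show "x \<in> span {e1, e2}" by (metis insertI1 insertI2 singletonI span_add span_base span_scale)
qed

lemma displacement_in_plane: "g x - x \<in> span {e1, e2}"
  unfolding in_plane
proof (intro allI impI)
  fix y assume "g y = y"
  then have "g x \<bullet> y = x \<bullet> y" using orth_inner[OF g_orth, of x y] by simp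
  then show "(g x - x) \<bullet> y = 0" by (simp add: inner_diff_left)
qed

text \<open>Zassenhaus' lemma for one rotation. For \<open>y\<close> fixed by \<open>g\<close>,
  commuting with the conjugate makes \<open>C y\<close> orthogonal to all \<open>\<psi> x\<close>
  with \<open>x\<close> in the plane. As \<open>C\<close> is near the identity,
  \<open>\<psi>\<close> maps the plane onto itself, so \<open>C\<close> preserves the fixed space
  and then the plane. On the plane both maps are rotations, on the fixed space \<open>g\<close> is
  trivial.\<close>

lemma commutes_if_near:
  assumes f: "f \<in> \<Gamma>" "orthogonal_transformation C" "f = (\<lambda>x. C x + c)"
    and small: "\<And>x. norm (C x - x) \<le> norm x / 2"
    and comm: "g \<circ> (f \<circ> g \<circ> inv_into UNIV f) = (f \<circ> g \<circ> inv_into UNIV f) \<circ> g"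
  shows "g \<circ> f = f \<circ> g"
proof -
  let ?P = "span {e1, e2}"
  interpret g: linear g by (rule g_lin)
  interpret C: linear C by (rule orth_lin[OF f(2)])
  note cl = commuting_conjugate_linear[OF g_mem g_lin f(1) C.linear_axioms f(3) comm]
  define \<psi> where "\<psi> x = g (C x) - C x" for x
  have \<psi>_perp: "\<psi> x \<bullet> C y = 0" if x: "x \<in> ?P" and y: "g y = y" for x y
  proof -
    obtain z where z: "g z = z" "C y = g (C z)" using cl(2)[OF y] by blast
    have "g (C x) \<bullet> C y = x \<bullet> z" by (simp add: z(2) orth_inner[OF g_orth] orth_inner[OF f(2)])
    moreover have "C x \<bullet> C y = x \<bullet> y" by (simp add: orth_inner[OF f(2)])
    ultimately show ?thesis using x y z(1) by (simp add: \<psi>_def inner_diff_left in_plane)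
  qed
  have "\<psi> ` ?P = ?P"
  proof (rule linear_injective_self_image)
    show "subspace ?P" by simp
    show "linear \<psi>" unfolding \<psi>_def
      by (rule linearI) (simp_all add: g.add C.add g.scale C.scale algebra_simps)
    show "\<psi> ` ?P \<subseteq> ?P" using displacement_in_plane by (auto simp: \<psi>_def)
    fix x assume x: "x \<in> ?P" "\<psi> x = 0"
    then have "x \<bullet> C x = 0" by (simp add: \<psi>_def in_plane)
    \<comment> \<open>A kernel vector would be turned by a right angle, which is farther than
      \<open>small\<close> allows.\<close>
    then have "(norm (C x - x))\<^sup>2 = 2 * (norm x)\<^sup>2"
      using orth_inner[OF f(2), of x x] by (simp add: power2_norm_eq_inner inner_diff inner_commute)
    moreover have "(norm (C x - x))\<^sup>2 \<le> (norm x / 2)\<^sup>2" using small by (intro power_mono) auto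
    ultimately have "(norm x)\<^sup>2 \<le> 0" by (simp add: power_divide)
    then show "x = 0" by simp
  qed
  then have perp: "x \<bullet> C y = 0" if x: "x \<in> ?P" and y: "g y = y" for x y
  proof -
    have "x \<in> \<psi> ` ?P" using x \<open>\<psi> ` ?P = ?P\<close> by simp
    then obtain u where "u \<in> ?P" "x = \<psi> u" by blast
    then show ?thesis using \<psi>_perp[OF _ y] by simp
  qed
  have e_in: "e1 \<in> ?P" "e2 \<in> ?P" by (simp_all add: span_base)
  have C_fix: "g (C y) = C y" if y: "g y = y" for y
    unfolding g_fix[of "C y"] using perp[OF e_in(1) y] perp[OF e_in(2) y] by (simp add: inner_commute)
  obtain D where D: "orthogonal_transformation D" "\<And>x. C (D x) = x" "\<And>x. D (C x) = x"
    by (rule orthogonal_transformation_inverse[OF f(2)], rule that)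
  interpret D: linear D by (rule orth_lin[OF D(1)])
  have D_plane: "D ` ?P \<subseteq> ?P"
  proof
    fix x assume "x \<in> D ` ?P"
    then have "C x \<in> ?P" using D(2) by auto
    then have "x \<bullet> y = 0" if "g y = y" for y
      using perp[OF _ that] orth_inner[OF f(2), of x y] by simp
    then show "x \<in> ?P" by (simp add: in_plane)
  qed
  have D0: "x = 0" if "D x = 0" for x using D(2)[of x] C.zero unfolding that by simp
  have "D ` ?P = ?P"
    by (rule linear_injective_self_image[OF subspace_span D.linear_axioms D_plane]) (rule D0)
  have C_plane: "C ` ?P \<subseteq> ?P"
  proof
    fix x assume "x \<in> C ` ?P"
    then obtain y where "y \<in> D ` ?P" "x = C y" using \<open>D ` ?P = ?P\<close> by auto
    then show "x \<in> ?P" using D(2) by auto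
  qed
  have g_plane: "g ` ?P \<subseteq> ?P"
  proof
    fix x assume "x \<in> g ` ?P"
    then obtain y where "y \<in> ?P" "x = g y" by blast
    then show "x \<in> ?P" using span_add[OF displacement_in_plane[of y], of y] by simp
  qed
  have gC: "g (C x) = C (g x)" for x
  proof -
    define p where "p = (x \<bullet> e1) *\<^sub>R e1 + (x \<bullet> e2) *\<^sub>R e2"
    have p: "p \<in> ?P" unfolding p_def by (intro span_add span_scale span_base) auto
    have xp: "g (x - p) = x - p" unfolding g_fix by (simp add: p_def inner_diff_left inner_add_left e ee)
    have "norm (g y - y) \<le> norm y / 2" for y using g_small[of y] norm_ge_zero[of y] by linarith
    then have "g (C p) = C (g p)"
      using plane_rotations_commute[OF e g_orth _ g_plane f(2) small C_plane p] by blast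
    moreover have "g (C (x - p)) = C (g (x - p))" using C_fix[OF xp] xp by simp
    moreover have "x = p + (x - p)" by simp
    ultimately have "g (C p) + g (C (x - p)) = C (g p) + C (g (x - p))" by simp
    then show ?thesis by (simp add: g.add[symmetric] C.add[symmetric])
  qed
  \<comment> \<open>The difference \<open>c - g c\<close> lies in the fixed space by the conjugation
    relation and in the plane as a displacement, so it vanishes.\<close>
  have gc: "g c = c"
  proof -
    obtain z where z: "g z = z" "c - g c = g (C z)" using cl(1) by blast
    have "g (g (C z)) = g (C z)" using C_fix[OF z(1)] by simp
    then have "g (c - g c) = c - g c" using z(2) by simp
    moreover have "g c - c \<in> ?P" by (rule displacement_in_plane)
    ultimately have "(g c - c) \<bullet> (c - g c) = 0" by (simp add: in_plane)
    then have "(g c - c) \<bullet> (g c - c) = 0" by (simp add: inner_diff_left inner_diff_right algebra_simps)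
    then show ?thesis by simp
  qed
  show ?thesis by (rule ext) (simp add: f(3) g.add gC gc)
qed

text \<open>The commutator sequence of \<open>f\<close> ends at the identity, and commuting is
  carried back along it. If \<open>g\<close> commutes with \<open>K h\<close>, it commutes with its
  own conjugate by \<open>h\<close>; if \<open>h\<close> is itself a commutator, its linear part is
  near the identity and \<open>commutes_if_near\<close> yields \<open>h\<close> as well. At the
  arbitrary map \<open>f\<close> the conclusion stops at the conjugate.\<close>

lemma commutes_with_conjugates:
  assumes f: "f \<in> \<Gamma>"
  shows "g \<circ> (f \<circ> g \<circ> inv_into UNIV f) = (f \<circ> g \<circ> inv_into UNIV f) \<circ> g"
proof -
  define K where "K f = g \<circ> f \<circ> inv_into UNIV g \<circ> inv_into UNIV f" for f
  obtain n where n: "(K ^^ n) f = id"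
    using iterated_commutator_trivial[OF g_mem g_orth g_small f] unfolding K_def by blast
  have K_mem: "K h \<in> \<Gamma>" if "h \<in> \<Gamma>" for h
    unfolding K_def by (intro comp_mem g_mem inv_mem(1) that)
  have mem: "(K ^^ n) f \<in> \<Gamma>" for n by (induction n) (use f K_mem in auto)
  have conj: "g \<circ> (h \<circ> g \<circ> inv_into UNIV h) = (h \<circ> g \<circ> inv_into UNIV h) \<circ> g" if h: "h \<in> \<Gamma>" and c: "g \<circ> K h = K h \<circ> g" for h
  proof -
    have "g (h (inv_into UNIV g (inv_into UNIV h (g x)))) = g (g (h (inv_into UNIV g (inv_into UNIV h x))))" for x
      using fun_cong[OF c, of x] by (simp add: K_def)
    then have 1: "h (inv_into UNIV g (inv_into UNIV h (g x))) = g (h (inv_into UNIV g (inv_into UNIV h x)))" for x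
      using inv_mem[OF g_mem] by metis
    have "g (h (g (inv_into UNIV h x))) = h (g (inv_into UNIV h (g x)))" for x
      using 1[of "h (g (inv_into UNIV h x))"] inv_mem[OF g_mem] inv_mem[OF h] by metis
    then show ?thesis by (auto simp: fun_eq_iff)
  qed
  have near: "\<exists>C c. orthogonal_transformation C \<and> K h = (\<lambda>x. C x + c) \<and> (\<forall>x. norm (C x - x) \<le> norm x / 2)"
    if h: "h \<in> \<Gamma>" for h
  proof -
    obtain C c where C: "orthogonal_transformation C" "h = (\<lambda>x. C x + c)" using affine[OF h] by blast
    have "norm (C x - x) \<le> 2 * norm x" for x
      using norm_triangle_ineq4[of "C x" x] orth_norm[OF C(1), of x] by simp
    then have "almost_id 2 (norm c) h" unfolding almost_id_def using C by blast
    then have "almost_id (2 / 4) (norm c * (5/8)) (K h)" unfolding K_def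
      by (intro almost_id_commutator[OF g_orth g_small]) (simp_all add: inv_mem[OF g_mem] inv_mem[OF h])
    then show ?thesis unfolding almost_id_def by auto
  qed
  have K_step: "g \<circ> h = h \<circ> g" if "g \<circ> K h = K h \<circ> g" "h \<in> K ` \<Gamma>" for h
    using near commutes_if_near[of h] conj[of h] that K_mem by blast
  \<comment> \<open>The successor in the exponent restricts the descent to genuine commutators,
    which have a linear part near the identity.\<close>
  have "g \<circ> (K ^^ Suc m) f = (K ^^ Suc m) f \<circ> g" if "m \<le> n" for m
    using that
  proof (induction rule: inc_induct)
    case base
    have "K id = id" by (rule ext) (simp add: K_def inv_mem[OF g_mem])
    then have "(K ^^ Suc n) f = id" using n by simp
    then show ?case by (simp only: comp_id id_comp)
  next
    case (step m)
    have "(K ^^ Suc m) f = K ((K ^^ m) f)" by simp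
    then have "(K ^^ Suc m) f \<in> K ` \<Gamma>" using mem by blast
    moreover have "(K ^^ Suc (Suc m)) f = K ((K ^^ Suc m) f)" by (simp only: funpow.simps comp_apply)
    ultimately show ?case using K_step step(3) by (simp only:)
  qed
  from this[of 0] show ?thesis using conj[OF f] by simp
qed

text \<open>Here \<open>d\<close> is the signed distance of the mirror from the origin. The
  translation relation of \<open>commuting_conjugate_linear\<close> yields a fixed vector
  \<open>z\<close> in the span of \<open>a\<close> and \<open>w = g a - a\<close>; its inner
  products with \<open>a\<close> and with \<open>w\<close> give two equations that force
  \<open>d\<close> to be 0.\<close>

lemma reflection_fixes_center:
  assumes r: "refl_at a q \<in> \<Gamma>" and a: "norm a = 1" "g a \<noteq> a"
  shows "q \<bullet> a = 0"
proof -
  define d where "d = q \<bullet> a"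
  define w where "w = g a - a"
  interpret g: linear g by (rule g_lin)
  have aa: "a \<bullet> a = 1" using a(1) by (simp add: norm_eq_1)
  have eq: "refl_at a q = (\<lambda>x. refl_at a 0 x + (2 * d) *\<^sub>R a)"
    by (rule ext) (simp add: refl_at_def d_def inner_diff_left algebra_simps)
  obtain z where z: "g z = z" "(2 * d) *\<^sub>R a - g ((2 * d) *\<^sub>R a) = g (refl_at a 0 z)"
    using commuting_conjugate_linear(1)[OF g_mem g_lin r linear_refl_at eq commutes_with_conjugates[OF r]]
    by blast
  define t where "t = z \<bullet> a"
  have ga: "g a = a + w" by (simp add: w_def)
  have zeq: "z = (2 * t) *\<^sub>R a + (2 * t - 2 * d) *\<^sub>R w"
    using z(2) by (simp add: refl_at_def g.diff g.scale z(1) ga t_def[symmetric] algebra_simps)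
  define k where "k = w \<bullet> w"
  have wa: "w \<bullet> a = - k / 2"
    using orth_inner[OF g_orth, of a a] aa
    by (simp add: k_def w_def inner_diff_left inner_diff_right inner_commute[of a "g a"])
  have "norm w \<le> 1/8" using g_small[of a] a(1) by (simp add: w_def)
  then have "(norm w)\<^sup>2 \<le> (1/8)\<^sup>2" by (intro power_mono) auto
  moreover have "(norm w)\<^sup>2 = k" by (simp add: k_def power2_norm_eq_inner)
  \<comment> \<open>Smallness of the rotation enters here: the two equations reduce to
    \<open>d * (2 - k) = 0\<close>.\<close>
  ultimately have "k < 2" by (simp add: power2_eq_square)
  have "w \<noteq> 0" using a(2) by (simp add: w_def)
  then have "k \<noteq> 0" by (simp add: k_def)
  have wk: "(2 * t - 2 * d) * (w \<bullet> a) = - ((t - d) * k)" by (simp add: wa algebra_simps)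
  have "z \<bullet> a = (2 * t) * (a \<bullet> a) + (2 * t - 2 * d) * (w \<bullet> a)"
    by (subst zeq) (simp add: inner_add_left)
  then have 1: "t = (t - d) * k" using aa wk unfolding t_def[symmetric] by simp
  have "w \<bullet> z = 0" using displacement_in_plane[of a] z(1) unfolding in_plane w_def by blast
  then have "(2 * t) * (w \<bullet> a) + (2 * t - 2 * d) * (w \<bullet> w) = 0"
    by (subst (asm) zeq) (simp add: inner_add_right)
  then have "k * (t - 2 * d) = 0" unfolding wa k_def[symmetric] by (simp add: algebra_simps)
  then have 2: "t = 2 * d" using \<open>k \<noteq> 0\<close> by simp
  have "d * (2 - k) = 0" using 1 unfolding 2 by (simp add: algebra_simps)
  then show ?thesis using \<open>k < 2\<close> by (simp add: d_def)
qed

end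

text \<open>Since \<open>refl_at a p\<close> is an isometric involution, the product is compared
  with the square of \<open>refl_at a p\<close>, which leaves the difference of two
  reflections.\<close>

lemma norm_refl_at_diff:
  assumes "norm a = 1" "norm b = 1"
  shows "norm (refl_at a p (refl_at b p x) - x) \<le> 4 * norm (a - b) * norm (x - p)"
proof -
  define y where "y = x - p"
  have "refl_at a p (refl_at b p x) - x = refl_at a 0 (refl_at b 0 y) - refl_at a 0 (refl_at a 0 y)"
    unfolding refl_at_self[OF assms(1)] by (simp add: refl_at_def y_def diff_diff_eq add.commute)
  also have "norm \<dots> = norm (refl_at b 0 y - refl_at a 0 y)"
    by (simp only: linear_diff[OF linear_refl_at, symmetric]
        orth_norm[OF orthogonal_transformation_refl_at[OF assms(1)]])
  also have "refl_at b 0 y - refl_at a 0 y = (2 * (y \<bullet> a)) *\<^sub>R (a - b) + (2 * (y \<bullet> (a - b))) *\<^sub>R b"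
    by (simp add: refl_at_def inner_diff_right algebra_simps)
  also have "norm \<dots> \<le> 2 * \<bar>y \<bullet> a\<bar> * norm (a - b) + 2 * \<bar>y \<bullet> (a - b)\<bar> * norm b"
    by (rule order_trans[OF norm_triangle_ineq]) simp
  also have "\<dots> \<le> 2 * (norm y * norm a) * norm (a - b) + 2 * (norm y * norm (a - b)) * norm b"
    by (intro add_mono mult_right_mono mult_left_mono Cauchy_Schwarz_ineq2) auto
  finally show ?thesis using assms by (simp add: y_def)
qed

section \<open>Finitely many mirror directions\<close>

context discrete_motions begin

text \<open>The product of the two reflections is a plane rotation; 1/32 times the factor 4 of
  \<open>norm_refl_at_diff\<close> is the 1/8 required by \<open>plane_rotation\<close>. It moves
  \<open>b\<close>, because its fixed vectors are orthogonal to \<open>a1\<close>.\<close>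

lemma reflection_concurrent_origin:
  assumes a: "norm a1 = 1" "norm a2 = 1" "a1 \<noteq> a2" "a1 \<noteq> - a2" "norm (a1 - a2) \<le> 1/32"
    and r: "refl_at a1 0 \<in> \<Gamma>" "refl_at a2 0 \<in> \<Gamma>"
    and b: "refl_at b q \<in> \<Gamma>" "norm b = 1" "b \<bullet> a1 \<noteq> 0"
  shows "q \<bullet> b = 0"
proof -
  define t where "t = a2 \<bullet> a1"
  define v where "v = a2 - t *\<^sub>R a1"
  have aa: "a1 \<bullet> a1 = 1" "a2 \<bullet> a2 = 1" using a by (simp_all add: norm_eq_1)
  have v: "v \<noteq> 0"
  proof
    assume "v = 0"
    then have v2: "a2 = t *\<^sub>R a1" by (simp add: v_def)
    then have "\<bar>t\<bar> = 1" using a(1,2) by (metis norm_scaleR mult_cancel_left1 mult.commute)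
    then have "t = 1 \<or> t = - 1" by linarith
    then show False using a(3,4) v2 by auto
  qed
  define g where "g = refl_at a1 0 \<circ> refl_at a2 0"
  have fix_iff: "g x = x \<longleftrightarrow> x \<bullet> a1 = 0 \<and> x \<bullet> a2 = 0" for x
  proof
    assume "g x = x"
    then have "refl_at a2 0 x = refl_at a1 0 x"
      unfolding g_def comp_apply using refl_at_self[OF a(1), of 0 "refl_at a2 0 x"] by simp
    then have eq: "(x \<bullet> a2) *\<^sub>R a2 = (x \<bullet> a1) *\<^sub>R a1"
      by (simp add: refl_at_def scaleR_scaleR[symmetric] del: scaleR_scaleR)
    then have "((x \<bullet> a2) *\<^sub>R v) \<bullet> a1 = (((x \<bullet> a1) - (x \<bullet> a2) * t) *\<^sub>R a1) \<bullet> a1"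
      by (simp add: v_def scaleR_diff_right scaleR_diff_left)
    moreover have "v \<bullet> a1 = 0" using aa by (simp add: v_def t_def inner_diff_left)
    ultimately have xa: "x \<bullet> a1 = (x \<bullet> a2) * t" using aa by simp
    then have "(x \<bullet> a2) *\<^sub>R v = 0" using eq by (simp add: v_def scaleR_diff_right)
    then show "x \<bullet> a1 = 0 \<and> x \<bullet> a2 = 0" using v xa by simp
  qed (simp add: g_def refl_at_def)
  define e2 where "e2 = v /\<^sub>R norm v"
  have fix_iff2: "g x = x \<longleftrightarrow> x \<bullet> a1 = 0 \<and> x \<bullet> e2 = 0" for x
    unfolding fix_iff using v by (auto simp: e2_def v_def inner_diff_right)
  interpret plane_rotation \<Gamma> g a1 e2
  proof
    show "norm a1 = 1" "norm e2 = 1" using a v by (simp_all add: e2_def)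
    show "a1 \<bullet> e2 = 0" using aa by (simp add: e2_def v_def t_def inner_diff_right inner_commute)
    show "g \<in> \<Gamma>" unfolding g_def by (intro comp_mem r)
    show "orthogonal_transformation g" unfolding g_def
      by (intro orthogonal_transformation_compose orthogonal_transformation_refl_at a)
    show "norm (g x - x) \<le> norm x / 8" for x
    proof -
      have "norm (g x - x) \<le> 4 * norm (a1 - a2) * norm (x - 0)"
        unfolding g_def comp_apply by (rule norm_refl_at_diff[OF a(1,2)])
      also have "\<dots> \<le> 4 * (1/32) * norm (x - 0)" by (intro mult_right_mono mult_left_mono a(5)) auto
      finally show ?thesis by simp
    qed
    show "g x = x \<longleftrightarrow> x \<bullet> a1 = 0 \<and> x \<bullet> e2 = 0" for x by (rule fix_iff2)
  qed
  show ?thesis using reflection_fixes_center[OF b(1,2)] b(3) fix_iff by blast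
qed

lemma reflection_concurrent:
  assumes a: "norm a1 = 1" "norm a2 = 1" "a1 \<noteq> a2" "a1 \<noteq> - a2" "norm (a1 - a2) \<le> 1/32"
    and r: "refl_at a1 p \<in> \<Gamma>" "refl_at a2 p \<in> \<Gamma>"
    and b: "refl_at b q \<in> \<Gamma>" "norm b = 1" "b \<bullet> a1 \<noteq> 0"
  shows "q \<bullet> b = p \<bullet> b"
proof -
  interpret t: discrete_motions "(\<lambda>f x. f (x + p) - p) ` \<Gamma>" by (rule translate)
  have shift: "refl_at a (q - p) \<in> (\<lambda>f x. f (x + p) - p) ` \<Gamma>" if "refl_at a q \<in> \<Gamma>" for a q
  proof (rule image_eqI[OF _ that])
    show "refl_at a (q - p) = (\<lambda>x. refl_at a q (x + p) - p)" by (rule ext) (simp add: refl_at_def diff_diff_eq2)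
  qed
  have "(q - p) \<bullet> b = 0"
    using t.reflection_concurrent_origin[OF a _ _ shift[OF b(1)] b(2,3)] shift[OF r(1)] shift[OF r(2)] by simp
  then show ?thesis by (simp add: inner_diff_left)
qed

definition normals :: "'e set" where
  "normals = {a. norm a = 1 \<and> (\<exists>p. refl_at a p \<in> \<Gamma>)}"

end

text \<open>The prescribed values extend to a linear functional, and the point is the vector
  representing it.\<close>

lemma common_point_of_hyperplanes:
  fixes f :: "'e::euclidean_space \<Rightarrow> real"
  assumes "independent B"
  shows "\<exists>p. \<forall>b\<in>B. p \<bullet> b = f b"
proof -
  obtain h where h: "linear h" "\<forall>b\<in>B. h b = f b" using linear_independent_extend[OF assms] by blast
  have rep: "(\<Sum>i\<in>Basis. h i *\<^sub>R i) \<bullet> x = h x" for x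
  proof -
    have "h x = h (\<Sum>i\<in>Basis. (x \<bullet> i) *\<^sub>R i)" by (simp add: euclidean_representation)
    also have "\<dots> = (\<Sum>i\<in>Basis. (x \<bullet> i) * h i)" by (simp add: linear_sum[OF h(1)] linear_scale[OF h(1)])
    also have "\<dots> = (\<Sum>i\<in>Basis. h i * (i \<bullet> x))" by (simp add: inner_commute mult.commute)
    finally show ?thesis by (simp add: inner_sum_left)
  qed
  show ?thesis
    by (intro exI[of _ "\<Sum>i\<in>Basis. h i *\<^sub>R i"] ballI) (simp only: rep bspec[OF h(2)])
qed

lemma independent_unit_pair:
  fixes a b :: "'e::euclidean_space"
  assumes "norm a = 1" "norm b = 1" "a \<noteq> b" "a \<noteq> - b"
  shows "independent {a, b}"
proof -
  have "a \<notin> span {b}"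
  proof
    assume "a \<in> span {b}"
    then obtain k where k: "a = k *\<^sub>R b" by (auto simp: span_singleton)
    then have "\<bar>k\<bar> = 1" using assms(1,2) by simp
    then have "k = 1 \<or> k = - 1" by linarith
    then show False using k assms(3,4) by auto
  qed
  moreover have "b \<noteq> 0" using assms(2) by auto
  ultimately show ?thesis by (simp add: independent_insert)
qed

lemma infinite_bounded_close_points:
  fixes X :: "'e::euclidean_space set"
  assumes "infinite X" "bounded X" "\<delta> > 0"
  obtains Y where "Y \<subseteq> X" "infinite Y" "\<And>x y. x \<in> Y \<Longrightarrow> y \<in> Y \<Longrightarrow> dist x y < \<delta>"
proof -
  obtain l where "l islimpt X" using assms bounded_infinite_imp_islimpt by blast
  then have inf: "infinite (X \<inter> ball l (\<delta> / 2))" using assms(3) by (simp add: islimpt_eq_infinite_ball)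
  show thesis
  proof (rule that[OF _ inf])
    fix x y assume "x \<in> X \<inter> ball l (\<delta> / 2)" "y \<in> X \<inter> ball l (\<delta> / 2)"
    then show "dist x y < \<delta>" using dist_triangle_half_r[of l x \<delta> y] by (auto simp: dist_commute)
  qed auto
qed

context discrete_motions begin

text \<open>Infinitely many unit normals would accumulate. In a cluster of diameter at most 1/32,
  two mirrors share a point \<open>p\<close>, and by concurrency every normal of the cluster has a
  mirror through \<open>p\<close>. Two normals that are closer still then give a product of
  reflections near the identity, which must be trivial although the normals differ.\<close>

lemma finite_normals: "finite normals"
proof (rule ccontr)
  assume "infinite normals"
  moreover have "bounded normals" by (rule boundedI[of _ 1]) (auto simp: normals_def)
  ultimately obtain Y where Y: "Y \<subseteq> normals" "infinite Y" "\<And>x y. x \<in> Y \<Longrightarrow> y \<in> Y \<Longrightarrow> dist x y < 1/32"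
    by (rule infinite_bounded_close_points[of normals "1/32"]) (simp, rule that)
  have unit: "norm a = 1" if "a \<in> Y" for a using Y(1) that by (auto simp: normals_def)
  \<comment> \<open>Acute angles rule out antipodal pairs, and they provide the nonvanishing inner
    product that concurrency needs.\<close>
  have pos: "a \<bullet> b > 0" if "a \<in> Y" "b \<in> Y" for a b
  proof -
    have "(norm (a - b))\<^sup>2 = 2 - 2 * (a \<bullet> b)"
      using unit[OF that(1)] unit[OF that(2)]
      by (simp add: power2_norm_eq_inner inner_diff inner_commute norm_eq_1)
    moreover have "norm (a - b) < 1" using Y(3)[OF that] by (simp add: dist_norm)
    then have "(norm (a - b))\<^sup>2 < 1" by (simp add: abs_square_less_1)
    ultimately show ?thesis by simp
  qed
  have not_neg: "a \<noteq> - b" if "a \<in> Y" "b \<in> Y" for a b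
  proof
    assume "a = - b"
    then have "a \<bullet> b = - (b \<bullet> b)" by simp
    then show False using pos[OF that] inner_ge_zero[of b] by linarith
  qed
  obtain a1 where a1: "a1 \<in> Y" using infinite_imp_nonempty[OF Y(2)] by blast
  obtain a2 where a2: "a2 \<in> Y" "a1 \<noteq> a2"
    using infinite_imp_nonempty[OF infinite_remove[OF Y(2), of a1]] by blast
  have "a1 \<in> normals" "a2 \<in> normals" using a1 a2(1) Y(1) by blast+
  then obtain p1 p2 where p12: "refl_at a1 p1 \<in> \<Gamma>" "refl_at a2 p2 \<in> \<Gamma>" unfolding normals_def by blast
  have indep: "independent {a1, a2}"
    by (rule independent_unit_pair[OF unit[OF a1] unit[OF a2(1)] a2(2) not_neg[OF a1 a2(1)]])
  obtain p where p: "\<forall>b\<in>{a1, a2}. p \<bullet> b = (if b = a1 then p1 \<bullet> a1 else p2 \<bullet> a2)"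
    using common_point_of_hyperplanes[OF indep, of "\<lambda>b. if b = a1 then p1 \<bullet> a1 else p2 \<bullet> a2"] by (rule exE)
  have move: "refl_at a p = refl_at a q" if "p \<bullet> a = q \<bullet> a" for a q
    using that by (simp add: refl_at_def inner_diff_left fun_eq_iff)
  have r12: "refl_at a1 p \<in> \<Gamma>" "refl_at a2 p \<in> \<Gamma>"
    using p p12 move[of a1 p1] move[of a2 p2] a2(2) by auto
  have through: "refl_at b p \<in> \<Gamma>" if b: "b \<in> Y" for b
  proof -
    obtain q where q: "refl_at b q \<in> \<Gamma>" using b Y(1) by (auto simp: normals_def)
    have "norm (a1 - a2) \<le> 1/32" using Y(3)[OF a1 a2(1)] by (simp add: dist_norm)
    then have "q \<bullet> b = p \<bullet> b"
      using reflection_concurrent[OF unit[OF a1] unit[OF a2(1)] a2(2) not_neg[OF a1 a2(1)] _ r12 q unit[OF b]]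
        pos[OF b a1] by simp
    then show ?thesis using q move[of b q] by simp
  qed
  obtain \<kappa> where \<kappa>: "\<kappa> > 0" "\<And>f. f \<in> \<Gamma> \<Longrightarrow> (\<forall>x. norm (f x - x) \<le> \<kappa> * (1 + norm x)) \<Longrightarrow> f = id"
    using discrete by blast
  \<comment> \<open>Chosen such that \<open>4 * \<delta> * (1 + norm p) = \<kappa>\<close>, to match
    the bound for a product of two reflections through \<open>p\<close>.\<close>
  define \<delta> where "\<delta> = \<kappa> / 4 / (1 + norm p)"
  have p0: "0 < 1 + norm p" by (simp add: add_pos_nonneg)
  have \<delta>: "\<delta> > 0" using \<kappa>(1) p0 by (simp add: \<delta>_def)
  have "bounded Y" using \<open>bounded normals\<close> Y(1) bounded_subset by blast
  then obtain Z where Z: "Z \<subseteq> Y" "infinite Z" "\<And>x y. x \<in> Z \<Longrightarrow> y \<in> Z \<Longrightarrow> dist x y < \<delta>"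
    by (rule infinite_bounded_close_points[OF Y(2) _ \<delta>]) (rule that)
  obtain a where a: "a \<in> Z" using infinite_imp_nonempty[OF Z(2)] by blast
  obtain b where b: "b \<in> Z" "a \<noteq> b"
    using infinite_imp_nonempty[OF infinite_remove[OF Z(2), of a]] by blast
  have abY: "a \<in> Y" "b \<in> Y" using a b Z(1) by auto
  have "norm ((refl_at a p \<circ> refl_at b p) x - x) \<le> \<kappa> * (1 + norm x)" for x
  proof -
    have "norm ((refl_at a p \<circ> refl_at b p) x - x) \<le> 4 * norm (a - b) * norm (x - p)"
      unfolding comp_apply by (rule norm_refl_at_diff[OF unit[OF abY(1)] unit[OF abY(2)]])
    also have "\<dots> \<le> 4 * \<delta> * ((1 + norm p) * (1 + norm x))"
    proof (intro mult_mono mult_left_mono)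
      show "norm (a - b) \<le> \<delta>" using Z(3)[OF a b(1)] by (simp add: dist_norm)
      have "0 \<le> norm p * norm x" by simp
      then have "norm (x - p) \<le> 1 + norm x + norm p + norm p * norm x"
        using norm_triangle_ineq4[of x p] by linarith
      then show "norm (x - p) \<le> (1 + norm p) * (1 + norm x)" by (simp add: algebra_simps)
    qed (use \<delta> in auto)
    also have "\<dots> = 4 * (\<delta> * (1 + norm p)) * (1 + norm x)" by (simp only: mult.assoc)
    also have "\<delta> * (1 + norm p) = \<kappa> / 4"
      unfolding \<delta>_def using p0 by (metis less_irrefl nonzero_eq_divide_eq)
    also have "4 * (\<kappa> / 4) * (1 + norm x) = \<kappa> * (1 + norm x)" by simp
    finally show ?thesis .
  qed
  then have eq: "refl_at a p \<circ> refl_at b p = id"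
    using \<kappa>(2)[OF comp_mem[OF through[OF abY(1)] through[OF abY(2)]]] by blast
  have "refl_at b p (p + a) = refl_at a p (p + a)"
    using refl_at_self[OF unit[OF abY(1)], of p "refl_at b p (p + a)"] fun_cong[OF eq, of "p + a"] by simp
  then have "(a \<bullet> b) *\<^sub>R b = a" using unit[OF abY(1)]
    by (simp add: refl_at_def norm_eq_1 scaleR_scaleR[symmetric] del: scaleR_scaleR)
  then have "\<bar>a \<bullet> b\<bar> = 1" 
    using unit[OF abY(1)] unit[OF abY(2)] norm_scaleR[of "a \<bullet> b" b] by simp
  then have "a \<bullet> b = 1" using pos[OF abY] by simp
  then show False using \<open>(a \<bullet> b) *\<^sub>R b = a\<close> b(2) by simp
qed

end

section \<open>Lattices with reflections\<close>

text \<open>Lattice vectors are functions that vanish outside \<open>I\<close>; the value 0 there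
  makes equality of functions the same as equality of vectors.\<close>

definition lattice_act :: "'i set \<Rightarrow> ('i \<Rightarrow> 'i \<Rightarrow> int) \<Rightarrow> ('i \<Rightarrow> int) \<Rightarrow> 'i \<Rightarrow> int" where
  "lattice_act I A v i = (if i \<in> I then \<Sum>j\<in>I. A i j * v j else 0)"

definition lattice_semidirect :: "'i set \<Rightarrow> 'g monoid \<Rightarrow> ('g \<Rightarrow> 'i \<Rightarrow> 'i \<Rightarrow> int) \<Rightarrow> (('i \<Rightarrow> int) \<times> 'g) monoid" where
  "lattice_semidirect I G R =
    \<lparr>carrier = {(v, g). g \<in> carrier G \<and> (\<forall>i. i \<notin> I \<longrightarrow> v i = 0)},
     monoid.mult = (\<lambda>(v, g) (w, h). (\<lambda>i. v i + lattice_act I (R g) w i, g \<otimes>\<^bsub>G\<^esub> h)),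
     one = (\<lambda>_. 0, \<one>\<^bsub>G\<^esub>)\<rparr>"

text \<open>The algebraic residue of the geometry: \<open>c\<close> holds Cartan integers, and
  \<open>s i\<close> acts as the reflection that negates the \<open>i\<close>-th basis vector.
  \<open>R\<close> may have a kernel: generators with trivial action come from mirror directions
  that carry no translation.\<close>

locale reflection_lattice =
  fixes I :: "'i set" and G :: "'g monoid" and R :: "'g \<Rightarrow> 'i \<Rightarrow> 'i \<Rightarrow> int"
    and s :: "'i \<Rightarrow> 'g" and c :: "'i \<Rightarrow> 'i \<Rightarrow> int"
  assumes finite_I: "finite I" and group_G: "group G" and finite_G: "finite (carrier G)"
    and R_mult: "\<lbrakk>g \<in> carrier G; h \<in> carrier G; i \<in> I; k \<in> I\<rbrakk> \<Longrightarrow>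
      R (g \<otimes>\<^bsub>G\<^esub> h) i k = (\<Sum>j\<in>I. R g i j * R h j k)"
    and R_one: "\<lbrakk>i \<in> I; k \<in> I\<rbrakk> \<Longrightarrow> R \<one>\<^bsub>G\<^esub> i k = (if i = k then 1 else 0)"
    and s_mem: "i \<in> I \<Longrightarrow> s i \<in> carrier G"
    and R_s: "\<lbrakk>i \<in> I; k \<in> I; j \<in> I\<rbrakk> \<Longrightarrow>
      R (s i) k j = (if k = j then 1 else 0) - (if k = i then c i j else 0)"
    and c_diag: "i \<in> I \<Longrightarrow> c i i = 2"
    and generated: "\<exists>S. S \<subseteq> carrier G \<and> generate G S = carrier G \<and>
      (\<forall>t\<in>S. t \<otimes>\<^bsub>G\<^esub> t = \<one>\<^bsub>G\<^esub> \<and>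
        ((\<exists>i\<in>I. t = s i) \<or> (\<forall>i\<in>I. \<forall>k\<in>I. R t i k = (if i = k then 1 else 0))))"

section \<open>Discrete reflection groups\<close>

definition map_group :: "('a \<Rightarrow> 'a) set \<Rightarrow> ('a \<Rightarrow> 'a) monoid" where
  "map_group X = \<lparr>carrier = X, monoid.mult = comp, one = id\<rparr>"

lemma map_group_simps [simp]:
  "carrier (map_group X) = X" "f \<otimes>\<^bsub>map_group X\<^esub> g = f \<circ> g" "\<one>\<^bsub>map_group X\<^esub> = id"
  by (simp_all add: map_group_def)

text \<open>The generator is the least positive element, or 0 for the trivial group. The value 0
  later marks directions without translations.\<close>

lemma discrete_subgroup_real_cyclic:
  fixes K :: "real set"
  assumes zero: "0 \<in> K" and diff: "\<And>x y. x \<in> K \<Longrightarrow> y \<in> K \<Longrightarrow> x - y \<in> K"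
    and \<epsilon>: "\<epsilon> > 0" "\<And>x. x \<in> K \<Longrightarrow> \<bar>x\<bar> < \<epsilon> \<Longrightarrow> x = 0"
  shows "\<exists>l. l \<in> K \<and> (\<forall>x\<in>K. \<exists>n::int. x = of_int n * l)"
proof (cases "K \<subseteq> {0}")
  case True then show ?thesis using zero by (intro exI[of _ 0]) auto
next
  case False
  then obtain y where y: "y \<in> K" "y \<noteq> 0" by blast
  have neg: "- x \<in> K" if "x \<in> K" for x using diff[OF zero that] by simp
  define P where "P = {x\<in>K. x > 0}"
  have "P \<noteq> {}" using y neg[of y] by (cases "y > 0") (auto simp: P_def)
  have bdd: "bdd_below P" by (rule bdd_belowI[of _ 0]) (auto simp: P_def)
  define l0 where "l0 = Inf P"
  obtain l where l: "l \<in> P" "l < l0 + \<epsilon>"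
    using cInf_lessD[OF \<open>P \<noteq> {}\<close>, of "l0 + \<epsilon>"] \<epsilon>(1) by (auto simp: l0_def)
  have least: "l \<le> x" if "x \<in> P" for x
  proof (rule ccontr)
    assume "\<not> l \<le> x"
    moreover have "l0 \<le> x" unfolding l0_def by (rule cInf_lower[OF that bdd])
    ultimately have "\<bar>l - x\<bar> < \<epsilon>" using l(2) by linarith
    moreover have "l - x \<in> K" using l(1) that diff by (simp add: P_def)
    ultimately have "l - x = 0" by (rule \<epsilon>(2)[rotated])
    then show False using \<open>\<not> l \<le> x\<close> by simp
  qed
  have mult: "of_int n * l \<in> K" for n :: int
  proof -
    have nat: "of_nat m * l \<in> K" for m :: nat
    proof (induction m)
      case 0 then show ?case using zero by simp
    next
      case (Suc m)
      have "l \<in> K" using l(1) by (simp add: P_def)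
      then have "of_nat m * l - (- l) \<in> K" by (intro diff Suc neg)
      then show ?case by (simp add: algebra_simps)
    qed
    show ?thesis
    proof (cases "n \<ge> 0")
      case True then show ?thesis using nat[of "nat n"] by simp
    next
      case False then show ?thesis using neg[OF nat[of "nat (- n)"]] by simp
    qed
  qed
  have "\<exists>n::int. x = of_int n * l" if x: "x \<in> K" for x
  proof
    have l0: "l > 0" using l(1) by (simp add: P_def)
    define r where "r = x - of_int \<lfloor>x / l\<rfloor> * l"
    have "of_int \<lfloor>x / l\<rfloor> * l \<le> x" by (rule floor_divide_lower[OF l0])
    moreover have "x < (of_int \<lfloor>x / l\<rfloor> + 1) * l" by (rule floor_divide_upper[OF l0])
    ultimately have "0 \<le> r" "r < l" by (simp_all add: r_def algebra_simps)
    moreover have "r \<in> K" unfolding r_def by (intro diff x mult)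
    ultimately have "r = 0" using least[of r] by (cases "r = 0") (auto simp: P_def)
    then show "x = of_int \<lfloor>x / l\<rfloor> * l" by (simp add: r_def)
  qed
  then show ?thesis using l(1) by (auto simp: P_def)
qed

locale discrete_reflections = discrete_motions +
  assumes gen: "\<Gamma> = compositions {r\<in>\<Gamma>. \<exists>a p. norm a = 1 \<and> r = refl_at a p}"
begin

lemma normals_unit: "a \<in> normals \<Longrightarrow> norm a = 1"
  by (simp add: normals_def)

lemma refl_at_conjugate:
  assumes "orthogonal_transformation C" "f = (\<lambda>x. C x + c)" "\<And>x. f (f' x) = x"
  shows "f \<circ> refl_at b q \<circ> f' = refl_at (C b) (f q)"
proof
  fix x
  have x: "x = C (f' x) + c" using assms(2,3) by simp
  interpret C: linear C by (rule orth_lin[OF assms(1)])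
  have "(x - f q) \<bullet> C b = (f' x - q) \<bullet> b"
    by (subst x) (simp add: assms(2) C.diff[symmetric] orth_inner[OF assms(1)])
  moreover have "f (refl_at b q (f' x)) = x - (2 * ((f' x - q) \<bullet> b)) *\<^sub>R C b"
    by (subst (2) x) (simp add: refl_at_def assms(2) C.diff C.scale)
  ultimately show "(f \<circ> refl_at b q \<circ> f') x = refl_at (C b) (f q) x"
    by (simp add: refl_at_def)
qed

lemma refl_at_affine: "refl_at a p = (\<lambda>x. refl_at a 0 x + (2 * (p \<bullet> a)) *\<^sub>R a)"
  by (rule ext) (simp add: refl_at_def inner_diff_left algebra_simps)

lemma normals_closed:
  assumes "a \<in> normals" "b \<in> normals"
  shows "refl_at a 0 b \<in> normals"
proof -
  obtain p q where pq: "refl_at a p \<in> \<Gamma>" "refl_at b q \<in> \<Gamma>" "norm a = 1" "norm b = 1"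
    using assms unfolding normals_def by blast
  note o = orthogonal_transformation_refl_at[OF pq(3)]
  have "refl_at a p \<circ> refl_at b q \<circ> refl_at a p = refl_at (refl_at a 0 b) (refl_at a p q)"
    by (rule refl_at_conjugate[OF o refl_at_affine refl_at_self[OF pq(3)]])
  then have "refl_at (refl_at a 0 b) (refl_at a p q) \<in> \<Gamma>" using pq comp_mem by metis
  moreover have "norm (refl_at a 0 b) = 1" using orth_norm[OF o] pq(4) by simp
  ultimately show ?thesis unfolding normals_def by blast
qed

end

section \<open>The finite reflection group at a special point, and the coroot lattice\<close>

locale special_point = discrete_reflections +
  fixes \<Delta> :: "'a set" and p :: 'a
  assumes \<Delta>_normals: "\<Delta> \<subseteq> normals" and \<Delta>_independent: "independent \<Delta>"
    and normals_orbit: "\<And>b. b \<in> normals \<Longrightarrow> \<exists>w \<in> compositions ((\<lambda>a. refl_at a 0) ` \<Delta>). \<exists>a\<in>\<Delta>. b = w a"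
    and refl_p: "\<And>a. a \<in> \<Delta> \<Longrightarrow> refl_at a p \<in> \<Gamma>"
begin

abbreviation "Wp \<equiv> compositions ((\<lambda>a. refl_at a p) ` \<Delta>)"

text \<open>The linear part of a map of \<open>Wp\<close>, since such a map fixes \<open>p\<close>.
  Written as conjugation by a translation, it respects composition of arbitrary maps.\<close>

definition lin :: "('a \<Rightarrow> 'a) \<Rightarrow> 'a \<Rightarrow> 'a" where "lin g x = g (p + x) - p"

lemma \<Delta>_unit: "a \<in> \<Delta> \<Longrightarrow> norm a = 1"
  using \<Delta>_normals normals_unit by blast

lemma lin_refl: "lin (refl_at a p) = refl_at a 0"
  by (rule ext) (simp add: lin_def refl_at_def)

lemma lin_id: "lin id = id"
  by (rule ext) (simp add: lin_def)

lemma lin_ident [simp]: "lin (\<lambda>x. x) = (\<lambda>x. x)"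
  by (rule ext) (simp add: lin_def)

lemma lin_comp: "lin (f \<circ> g) = lin f \<circ> lin g"
  by (rule ext) (simp add: lin_def)

lemma Wp_\<Gamma>: "Wp \<subseteq> \<Gamma>"
  by (rule compositions_subset) (use refl_p id_mem comp_mem in auto)

lemma Wp_orth: "g \<in> Wp \<Longrightarrow> orthogonal_transformation (lin g)"
proof (induction rule: compositions.induct)
  case id show ?case unfolding lin_id by (simp only: id_def orthogonal_transformation_id)
next
  case (step r f)
  then obtain a where "a \<in> \<Delta>" "r = refl_at a p" by blast
  then show ?case unfolding lin_comp
    using step(3) by (simp only: lin_refl orthogonal_transformation_compose
        orthogonal_transformation_refl_at \<Delta>_unit)
qed

lemma Wp_lin: "g \<in> Wp \<Longrightarrow> linear (lin g)"
  by (rule orth_lin[OF Wp_orth])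

lemma Wp_apply: "g x = lin g (x - p) + p"
  by (simp add: lin_def)

lemma Wp_apply_add: "g \<in> Wp \<Longrightarrow> g (x + v) = g x + lin g v"
  by (frule linear_add[OF Wp_lin, of g "x - p" v]) (simp add: lin_def algebra_simps)

lemma Wp_fix: "g \<in> Wp \<Longrightarrow> g p = p"
  by (frule linear_0[OF Wp_lin]) (simp add: lin_def)

lemma Wp_affine: "g \<in> Wp \<Longrightarrow> g = (\<lambda>x. lin g x + (p - lin g p))"
  by (rule ext, subst Wp_apply) (simp add: linear_diff[OF Wp_lin] algebra_simps)

lemma Wp_inverse:
  assumes "g \<in> Wp"
  shows "\<exists>h\<in>Wp. g \<circ> h = id \<and> h \<circ> g = id"
proof (rule compositions_inverse[OF _ assms])
  fix r assume "r \<in> (\<lambda>a. refl_at a p) ` \<Delta>"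
  then show "r \<circ> r = id" using refl_at_comp_self \<Delta>_unit by blast
qed

lemma normals_orbit':
  assumes "b \<in> normals"
  shows "\<exists>g\<in>Wp. \<exists>a\<in>\<Delta>. b = lin g a"
proof -
  have "\<exists>g\<in>Wp. w = lin g" if "w \<in> compositions ((\<lambda>a. refl_at a 0) ` \<Delta>)" for w
    using that
  proof (induction rule: compositions.induct)
    case id show ?case by (rule bexI[of _ id]) (rule lin_id[symmetric], rule compositions.id)
  next
    case (step r f)
    then obtain a g where "a \<in> \<Delta>" "r = refl_at a 0" "g \<in> Wp" "f = lin g" by blast
    then have "r \<circ> f = lin (refl_at a p \<circ> g)" "refl_at a p \<circ> g \<in> Wp"
      by (auto simp only: lin_comp lin_refl intro: compositions.step)
    then show ?case by blast
  qed
  then show ?thesis using normals_orbit[OF assms] by blast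
qed

text \<open>Each normal is the image of a simple one under the linear part of some \<open>g\<close>.
  Conjugation by \<open>g\<close>, which fixes \<open>p\<close>, keeps the mirror through
  \<open>p\<close>; so every mirror direction is realised at this one point.\<close>

lemma refl_Wp:
  assumes "b \<in> normals"
  shows "refl_at b p \<in> Wp"
proof -
  obtain g a where ga: "g \<in> Wp" "a \<in> \<Delta>" "b = lin g a" using normals_orbit'[OF assms] by blast
  obtain h where h: "h \<in> Wp" "g \<circ> h = id" using Wp_inverse[OF ga(1)] by blast
  have gh: "g (h x) = x" for x using fun_cong[OF h(2), of x] by simp
  have "g \<circ> refl_at a p \<circ> h = refl_at b p"
    using refl_at_conjugate[OF Wp_orth[OF ga(1)] Wp_affine[OF ga(1)] gh, of a p] Wp_fix[OF ga(1)] ga(3) by simp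
  moreover have "g \<circ> refl_at a p \<circ> h \<in> Wp"
    using compositions_comp[OF compositions_comp[OF ga(1) compositions_base] h(1)] ga(2) by blast
  ultimately show ?thesis by simp
qed

lemma lin_normals: "g \<in> Wp \<Longrightarrow> b \<in> normals \<Longrightarrow> lin g b \<in> normals"
proof (induction arbitrary: b rule: compositions.induct)
  case id then show ?case by (simp add: lin_id)
next
  case (step r f)
  then obtain a where a: "a \<in> \<Delta>" "r = refl_at a p" by blast
  have eq: "lin (r \<circ> f) b = refl_at a 0 (lin f b)" by (simp only: lin_comp a(2) lin_refl comp_apply)
  show ?case unfolding eq by (rule normals_closed[OF subsetD[OF \<Delta>_normals a(1)] step(3)[OF step(4)]])
qed

lemma displacement_span: "g \<in> Wp \<Longrightarrow> lin g x - x \<in> span normals"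
proof (induction rule: compositions.induct)
  case id then show ?case by (simp add: lin_id span_zero)
next
  case (step r f)
  then obtain a where a: "a \<in> \<Delta>" "r = refl_at a p" by blast
  have "lin (r \<circ> f) x - x = (lin f x - x) - (2 * (lin f x \<bullet> a)) *\<^sub>R a"
    unfolding lin_comp comp_apply a(2) lin_refl by (simp add: refl_at_def)
  also have "\<dots> \<in> span normals"
    using a(1) \<Delta>_normals by (intro span_diff step(3) span_scale span_base) auto
  finally show ?case .
qed

text \<open>An element is determined by how it permutes the finitely many normals: for two elements
  that agree there, the difference of their values lies in the span of the normals and is also
  orthogonal to it.\<close>

lemma finite_Wp: "finite Wp"
proof (rule finite_imageD)
  let ?r = "\<lambda>g. restrict (lin g) normals"
  show "finite (?r ` Wp)"
  proof (rule finite_subset)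
    show "?r ` Wp \<subseteq> normals \<rightarrow>\<^sub>E normals" using lin_normals by auto
    show "finite (normals \<rightarrow>\<^sub>E normals)" by (intro finite_PiE finite_normals)
  qed
  show "inj_on ?r Wp"
  proof (rule inj_onI)
    fix g h assume gh: "g \<in> Wp" "h \<in> Wp" "?r g = ?r h"
    have eq: "lin g b = lin h b" if "b \<in> normals" for b
      using fun_cong[OF gh(3), of b] that by simp
    have "inj_on (lin g) normals"
      using orthogonal_transformation_inj[OF Wp_orth[OF gh(1)]] inj_on_subset by blast
    moreover have "lin g ` normals \<subseteq> normals" using lin_normals[OF gh(1)] by (rule image_subsetI)
    ultimately have surj: "lin g ` normals = normals" by (intro endo_inj_surj[OF finite_normals])
    have "lin g x = lin h x" for x
    proof -
      define u where "u = lin g x - lin h x"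
      have "u = (lin g x - x) - (lin h x - x)" by (simp add: u_def)
      then have u: "u \<in> span normals" using displacement_span gh(1,2) by (simp only: span_diff)
      have "u \<bullet> b = 0" if "b \<in> normals" for b
      proof -
        have "b \<in> lin g ` normals" using that by (simp only: surj)
        then obtain b' where b': "b' \<in> normals" "b = lin g b'" by blast
        have "lin g x \<bullet> b = x \<bullet> b'" by (simp add: b'(2) orth_inner[OF Wp_orth[OF gh(1)]])
        moreover have "lin h x \<bullet> b = x \<bullet> b'"
          by (simp add: b'(2) eq[OF b'(1)] orth_inner[OF Wp_orth[OF gh(2)]])
        ultimately show ?thesis by (simp add: u_def inner_diff_left)
      qed
      then have "orthogonal u u" by (intro orthogonal_to_span[OF u]) (simp add: orthogonal_def)
      then have "u = 0" by (simp add: orthogonal_self)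
      then show ?thesis by (simp add: u_def)
    qed
    then show "g = h" by (intro ext) (simp add: Wp_apply[of g] Wp_apply[of h])
  qed
qed

definition T :: "'a set" where "T = {v. (\<lambda>x. x + v) \<in> \<Gamma>}"

lemma T_zero: "0 \<in> T"
  using id_mem by (simp add: T_def id_def)

lemma T_diff:
  assumes "u \<in> T" "v \<in> T"
  shows "u - v \<in> T"
proof -
  obtain f where f: "f \<in> \<Gamma>" "(\<lambda>x. x + v) \<circ> f = id" using inverse_mem assms(2) by (auto simp: T_def)
  have "f = (\<lambda>x. x - v)" by (rule ext) (use fun_cong[OF f(2)] in \<open>simp add: eq_diff_eq\<close>)
  then have "(\<lambda>x. x + u) \<circ> (\<lambda>x. x - v) \<in> \<Gamma>" using assms(1) f(1) comp_mem by (simp add: T_def)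
  moreover have "(\<lambda>x. x + u) \<circ> (\<lambda>x. x - v) = (\<lambda>x. x + (u - v))" by (simp add: fun_eq_iff)
  ultimately show ?thesis by (simp add: T_def)
qed

lemma T_add: "u \<in> T \<Longrightarrow> v \<in> T \<Longrightarrow> u + v \<in> T"
  using T_diff[of u "0 - v"] T_diff[OF T_zero, of v] by simp

lemma T_lin:
  assumes "g \<in> Wp" "v \<in> T"
  shows "lin g v \<in> T"
proof -
  obtain h where h: "h \<in> Wp" "g \<circ> h = id" using Wp_inverse[OF assms(1)] by blast
  have "g \<circ> (\<lambda>x. x + v) \<circ> h = (\<lambda>x. x + lin g v)"
  proof
    fix x
    have "g (h x) = x" using fun_cong[OF h(2), of x] by simp
    then show "(g \<circ> (\<lambda>x. x + v) \<circ> h) x = x + lin g v"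
      by (simp add: Wp_apply_add[OF assms(1)])
  qed
  moreover have "g \<circ> (\<lambda>x. x + v) \<circ> h \<in> \<Gamma>"
    using assms h Wp_\<Gamma> by (intro comp_mem) (auto simp: T_def)
  ultimately show ?thesis by (simp add: T_def)
qed

lemma T_discrete: "\<exists>\<epsilon>>0. \<forall>v\<in>T. norm v < \<epsilon> \<longrightarrow> v = 0"
proof -
  obtain \<kappa> where \<kappa>: "\<kappa> > 0" "\<And>f. f \<in> \<Gamma> \<Longrightarrow> (\<forall>x. norm (f x - x) \<le> \<kappa> * (1 + norm x)) \<Longrightarrow> f = id"
    using discrete by blast
  have "v = 0" if v: "v \<in> T" "norm v < \<kappa>" for v
  proof -
    have "norm ((\<lambda>x. x + v) x - x) \<le> \<kappa> * (1 + norm x)" for x :: 'a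
    proof -
      have "0 \<le> \<kappa> * norm x" using \<kappa>(1) by simp
      then show ?thesis using v(2) by (simp add: distrib_left)
    qed
    then have "(\<lambda>x. x + v) = id" using \<kappa>(2)[of "\<lambda>x. x + v"] v(1) by (simp add: T_def)
    then have "0 + v = 0" by (metis id_apply)
    then show ?thesis by simp
  qed
  then show ?thesis using \<kappa>(1) by blast
qed

lemma T_line:
  assumes "a \<in> \<Delta>"
  shows "\<exists>l. l *\<^sub>R a \<in> T \<and> (\<forall>x. x *\<^sub>R a \<in> T \<longrightarrow> (\<exists>n::int. x = of_int n * l))"
proof -
  obtain \<epsilon> where \<epsilon>: "\<epsilon> > 0" "\<And>v. v \<in> T \<Longrightarrow> norm v < \<epsilon> \<Longrightarrow> v = 0" using T_discrete by blast
  have "\<exists>l. l \<in> {x. x *\<^sub>R a \<in> T} \<and> (\<forall>x\<in>{x. x *\<^sub>R a \<in> T}. \<exists>n::int. x = of_int n * l)"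
  proof (rule discrete_subgroup_real_cyclic[OF _ _ \<epsilon>(1)])
    show "0 \<in> {x. x *\<^sub>R a \<in> T}" by (simp add: T_zero)
    show "x - y \<in> {x. x *\<^sub>R a \<in> T}" if "x \<in> {x. x *\<^sub>R a \<in> T}" "y \<in> {x. x *\<^sub>R a \<in> T}" for x y
      using that T_diff by (simp add: scaleR_diff_left)
    show "x = 0" if "x \<in> {x. x *\<^sub>R a \<in> T}" "\<bar>x\<bar> < \<epsilon>" for x
      using \<epsilon>(2)[of "x *\<^sub>R a"] that \<Delta>_unit[OF assms] by auto
  qed
  then show ?thesis by simp
qed

text \<open>For \<open>a\<close> in \<open>\<Delta>\<close> this is determined up to sign, and it is
  0 exactly if there is no nonzero translation along \<open>a\<close>. Thus \<open>coroot a\<close>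
  is a shortest translation in this direction, whatever its length in the classical
  normalisation.\<close>

definition scale :: "'a \<Rightarrow> real" where
  "scale a = (SOME l. l *\<^sub>R a \<in> T \<and> (\<forall>x. x *\<^sub>R a \<in> T \<longrightarrow> (\<exists>n::int. x = of_int n * l)))"

definition coroot :: "'a \<Rightarrow> 'a" where "coroot a = scale a *\<^sub>R a"

definition J :: "'a set" where "J = {a\<in>\<Delta>. scale a \<noteq> 0}"

lemma scale:
  assumes "a \<in> \<Delta>"
  shows "coroot a \<in> T" "x *\<^sub>R a \<in> T \<Longrightarrow> \<exists>n::int. x = of_int n * scale a"
  using someI_ex[OF T_line[OF assms], folded scale_def] by (auto simp: coroot_def)

lemma finite_J: "finite J"
  using finite_subset[OF \<Delta>_normals finite_normals] by (simp add: J_def)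

lemma J_\<Delta>: "a \<in> J \<Longrightarrow> a \<in> \<Delta>"
  by (simp add: J_def)

definition cartan :: "'a \<Rightarrow> 'a \<Rightarrow> int" where
  "cartan a b = (if scale a = 0 then 0 else SOME n. 2 * (coroot b \<bullet> a) = of_int n * scale a)"

text \<open>Subtracting from a translation vector its mirror image leaves a translation vector along
  \<open>a\<close>, hence an integral multiple of the generator. If the scale is 0, both sides
  vanish, in accordance with the default value in \<open>cartan\<close>.\<close>

lemma cartan:
  assumes "a \<in> \<Delta>" "b \<in> \<Delta>"
  shows "2 * (coroot b \<bullet> a) = of_int (cartan a b) * scale a"
proof -
  have "refl_at a p \<in> Wp" using assms(1) by (auto intro: compositions_base)
  then have "coroot b - refl_at a 0 (coroot b) \<in> T"
    using T_diff[OF scale(1)[OF assms(2)] T_lin[OF _ scale(1)[OF assms(2)]]] by (metis lin_refl)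
  then have "(2 * (coroot b \<bullet> a)) *\<^sub>R a \<in> T" by (simp add: refl_at_def)
  then have ex: "\<exists>n::int. 2 * (coroot b \<bullet> a) = of_int n * scale a" by (rule scale(2)[OF assms(1)])
  show ?thesis
  proof (cases "scale a = 0")
    case True then show ?thesis using ex by auto
  next
    case False then show ?thesis using someI_ex[OF ex] by (simp add: cartan_def)
  qed
qed

lemma refl_coroot:
  assumes "a \<in> \<Delta>" "b \<in> \<Delta>"
  shows "refl_at a 0 (coroot b) = coroot b - of_int (cartan a b) *\<^sub>R coroot a"
  using cartan[OF assms] by (simp add: refl_at_def coroot_def[of a])

lemma cartan_diag: "a \<in> J \<Longrightarrow> cartan a a = 2"
  using cartan[of a a] \<Delta>_unit[of a] by (simp add: J_def coroot_def norm_eq_1)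

definition comb :: "('a \<Rightarrow> int) \<Rightarrow> 'a" where "comb v = (\<Sum>a\<in>J. of_int (v a) *\<^sub>R coroot a)"

lemma comb_add: "comb (\<lambda>a. v a + w a) = comb v + comb w"
  by (simp add: comb_def scaleR_add_left sum.distrib)

lemma comb_unique:
  assumes "comb v = comb w" "a \<in> J"
  shows "v a = w a"
proof -
  have "(\<Sum>a\<in>J. ((of_int (v a) - of_int (w a)) * scale a) *\<^sub>R a) = comb v - comb w"
    by (simp add: comb_def coroot_def scaleR_diff_left sum_subtractf left_diff_distrib)
  then have sum: "(\<Sum>a\<in>J. ((of_int (v a) - of_int (w a)) * scale a) *\<^sub>R a) = 0" using assms(1) by simp
  have "independent J" using \<Delta>_independent by (rule independent_mono) (auto simp: J_def)
  from independentD[OF this finite_J order_refl sum assms(2)]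
  have "(of_int (v a) - of_int (w a)) * scale a = 0" .
  then show ?thesis using assms(2) by (simp add: J_def)
qed

lemma comb_T: "comb v \<in> T"
proof -
  have nat: "of_nat n *\<^sub>R u \<in> T" if "u \<in> T" for n u
    by (induction n) (simp_all add: T_zero T_add that scaleR_add_left)
  have int: "of_int n *\<^sub>R u \<in> T" if "u \<in> T" for n u
  proof (cases "n \<ge> 0")
    case True then show ?thesis using nat[OF that, of "nat n"] by simp
  next
    case False then show ?thesis using T_diff[OF T_zero nat[OF that, of "nat (- n)"]] by simp
  qed
  have "(\<Sum>a\<in>A. of_int (v a) *\<^sub>R coroot a) \<in> T" if "finite A" "A \<subseteq> J" for A
    using that by (induction A) (auto intro!: T_add T_zero int scale J_\<Delta>)
  then show ?thesis using finite_J by (simp add: comb_def)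
qed

lemma lin_coroot:
  assumes "g \<in> Wp"
  shows "b \<in> J \<Longrightarrow> \<exists>v. lin g (coroot b) = comb v"
  using assms
proof (induction arbitrary: b rule: compositions.induct)
  case id
  have "coroot b = comb (\<lambda>a. if a = b then 1 else 0)"
    using finite_J id by (simp add: comb_def if_distrib[of of_int] if_distrib[of "\<lambda>x. x *\<^sub>R _"] cong: if_cong)
  then show ?case by (auto simp: lin_id)
next
  case (step r f)
  then obtain a v where a: "a \<in> \<Delta>" "r = refl_at a p" and v: "lin f (coroot b) = comb v" by blast
  interpret r: linear "refl_at a 0" by (rule linear_refl_at)
  have "lin (r \<circ> f) (coroot b) = refl_at a 0 (comb v)" using a v by (simp add: lin_comp lin_refl)
  also have "\<dots> = (\<Sum>c\<in>J. of_int (v c) *\<^sub>R (coroot c - of_int (cartan a c) *\<^sub>R coroot a))"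
    unfolding comb_def r.sum by (intro sum.cong) (simp_all add: r.scale refl_coroot[OF a(1) J_\<Delta>])
  also have "\<dots> = comb v - of_int (\<Sum>c\<in>J. v c * cartan a c) *\<^sub>R coroot a"
    by (simp add: comb_def scaleR_diff_right sum_subtractf scaleR_sum_left)
  also have "\<dots> = comb (\<lambda>c. v c + (if c = a then - (\<Sum>c\<in>J. v c * cartan a c) else 0))"
  proof (cases "a \<in> J")
    case True
    then show ?thesis unfolding comb_add using finite_J
      by (simp add: comb_def[of "\<lambda>c. if c = a then _ else 0"] if_distrib[of of_int] if_distrib[of "\<lambda>x. x *\<^sub>R _"] cong: if_cong)
  next
    case False
    then have "coroot a = 0" using a(1) by (simp add: J_def coroot_def)
    moreover have "comb (\<lambda>c. if c = a then - (\<Sum>c\<in>J. v c * cartan a c) else 0) = 0"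
      unfolding comb_def using False by (intro sum.neutral) auto
    ultimately show ?thesis unfolding comb_add by simp
  qed
  finally show ?case by blast
qed

text \<open>Column \<open>b\<close> holds coordinates of the image of the coroot of
  \<open>b\<close>. By \<open>comb_unique\<close> the choice is determined on \<open>J\<close>,
  which is all that \<open>comb\<close> sees.\<close>

definition mat :: "('a \<Rightarrow> 'a) \<Rightarrow> 'a \<Rightarrow> 'a \<Rightarrow> int" where
  "mat g a b = (SOME v. lin g (coroot b) = comb v) a"

lemma mat: "g \<in> Wp \<Longrightarrow> b \<in> J \<Longrightarrow> lin g (coroot b) = comb (\<lambda>a. mat g a b)"
  using someI_ex[OF lin_coroot] by (simp add: mat_def)

lemma mat_eqI:
  assumes "g \<in> Wp" "b \<in> J" "lin g (coroot b) = comb v" "a \<in> J"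
  shows "mat g a b = v a"
  using comb_unique[of "\<lambda>a. mat g a b" v a] mat[OF assms(1,2)] assms(3,4) by simp

lemma lin_comb:
  assumes "g \<in> Wp"
  shows "lin g (comb v) = comb (lattice_act J (mat g) v)"
proof -
  interpret g: linear "lin g" by (rule Wp_lin[OF assms])
  have "lin g (comb v) = (\<Sum>b\<in>J. of_int (v b) *\<^sub>R comb (\<lambda>a. mat g a b))"
    unfolding comb_def[of v] g.sum by (intro sum.cong) (simp_all add: g.scale mat[OF assms])
  also have "\<dots> = (\<Sum>b\<in>J. \<Sum>a\<in>J. of_int (mat g a b * v b) *\<^sub>R coroot a)"
    by (simp add: comb_def scaleR_sum_right mult.commute)
  also have "\<dots> = (\<Sum>a\<in>J. \<Sum>b\<in>J. of_int (mat g a b * v b) *\<^sub>R coroot a)"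
    by (rule sum.swap)
  also have "\<dots> = comb (lattice_act J (mat g) v)"
    by (simp add: comb_def lattice_act_def scaleR_sum_left)
  finally show ?thesis .
qed

lemma comb_lattice_unit: "b \<in> J \<Longrightarrow> comb (\<lambda>a. if a = b then 1 else 0) = coroot b"
  using finite_J by (simp add: comb_def if_distrib[of of_int] if_distrib[of "\<lambda>x. x *\<^sub>R _"] cong: if_cong)

text \<open>Maps of this shape are closed under composition, so it suffices to treat reflections. A
  reflection differs from its parallel through \<open>p\<close> by a translation along the normal;
  moved to a simple direction, this translation is an integral multiple of a coroot.\<close>

lemma \<Gamma>_decomposition:
  assumes "f \<in> \<Gamma>"
  shows "\<exists>v. \<exists>g\<in>Wp. f = (\<lambda>x. g x + comb v)"
proof -
  let ?D = "{f. \<exists>v. \<exists>g\<in>Wp. f = (\<lambda>x. g x + comb v)}"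
  have "compositions {r\<in>\<Gamma>. \<exists>a p. norm a = 1 \<and> r = refl_at a p} \<subseteq> ?D"
  proof (rule compositions_subset)
    have "comb (\<lambda>_. 0) = 0" by (simp add: comb_def)
    then show "id \<in> ?D" using compositions.id[of "(\<lambda>a. refl_at a p) ` \<Delta>"]
      by (intro CollectI exI[of _ "\<lambda>_. 0"] bexI[of _ id]) (simp_all add: id_def)
    show "f1 \<circ> f2 \<in> ?D" if f12: "f1 \<in> ?D" "f2 \<in> ?D" for f1 f2
    proof -
      obtain v1 g1 v2 g2 where f: "g1 \<in> Wp" "f1 = (\<lambda>x. g1 x + comb v1)" "g2 \<in> Wp" "f2 = (\<lambda>x. g2 x + comb v2)"
        using f12 by blast
      have "f1 \<circ> f2 = (\<lambda>x. (g1 \<circ> g2) x + comb (\<lambda>i. v1 i + lattice_act J (mat g1) v2 i))"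
      proof
        fix x
        have "g1 (g2 x + comb v2) = g1 (g2 x) + lin g1 (comb v2)"
          by (rule Wp_apply_add[OF f(1)])
        then show "(f1 \<circ> f2) x = (g1 \<circ> g2) x + comb (\<lambda>i. v1 i + lattice_act J (mat g1) v2 i)"
          unfolding comb_add by (simp add: f(2,4) lin_comb[OF f(1)])
      qed
      then show ?thesis using compositions_comp[OF f(1,3)] by blast
    qed
    show "{r\<in>\<Gamma>. \<exists>a p. norm a = 1 \<and> r = refl_at a p} \<subseteq> ?D"
    proof
      fix r assume "r \<in> {r\<in>\<Gamma>. \<exists>a p. norm a = 1 \<and> r = refl_at a p}"
      then obtain b q where b: "r \<in> \<Gamma>" "norm b = 1" "r = refl_at b q" by blast
      then have bn: "b \<in> normals" by (auto simp: normals_def)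
      define k where "k = 2 * ((q - p) \<bullet> b)"
      have r: "r = (\<lambda>x. refl_at b p x + k *\<^sub>R b)"
        by (rule ext) (simp add: b(3) k_def refl_at_def inner_diff_left algebra_simps)
      have "r \<circ> refl_at b p = (\<lambda>x. x + k *\<^sub>R b)"
        by (rule ext) (simp add: r refl_at_self[OF b(2)])
      then have kb: "k *\<^sub>R b \<in> T"
        using comp_mem[OF b(1), of "refl_at b p"] refl_Wp[OF bn] Wp_\<Gamma> by (auto simp: T_def)
      obtain g a where ga: "g \<in> Wp" "a \<in> \<Delta>" "b = lin g a" using normals_orbit'[OF bn] by blast
      obtain h where h: "h \<in> Wp" "h \<circ> g = id" using Wp_inverse[OF ga(1)] by blast
      have "lin h (k *\<^sub>R b) = k *\<^sub>R a"
      proof -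
        have "lin h b = a" using lin_comp[of h g] h(2) lin_id ga(3) by (metis comp_apply id_apply)
        then show ?thesis by (simp add: linear_scale[OF Wp_lin[OF h(1)]])
      qed
      then have "k *\<^sub>R a \<in> T" using T_lin[OF h(1) kb] by simp
      then obtain n :: int where n: "k = of_int n * scale a" using scale(2)[OF ga(2)] by blast
      \<comment> \<open>If \<open>a\<close> is outside \<open>J\<close>, the line carries no
        translation, so \<open>k = 0\<close> and the mirror already passes through
        \<open>p\<close>.\<close>
      have "\<exists>v. k *\<^sub>R a = comb v"
      proof (cases "a \<in> J")
        case True
        have "comb (\<lambda>c. if c = a then n else 0) = of_int n *\<^sub>R coroot a"
          using finite_J True by (simp add: comb_def if_distrib[of of_int] if_distrib[of "\<lambda>x. x *\<^sub>R _"] cong: if_cong)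
        then show ?thesis using n by (intro exI[of _ "\<lambda>c. if c = a then n else 0"]) (simp add: coroot_def)
      next
        case False
        then have "k = 0" using n ga(2) by (simp add: J_def)
        then show ?thesis by (intro exI[of _ "\<lambda>_. 0"]) (simp add: comb_def)
      qed
      then obtain v where v: "k *\<^sub>R a = comb v" by blast
      have "k *\<^sub>R b = lin g (k *\<^sub>R a)" by (simp add: linear_scale[OF Wp_lin[OF ga(1)]] ga(3))
      then have "k *\<^sub>R b = comb (lattice_act J (mat g) v)" using v lin_comb[OF ga(1)] by simp
      then show "r \<in> ?D" using r refl_Wp[OF bn] by auto
    qed
  qed
  then show ?thesis using assms gen by blast
qed

lemma group_Wp: "group (map_group Wp)"
proof (rule groupI)
  fix x assume "x \<in> carrier (map_group Wp)"
  then show "\<exists>y\<in>carrier (map_group Wp). y \<otimes>\<^bsub>map_group Wp\<^esub> x = \<one>\<^bsub>map_group Wp\<^esub>"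
    using Wp_inverse[of x] by auto
qed (auto simp: compositions_comp compositions.id comp_assoc)

lemma reflection_lattice_Wp: "reflection_lattice J (map_group Wp) mat (\<lambda>a. refl_at a p) cartan"
proof (rule reflection_lattice.intro)
  have base: "refl_at a p \<in> Wp" if "a \<in> \<Delta>" for a using that by (auto intro: compositions_base)
  show "finite J" "group (map_group Wp)" "finite (carrier (map_group Wp))"
    by (simp_all add: finite_J group_Wp finite_Wp)
  show "mat (g \<otimes>\<^bsub>map_group Wp\<^esub> h) i k = (\<Sum>j\<in>J. mat g i j * mat h j k)"
    if "g \<in> carrier (map_group Wp)" "h \<in> carrier (map_group Wp)" "i \<in> J" "k \<in> J" for g h i k
  proof -
    have gh: "g \<in> Wp" "h \<in> Wp" using that by simp_all
    have eq: "lin (g \<circ> h) (coroot k) = comb (lattice_act J (mat g) (\<lambda>j. mat h j k))"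
      by (simp only: lin_comp comp_apply mat[OF gh(2) that(4)] lin_comb[OF gh(1)])
    have "mat (g \<circ> h) i k = lattice_act J (mat g) (\<lambda>j. mat h j k) i"
      by (rule mat_eqI[OF compositions_comp[OF gh] that(4) eq that(3)])
    then show ?thesis using that(3) by (simp add: lattice_act_def)
  qed
  show "mat \<one>\<^bsub>map_group Wp\<^esub> i k = (if i = k then 1 else 0)" if "i \<in> J" "k \<in> J" for i k
    using mat_eqI[OF compositions.id that(2), of "\<lambda>a. if a = k then 1 else 0" i] that comb_lattice_unit[OF that(2)]
    by (simp add: lin_id)
  show "refl_at i p \<in> carrier (map_group Wp)" if "i \<in> J" for i using base J_\<Delta>[OF that] by simp
  \<comment> \<open>Proved for all of \<open>\<Delta>\<close>: if \<open>a\<close> is outside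
    \<open>J\<close>, the correction term never occurs, and this gives the generators with trivial
    action.\<close>
  have mat_refl: "mat (refl_at a p) k j = (if k = j then 1 else 0) - (if k = a then cartan a j else 0)"
    if "a \<in> \<Delta>" "k \<in> J" "j \<in> J" for a k j
  proof -
    let ?v = "\<lambda>k. (if k = j then 1 else 0) + (if k = a then - cartan a j else 0)"
    have "comb (\<lambda>k. if k = a then - cartan a j else 0) = - (of_int (cartan a j) *\<^sub>R coroot a)"
    proof (cases "a \<in> J")
      case True
      then show ?thesis using finite_J
        by (simp add: comb_def if_distrib[of of_int] if_distrib[of "\<lambda>x. x *\<^sub>R _"] cong: if_cong)
    next
      case False
      then have "coroot a = 0" using that(1) by (simp add: J_def coroot_def)
      moreover have "comb (\<lambda>k. if k = a then - cartan a j else 0) = 0"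
        unfolding comb_def using False by (intro sum.neutral) auto
      ultimately show ?thesis by simp
    qed
    then have "comb ?v = refl_at a 0 (coroot j)"
      unfolding comb_add by (simp add: comb_lattice_unit[OF that(3)] refl_coroot[OF that(1) J_\<Delta>[OF that(3)]])
    then have "mat (refl_at a p) k j = ?v k"
      using mat_eqI[OF base[OF that(1)] that(3), of ?v k] that(2) by (simp only: lin_refl)
    then show ?thesis by simp
  qed
  show "mat (refl_at i p) k j = (if k = j then 1 else 0) - (if k = i then cartan i j else 0)"
    if "i \<in> J" "k \<in> J" "j \<in> J" for i k j by (rule mat_refl[OF J_\<Delta>[OF that(1)] that(2,3)])
  show "cartan i i = 2" if "i \<in> J" for i by (rule cartan_diag[OF that])
  let ?S = "(\<lambda>a. refl_at a p) ` \<Delta>"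
  have "?S \<subseteq> carrier (map_group Wp)" using base by auto
  moreover have "generate (map_group Wp) ?S = carrier (map_group Wp)"
  proof
    show "generate (map_group Wp) ?S \<subseteq> carrier (map_group Wp)"
      by (rule group.generate_incl[OF group_Wp \<open>?S \<subseteq> carrier (map_group Wp)\<close>])
    show "carrier (map_group Wp) \<subseteq> generate (map_group Wp) ?S"
    proof
      fix g assume "g \<in> carrier (map_group Wp)"
      then have "g \<in> Wp" by simp
      then show "g \<in> generate (map_group Wp) ?S"
      proof (induction rule: compositions.induct)
        case id show ?case using generate.one[of "map_group Wp" ?S] by (simp only: map_group_simps)
      next
        case (step r f)
        then show ?case using generate.eng[OF generate.incl[OF step(1)] step(3)] by (simp only: map_group_simps)
      qed
    qed
  qed
  moreover have "t \<otimes>\<^bsub>map_group Wp\<^esub> t = \<one>\<^bsub>map_group Wp\<^esub> \<and>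
      ((\<exists>i\<in>J. t = refl_at i p) \<or> (\<forall>i\<in>J. \<forall>k\<in>J. mat t i k = (if i = k then 1 else 0)))" if t: "t \<in> ?S" for t
  proof -
    obtain a where a: "a \<in> \<Delta>" "t = refl_at a p" using t by blast
    have "mat t i k = (if i = k then 1 else 0)" if "a \<notin> J" "i \<in> J" "k \<in> J" for i k
      using mat_refl[OF a(1) that(2,3)] that a(2) by auto
    then show ?thesis using a refl_at_comp_self[OF \<Delta>_unit[OF a(1)]] by (cases "a \<in> J") auto
  qed
  ultimately show "\<exists>S\<subseteq>carrier (map_group Wp). generate (map_group Wp) S = carrier (map_group Wp) \<and>
    (\<forall>t\<in>S. t \<otimes>\<^bsub>map_group Wp\<^esub> t = \<one>\<^bsub>map_group Wp\<^esub> \<and>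
      ((\<exists>i\<in>J. t = refl_at i p) \<or> (\<forall>i\<in>J. \<forall>k\<in>J. mat t i k = (if i = k then 1 else 0))))"
    by blast
qed

lemma semidirect_iso: "lattice_semidirect J (map_group Wp) mat \<cong> map_group \<Gamma>"
proof -
  let ?M = "lattice_semidirect J (map_group Wp) mat"
  let ?f = "\<lambda>(v, g) x. g x + comb v"
  have hom: "?f \<in> hom ?M (map_group \<Gamma>)"
  proof (rule homI)
    fix x assume "x \<in> carrier ?M"
    then obtain v g where x: "x = (v, g)" "g \<in> Wp" by (auto simp: lattice_semidirect_def)
    have "(\<lambda>x. x + comb v) \<circ> g \<in> \<Gamma>" using comb_T[of v] x(2) Wp_\<Gamma> by (intro comp_mem) (auto simp: T_def)
    then show "?f x \<in> carrier (map_group \<Gamma>)" by (simp add: x comp_def)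
    fix y assume "y \<in> carrier ?M"
    then obtain w h where y: "y = (w, h)" "h \<in> Wp" by (auto simp: lattice_semidirect_def)
    have "g (h z + comb w) = g (h z) + lin g (comb w)" for z by (rule Wp_apply_add[OF x(2)])
    then show "?f (x \<otimes>\<^bsub>?M\<^esub> y) = ?f x \<otimes>\<^bsub>map_group \<Gamma>\<^esub> ?f y"
      by (auto simp: lattice_semidirect_def x y comb_add lin_comb[OF x(2)] fun_eq_iff)
  qed
  moreover have "bij_betw ?f (carrier ?M) (carrier (map_group \<Gamma>))"
  proof (rule bij_betw_imageI)
    show "inj_on ?f (carrier ?M)"
    proof (rule inj_onI)
      fix x y assume "x \<in> carrier ?M" "y \<in> carrier ?M" and eq: "?f x = ?f y"
      then obtain v g w h where x: "x = (v, g)" "g \<in> Wp" "\<And>i. i \<notin> J \<Longrightarrow> v i = 0"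
        and y: "y = (w, h)" "h \<in> Wp" "\<And>i. i \<notin> J \<Longrightarrow> w i = 0"
        by (auto simp: lattice_semidirect_def)
      \<comment> \<open>Every element of \<open>Wp\<close> fixes \<open>p\<close>, so evaluation at
        \<open>p\<close> separates the translation from the finite part.\<close>
      have "comb v = comb w" using fun_cong[OF eq, of p] by (simp add: x y Wp_fix[OF x(2)] Wp_fix[OF y(2)])
      then have "v i = w i" for i
        using comb_unique[of v w i] x(3)[of i] y(3)[of i] by (cases "i \<in> J") simp_all
      then have "v = w" by (rule ext)
      moreover have "g = h" using fun_cong[OF eq] \<open>comb v = comb w\<close> by (auto simp: x y)
      ultimately show "x = y" using x y by simp
    qed
    show "?f ` carrier ?M = carrier (map_group \<Gamma>)"
    proof
      show "?f ` carrier ?M \<subseteq> carrier (map_group \<Gamma>)" by (rule hom_carrier[OF hom])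
      show "carrier (map_group \<Gamma>) \<subseteq> ?f ` carrier ?M"
      proof
        fix f assume "f \<in> carrier (map_group \<Gamma>)"
        then have "f \<in> \<Gamma>" by simp
        then obtain v g where f: "g \<in> Wp" "f = (\<lambda>x. g x + comb v)" using \<Gamma>_decomposition by blast
        let ?v = "\<lambda>i. if i \<in> J then v i else 0"
        have "comb ?v = comb v" unfolding comb_def by (intro sum.cong) simp_all
        then have "f = ?f (?v, g)" using f by simp
        moreover have "(?v, g) \<in> carrier ?M" using f by (simp add: lattice_semidirect_def)
        ultimately show "f \<in> ?f ` carrier ?M" by blast
      qed
    qed
  qed
  ultimately show ?thesis by (auto simp: is_iso_def iso_def)
qed

end

context discrete_reflections begin

theorem reflection_lattice_exists:
  "\<exists>(J :: 'a set) (G :: ('a \<Rightarrow> 'a) monoid) R s c.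
    reflection_lattice J G R s c \<and> lattice_semidirect J G R \<cong> map_group \<Gamma>"
proof -
  obtain \<Delta> where \<Delta>: "\<Delta> \<subseteq> normals" "independent \<Delta>"
    "\<And>b. b \<in> normals \<Longrightarrow> \<exists>w \<in> compositions ((\<lambda>a. refl_at a 0) ` \<Delta>). \<exists>a\<in>\<Delta>. b = w a"
    by (rule simple_system[OF finite_normals normals_unit normals_closed], assumption+) (rule that)
  have "\<forall>a\<in>\<Delta>. \<exists>q. refl_at a q \<in> \<Gamma>" using \<Delta>(1) by (auto simp: normals_def)
  then obtain q where q: "\<And>a. a \<in> \<Delta> \<Longrightarrow> refl_at a (q a) \<in> \<Gamma>" by metis
  \<comment> \<open>Independence of the simple normals lets one point lie on all the selected
    mirrors.\<close>
  obtain p where p: "\<forall>a\<in>\<Delta>. p \<bullet> a = q a \<bullet> a" using common_point_of_hyperplanes[OF \<Delta>(2)] by (rule exE)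
  have "refl_at a p = refl_at a (q a)" if "a \<in> \<Delta>" for a
    using p that by (simp add: refl_at_def inner_diff_left fun_eq_iff)
  then interpret special_point \<Gamma> \<Delta> p
    by unfold_locales (use \<Delta> q in auto)
  show ?thesis using reflection_lattice_Wp semidirect_iso by blast
qed

end

section \<open>Dense subgroups of the profinite lattice\<close>

text \<open>Nakayama's lemma by Gaussian elimination: modulo \<open>p\<close> the relations form a
  diagonal system with unit entries, so its determinant is nonzero. Allowing a factor
  \<open>u\<close> prime to \<open>p\<close> in place of 1 makes the hypothesis stable under
  elimination.\<close>

lemma nakayama_int:
  fixes D :: "('y \<Rightarrow> int) set" and p :: int
  assumes p: "prime p" and Y: "finite Y"
    and add: "\<And>f g. f \<in> D \<Longrightarrow> g \<in> D \<Longrightarrow> (\<lambda>z. f z + g z) \<in> D"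
    and mult: "\<And>k f. f \<in> D \<Longrightarrow> (\<lambda>z. k * f z) \<in> D"
    and rel: "\<And>y. y \<in> Y \<Longrightarrow> \<exists>u e. \<not> p dvd u \<and> (\<forall>z. z \<notin> Y \<longrightarrow> e z = 0) \<and>
      (\<lambda>z. u * of_bool (z = y) - p * e z) \<in> D"
  shows "\<exists>m. m \<noteq> 0 \<and> (\<forall>y\<in>Y. (\<lambda>z. m * of_bool (z = y)) \<in> D)"
  using Y rel
proof (induction Y)
  case empty then show ?case by (intro exI[of _ 1]) simp
next
  case (insert k Y)
  obtain u0 e0 where k: "\<not> p dvd u0" "\<And>z. z \<notin> insert k Y \<Longrightarrow> e0 z = 0"
    "(\<lambda>z. u0 * of_bool (z = k) - p * e0 z) \<in> D"
    using insert.prems[of k] by auto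
  \<comment> \<open>The contribution of the error term at \<open>k\<close> is absorbed in the
    coefficient, which stays prime to \<open>p\<close>.\<close>
  define u where "u = u0 - p * e0 k"
  define e where "e z = (if z = k then 0 else e0 z)" for z
  have u: "\<not> p dvd u" using k(1) by (simp add: u_def dvd_diff_left_iff)
  have "(\<lambda>z. u0 * of_bool (z = k) - p * e0 z) = (\<lambda>z. u * of_bool (z = k) - p * e z)"
    by (rule ext) (auto simp: u_def e_def)
  then have dk: "(\<lambda>z. u * of_bool (z = k) - p * e z) \<in> D" using k(3) by simp
  have "\<exists>m. m \<noteq> 0 \<and> (\<forall>y\<in>Y. (\<lambda>z. m * of_bool (z = y)) \<in> D)"
  proof (rule insert.IH)
    fix y assume y: "y \<in> Y"
    then obtain u1 e1 where 1: "\<not> p dvd u1" "\<And>z. z \<notin> insert k Y \<Longrightarrow> e1 z = 0"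
      "(\<lambda>z. u1 * of_bool (z = y) - p * e1 z) \<in> D"
      using insert.prems[of y] by auto
    have "y \<noteq> k" using y insert.hyps(2) by auto
    let ?e = "\<lambda>z. (if z = k then 0 else u * e1 z) + p * e1 k * e z"
    \<comment> \<open>Adding this multiple of the row of \<open>k\<close> clears the coordinate at
      \<open>k\<close>.\<close>
    have "(\<lambda>z. u * (u1 * of_bool (z = y) - p * e1 z) + p * e1 k * (u * of_bool (z = k) - p * e z)) \<in> D"
      by (intro add mult 1(3) dk)
    also have "(\<lambda>z. u * (u1 * of_bool (z = y) - p * e1 z) + p * e1 k * (u * of_bool (z = k) - p * e z))
      = (\<lambda>z. (u * u1) * of_bool (z = y) - p * ?e z)"
      by (rule ext) (use \<open>y \<noteq> k\<close> in \<open>auto simp: e_def algebra_simps\<close>)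
    finally have "(\<lambda>z. (u * u1) * of_bool (z = y) - p * ?e z) \<in> D" .
    moreover have "\<not> p dvd u * u1" using u 1(1) p by (simp add: prime_dvd_mult_iff)
    moreover have "\<forall>z. z \<notin> Y \<longrightarrow> ?e z = 0" using 1(2) k(2) by (simp add: e_def)
    ultimately show "\<exists>u e. \<not> p dvd u \<and> (\<forall>z. z \<notin> Y \<longrightarrow> e z = 0) \<and>
      (\<lambda>z. u * of_bool (z = y) - p * e z) \<in> D" by (intro exI conjI)
  qed
  then obtain m where m: "m \<noteq> 0" "\<And>y. y \<in> Y \<Longrightarrow> (\<lambda>z. m * of_bool (z = y)) \<in> D" by blast
  have zero: "(\<lambda>z. 0) \<in> D" using mult[OF dk, of 0] by simp
  have "(\<lambda>z. \<Sum>y\<in>Z. m * e y * of_bool (z = y)) \<in> D" if "finite Z" "Z \<subseteq> Y" for Z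
    using that
  proof (induction Z)
    case empty then show ?case using zero by simp
  next
    case (insert y Z)
    have "(\<lambda>z. e y * (m * of_bool (z = y)) + (\<Sum>y\<in>Z. m * e y * of_bool (z = y))) \<in> D"
      using insert by (intro add mult m(2)) auto
    then show ?case using insert by (simp add: mult_ac)
  qed
  then have "(\<lambda>z. \<Sum>y\<in>Y. m * e y * of_bool (z = y)) \<in> D" using insert.hyps by blast
  also have "(\<lambda>z. \<Sum>y\<in>Y. m * e y * of_bool (z = y)) = (\<lambda>z. m * e z)"
  proof
    fix z
    have "(\<Sum>y\<in>Y. m * e y * of_bool (z = y)) = (\<Sum>y\<in>Y. if z = y then m * e z else 0)"
      by (intro sum.cong) auto
    also have "\<dots> = (if z \<in> Y then m * e z else 0)" using insert.hyps by simp
    also have "\<dots> = m * e z" using k(2)[of z] by (auto simp: e_def)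
    finally show "(\<Sum>y\<in>Y. m * e y * of_bool (z = y)) = m * e z" .
  qed
  finally have me: "(\<lambda>z. m * e z) \<in> D" .
  \<comment> \<open>Back substitution into the row of \<open>k\<close>, once the other coordinates
    are solved.\<close>
  have "(\<lambda>z. m * (u * of_bool (z = k) - p * e z) + p * (m * e z)) \<in> D"
    by (rule add[OF mult[OF dk] mult[OF me]])
  also have "(\<lambda>z. m * (u * of_bool (z = k) - p * e z) + p * (m * e z)) = (\<lambda>z. (m * u) * of_bool (z = k))"
    by (rule ext) (simp add: algebra_simps)
  finally have "(\<lambda>z. (m * u) * of_bool (z = k)) \<in> D" .
  moreover have "(\<lambda>z. (m * u) * of_bool (z = y)) \<in> D" if "y \<in> Y" for y
    using mult[OF m(2)[OF that], of u] by (simp add: mult_ac)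
  moreover have "m * u \<noteq> 0" using m(1) u by auto
  ultimately show ?case by (intro exI[of _ "m * u"]) auto
qed

lemma int_subgroup_cyclic:
  fixes K :: "int set"
  assumes zero: "0 \<in> K" and diff: "\<And>a b. a \<in> K \<Longrightarrow> b \<in> K \<Longrightarrow> a - b \<in> K"
  shows "\<exists>g\<in>K. \<forall>a\<in>K. g dvd a"
proof (cases "K \<subseteq> {0}")
  case True then show ?thesis using zero by auto
next
  case False
  have neg: "- a \<in> K" if "a \<in> K" for a using diff[OF zero that] by simp
  have add: "a + b \<in> K" if "a \<in> K" "b \<in> K" for a b using diff[OF that(1) neg[OF that(2)]] by simp
  obtain a where a: "a \<in> K" "a \<noteq> 0" using False by blast
  then have "int (nat \<bar>a\<bar>) \<in> K" "nat \<bar>a\<bar> > 0" using neg by (auto simp: abs_if)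
  then have ex: "\<exists>n. n > 0 \<and> int n \<in> K" by blast
  define n where "n = (LEAST n. n > 0 \<and> int n \<in> K)"
  have n: "n > 0" "int n \<in> K" using LeastI_ex[OF ex] by (simp_all add: n_def)
  have mult: "int k * int n \<in> K" for k
    by (induction k) (simp_all add: zero add n distrib_right)
  have "int n dvd a" if "a \<in> K" for a
  proof -
    have "a div int n * int n \<in> K"
    proof (cases "a div int n \<ge> 0")
      case True then show ?thesis using mult[of "nat (a div int n)"] by simp
    next
      case False then show ?thesis using neg[OF mult[of "nat (- (a div int n))"]] by simp
    qed
    with that have "a - a div int n * int n \<in> K" by (rule diff)
    then have "a mod int n \<in> K" by (simp only: minus_div_mult_eq_mod)
    moreover have pos: "0 \<le> a mod int n" "a mod int n < int n" using n(1) by simp_all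
    ultimately have r: "int (nat (a mod int n)) \<in> K" by simp
    have "nat (a mod int n) < n" using pos by linarith
    then have "\<not> (nat (a mod int n) > 0 \<and> int (nat (a mod int n)) \<in> K)"
      unfolding n_def by (rule not_less_Least)
    then have "\<not> nat (a mod int n) > 0" by (rule contrapos_nn) (rule conjI[OF _ r])
    then have "a mod int n = 0" using pos by linarith
    then show ?thesis by (rule mod_0_imp_dvd)
  qed
  then show ?thesis by (intro bexI[OF _ n(2)] ballI)
qed

lemma lattice_act_scale: "lattice_act I A (\<lambda>j. k * v j) i = k * lattice_act I A v i"
  by (simp add: lattice_act_def sum_distrib_left mult_ac)

lemma lattice_act_cong_mod:
  assumes "\<And>j. j \<in> I \<Longrightarrow> [v j = w j] (mod n)"
  shows "[lattice_act I A v i = lattice_act I A w i] (mod n)"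
  unfolding lattice_act_def using assms by (auto intro!: cong_sum cong_mult)

text \<open>A homomorphism from \<open>H\<close> to the semidirect product of the completed lattice
  with \<open>G\<close>, recorded by integers \<open>x N h i\<close> that matter modulo
  \<open>N\<close> only. \<open>x_surj\<close> is density of the image; \<open>cofinal\<close> says
  that each finite index normal subgroup of \<open>H\<close> is open in the induced
  topology.\<close>

locale profinite_lattice_data =
  reflection_lattice I G R s c + H: group H
  for I :: "'i set" and G :: "'g monoid" and R s c and H :: "'h monoid" (structure) +
  fixes \<omega> :: "'h \<Rightarrow> 'g" and x :: "nat \<Rightarrow> 'h \<Rightarrow> 'i \<Rightarrow> int"
  assumes H_fg: "finitely_generated_group H" and H_rf: "residually_finite H"
    and \<omega>_hom: "\<omega> \<in> hom H G"
    and x_coherent: "\<lbrakk>N dvd M; M > 0; h \<in> carrier H; i \<in> I\<rbrakk> \<Longrightarrow> [x M h i = x N h i] (mod int N)"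
    and x_mult: "\<lbrakk>N > 0; h \<in> carrier H; h' \<in> carrier H; i \<in> I\<rbrakk> \<Longrightarrow>
      [x N (h \<otimes> h') i = x N h i + lattice_act I (R (\<omega> h)) (x N h') i] (mod int N)"
    and x_surj: "\<lbrakk>N > 0; g \<in> carrier G\<rbrakk> \<Longrightarrow>
      \<exists>h\<in>carrier H. \<omega> h = g \<and> (\<forall>i\<in>I. [x N h i = v i] (mod int N))"
    and cofinal: "U \<in> finite_index_normals H \<Longrightarrow>
      \<exists>N>0. \<forall>h\<in>carrier H. \<omega> h = \<one>\<^bsub>G\<^esub> \<and> (\<forall>i\<in>I. [x N h i = 0] (mod int N)) \<longrightarrow> h \<in> U"
begin

sublocale G: group G by (rule group_G)

lemma \<omega>_mem [simp]: "h \<in> carrier H \<Longrightarrow> \<omega> h \<in> carrier G"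
  using \<omega>_hom by (auto simp: hom_def)

lemma \<omega>_mult [simp]: "h \<in> carrier H \<Longrightarrow> h' \<in> carrier H \<Longrightarrow> \<omega> (h \<otimes> h') = \<omega> h \<otimes>\<^bsub>G\<^esub> \<omega> h'"
  using \<omega>_hom by (auto simp: hom_def)

lemma \<omega>_group_hom: "group_hom H G \<omega>"
  by (rule group_hom.intro[OF H.is_group group_G]) (simp add: group_hom_axioms_def \<omega>_hom)

lemma \<omega>_one [simp]: "\<omega> \<one> = \<one>\<^bsub>G\<^esub>"
  by (rule group_hom.hom_one[OF \<omega>_group_hom])

lemma \<omega>_inv [simp]: "h \<in> carrier H \<Longrightarrow> \<omega> (inv h) = inv\<^bsub>G\<^esub> \<omega> h"
  by (rule group_hom.hom_inv[OF \<omega>_group_hom])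

definition A :: "'h set" where "A = {a \<in> carrier H. \<omega> a = \<one>\<^bsub>G\<^esub>}"

lemma A_memI: "a \<in> carrier H \<Longrightarrow> \<omega> a = \<one>\<^bsub>G\<^esub> \<Longrightarrow> a \<in> A"
  by (simp add: A_def)

lemma A_carrier: "a \<in> A \<Longrightarrow> a \<in> carrier H" and A_\<omega>: "a \<in> A \<Longrightarrow> \<omega> a = \<one>\<^bsub>G\<^esub>"
  by (simp_all add: A_def)

lemma A_closed [simp]: "a \<in> A \<Longrightarrow> b \<in> A \<Longrightarrow> a \<otimes> b \<in> A" "\<one> \<in> A" "a \<in> A \<Longrightarrow> inv a \<in> A"
  by (simp_all add: A_def)

lemma A_conj [simp]: "a \<in> A \<Longrightarrow> h \<in> carrier H \<Longrightarrow> h \<otimes> a \<otimes> inv h \<in> A"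
  by (simp add: A_def)

declare A_carrier [simp] A_\<omega> [simp]

lemma A_subgroup: "subgroup A H"
  by (rule subgroup.intro) auto

lemma A_int_pow [simp]: "a \<in> A \<Longrightarrow> a [^] (k::int) \<in> A"
  by (rule H.subgroup_int_pow_closed[OF A_subgroup])

lemma lattice_act_one: "i \<in> I \<Longrightarrow> lattice_act I (R \<one>\<^bsub>G\<^esub>) v i = v i"
proof -
  assume i: "i \<in> I"
  have "(\<Sum>j\<in>I. R \<one>\<^bsub>G\<^esub> i j * v j) = (\<Sum>j\<in>I. if i = j then v j else 0)"
    using i by (intro sum.cong) (auto simp: R_one)
  then show ?thesis using i finite_I by (simp add: lattice_act_def)
qed

lemma x_A_mult:
  assumes "N > 0" "a \<in> A" "h \<in> carrier H" "i \<in> I"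
  shows "[x N (a \<otimes> h) i = x N a i + x N h i] (mod int N)"
  using x_mult[OF assms(1) A_carrier[OF assms(2)] assms(3,4)] assms by (simp add: lattice_act_one)

lemma x_one: "N > 0 \<Longrightarrow> i \<in> I \<Longrightarrow> [x N \<one> i = 0] (mod int N)"
proof -
  assume *: "N > 0" "i \<in> I"
  then have "[x N \<one> i + 0 = x N \<one> i + x N \<one> i] (mod int N)" using x_A_mult[of N \<one> \<one> i] by simp
  then show ?thesis unfolding cong_add_lcancel by (rule cong_sym)
qed

lemma x_A_inv:
  assumes "N > 0" "a \<in> A" "i \<in> I"
  shows "[x N (inv a) i = - x N a i] (mod int N)"
proof -
  have "[x N (a \<otimes> inv a) i = x N a i + x N (inv a) i] (mod int N)" using assms by (intro x_A_mult) auto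
  then have "[0 = x N a i + x N (inv a) i] (mod int N)"
    using x_one[OF assms(1,3)] assms(2) by (metis A_carrier H.r_inv cong_sym cong_trans)
  then have "[- x N a i + 0 = - x N a i + (x N a i + x N (inv a) i)] (mod int N)" by (rule cong_add[OF cong_refl])
  then show ?thesis by (simp add: cong_sym)
qed

lemma x_A_pow:
  assumes "N > 0" "a \<in> A" "i \<in> I"
  shows "[x N (a [^] (k::int)) i = k * x N a i] (mod int N)"
proof -
  have nat: "[x N (a [^] int n) i = int n * x N a i] (mod int N)" for n :: nat
  proof (induction n)
    case 0 then show ?case using x_one[OF assms(1,3)] by simp
  next
    case (Suc n)
    have "a [^] int (Suc n) = a \<otimes> a [^] int n"
      using H.int_pow_mult[of a 1 "int n"] assms by simp
    then have "[x N (a [^] int (Suc n)) i = x N a i + x N (a [^] int n) i] (mod int N)"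
      using x_A_mult[OF assms(1,2) _ assms(3)] assms by simp
    also have "[x N a i + x N (a [^] int n) i = x N a i + int n * x N a i] (mod int N)"
      by (intro cong_add cong_refl Suc)
    finally show ?case by (simp add: algebra_simps)
  qed
  show ?thesis
  proof (cases "k \<ge> 0")
    case True then show ?thesis using nat[of "nat k"] by simp
  next
    case False
    then have "a [^] k = inv (a [^] int (nat (- k)))" using H.int_pow_neg[of a "- k"] assms by simp
    then have "[x N (a [^] k) i = - x N (a [^] int (nat (- k))) i] (mod int N)"
      using x_A_inv assms by simp
    also have "[- x N (a [^] int (nat (- k))) i = - (int (nat (- k)) * x N a i)] (mod int N)"
      using nat cong_minus_minus_iff by blast
    finally show ?thesis using False by simp
  qed
qed

lemma x_conj:
  assumes "N > 0" "a \<in> A" "h \<in> carrier H" "i \<in> I"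
  shows "[x N (h \<otimes> a \<otimes> inv h) i = lattice_act I (R (\<omega> h)) (x N a) i] (mod int N)"
proof -
  have "h \<otimes> a \<otimes> inv h \<otimes> h = h \<otimes> a" using assms by (simp add: H.m_assoc)
  then have "[x N (h \<otimes> a) i = x N (h \<otimes> a \<otimes> inv h) i + x N h i] (mod int N)"
    using x_A_mult[OF assms(1) A_conj[OF assms(2,3)] assms(3,4)] by simp
  moreover have "[x N (h \<otimes> a) i = x N h i + lattice_act I (R (\<omega> h)) (x N a) i] (mod int N)"
    using assms by (intro x_mult) auto
  ultimately have "[x N h i + x N (h \<otimes> a \<otimes> inv h) i = x N h i + lattice_act I (R (\<omega> h)) (x N a) i] (mod int N)"
    by (metis add.commute cong_sym cong_trans)
  then show ?thesis unfolding cong_add_lcancel .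
qed

text \<open>By \<open>cofinal\<close>, an element of \<open>A\<close> that is invisible at all
  levels lies in every finite index normal subgroup, hence is trivial by residual finiteness.
  Identities in \<open>A\<close> can therefore be checked modulo every \<open>N\<close>.\<close>

lemma separated:
  assumes "a \<in> A" "\<And>N i. N > 0 \<Longrightarrow> i \<in> I \<Longrightarrow> [x N a i = 0] (mod int N)"
  shows "a = \<one>"
proof (rule ccontr)
  assume "a \<noteq> \<one>"
  then obtain M where "M \<in> finite_index_normals H" "a \<notin> M"
    using H_rf assms(1) by (auto simp: residually_finite_def)
  then show False using cofinal assms by (metis A_carrier A_\<omega>)
qed

lemma separated_eq:
  assumes "a \<in> A" "b \<in> A" "\<And>N i. N > 0 \<Longrightarrow> i \<in> I \<Longrightarrow> [x N a i = x N b i] (mod int N)"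
  shows "a = b"
proof -
  have "a \<otimes> inv b = \<one>"
  proof (rule separated)
    fix N :: nat and i assume N: "N > 0" "i \<in> I"
    have "[x N (a \<otimes> inv b) i = x N a i + x N (inv b) i] (mod int N)" using N assms by (intro x_A_mult) auto
    also have "[x N a i + x N (inv b) i = x N b i + - x N b i] (mod int N)"
      using N assms by (intro cong_add x_A_inv) auto
    finally show "[x N (a \<otimes> inv b) i = 0] (mod int N)" by simp
  qed (use assms in simp)
  then show ?thesis using assms by (metis A_carrier H.inv_equality H.inv_inv H.inv_closed)
qed

lemma A_comm:
  assumes "a \<in> A" "b \<in> A"
  shows "a \<otimes> b = b \<otimes> a"
proof (rule separated_eq)
  fix N :: nat and i assume N: "N > 0" "i \<in> I"
  show "[x N (a \<otimes> b) i = x N (b \<otimes> a) i] (mod int N)"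
    using x_A_mult[OF N(1) assms(1) A_carrier[OF assms(2)] N(2)]
      x_A_mult[OF N(1) assms(2) A_carrier[OF assms(1)] N(2)]
    by (metis add.commute cong_sym cong_trans)
qed (use assms in auto)

text \<open>The factor \<open>k\<close> is cancelled by going up to the level \<open>|k| N\<close>
  and coming back: profinite integers have no torsion.\<close>

lemma coherent_zero:
  assumes "N > 0" "k \<noteq> 0" "h \<in> carrier H" "i \<in> I"
    and "[k * x (nat \<bar>k\<bar> * N) h i = 0] (mod int (nat \<bar>k\<bar> * N))"
  shows "[x N h i = 0] (mod int N)"
proof -
  have "\<bar>k\<bar> * int N dvd k * x (nat \<bar>k\<bar> * N) h i" using assms(5) by (simp add: cong_0_iff)
  then have "k * int N dvd k * x (nat \<bar>k\<bar> * N) h i" by (cases "k \<ge> 0") auto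
  then have "int N dvd x (nat \<bar>k\<bar> * N) h i" using assms(2) by simp
  then have "[x (nat \<bar>k\<bar> * N) h i = 0] (mod int N)" by (simp add: cong_0_iff)
  moreover have "[x (nat \<bar>k\<bar> * N) h i = x N h i] (mod int N)"
    using assms by (intro x_coherent) auto
  ultimately show ?thesis by (metis cong_sym cong_trans)
qed

lemma A_torsion_free:
  assumes "a \<in> A" "a [^] (k::int) = \<one>" "k \<noteq> 0"
  shows "a = \<one>"
proof (rule separated[OF assms(1)])
  fix N :: nat and i assume N: "N > 0" "i \<in> I"
  let ?M = "nat \<bar>k\<bar> * N"
  have M: "?M > 0" using N assms(3) by simp
  have "[k * x ?M a i = 0] (mod int ?M)"
    using x_A_pow[OF M assms(1) N(2), of k] x_one[OF M N(2)] assms(2) by (metis cong_sym cong_trans)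
  then show "[x N a i = 0] (mod int N)" using coherent_zero[OF N(1) assms(3) _ N(2)] assms(1) by simp
qed

section \<open>The abelian group \<open>A\<close>: finite generation and divisibility\<close>

definition AG :: "'h monoid" where "AG = H\<lparr>carrier := A\<rparr>"

lemma AG_simps [simp]: "carrier AG = A" "a \<otimes>\<^bsub>AG\<^esub> b = a \<otimes> b" "\<one>\<^bsub>AG\<^esub> = \<one>"
  by (simp_all add: AG_def)

lemma AG_comm_group: "comm_group AG"
proof (rule group.group_comm_groupI)
  show "group AG" unfolding AG_def by (rule H.subgroup_imp_group[OF A_subgroup])
qed (simp add: A_comm)

sublocale AG: comm_group AG by (rule AG_comm_group)

lemma pow_mult_A: "a \<in> A \<Longrightarrow> b \<in> A \<Longrightarrow> (a \<otimes> b) [^] (k::int) = a [^] k \<otimes> b [^] k"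
  by (rule H.int_pow_mult_distrib) (simp_all add: A_comm)

text \<open>Linear combinations in multiplicative notation, with \<open>k\<close> as the vector of
  integral coefficients.\<close>

definition P :: "('y \<Rightarrow> 'h) \<Rightarrow> 'y set \<Rightarrow> ('y \<Rightarrow> int) \<Rightarrow> 'h" where
  "P b Y k = finprod AG (\<lambda>y. b y [^] k y) Y"

lemma P_closed [simp]: "(\<And>y. y \<in> Y \<Longrightarrow> b y \<in> A) \<Longrightarrow> P b Y k \<in> A"
  unfolding P_def using AG.finprod_closed[of "\<lambda>y. b y [^] k y" Y] by auto

lemma P_add:
  assumes "\<And>y. y \<in> Y \<Longrightarrow> b y \<in> A"
  shows "P b Y (\<lambda>y. k y + l y) = P b Y k \<otimes> P b Y l"
proof -
  have "P b Y (\<lambda>y. k y + l y) = finprod AG (\<lambda>y. b y [^] k y \<otimes>\<^bsub>AG\<^esub> b y [^] l y) Y"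
    unfolding P_def by (rule AG.finprod_cong') (use assms in \<open>auto simp: H.int_pow_mult\<close>)
  also have "\<dots> = P b Y k \<otimes>\<^bsub>AG\<^esub> P b Y l"
    unfolding P_def by (rule AG.finprod_multf) (use assms in auto)
  finally show ?thesis by simp
qed

lemma P_cong: "(\<And>y. y \<in> Y \<Longrightarrow> b y \<in> A) \<Longrightarrow> (\<And>y. y \<in> Y \<Longrightarrow> k y = l y) \<Longrightarrow> P b Y k = P b Y l"
  unfolding P_def by (rule AG.finprod_cong') auto

lemma P_zero: "P b Y (\<lambda>_. 0) = \<one>"
  unfolding P_def using AG.finprod_one_eqI[of Y "\<lambda>_. \<one>"] by simp

lemma P_neg:
  assumes "\<And>y. y \<in> Y \<Longrightarrow> b y \<in> A"
  shows "P b Y (\<lambda>y. - k y) = inv (P b Y k)"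
proof -
  have "P b Y (\<lambda>y. - k y) \<otimes> P b Y k = \<one>"
    using P_add[of Y b "\<lambda>y. - k y" k] assms P_zero[of b Y] by simp
  then show ?thesis using assms by (intro H.inv_equality[symmetric]) auto
qed

lemma P_pow:
  assumes "\<And>y. y \<in> Y \<Longrightarrow> b y \<in> A"
  shows "P b Y (\<lambda>y. m * k y) = P b Y k [^] (m::int)"
proof -
  have nat: "P b Y (\<lambda>y. int n * k y) = P b Y k [^] int n" for n
  proof (induction n)
    case 0 then show ?case by (simp add: P_zero)
  next
    case (Suc n)
    have "P b Y (\<lambda>y. int (Suc n) * k y) = P b Y (\<lambda>y. int n * k y + k y)"
      by (rule arg_cong[where f = "P b Y"]) (simp add: fun_eq_iff algebra_simps)
    also have "\<dots> = P b Y k [^] int n \<otimes> P b Y k [^] (1::int)"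
      using P_add[of Y b] assms Suc by simp
    also have "\<dots> = P b Y k [^] int (Suc n)" using assms H.int_pow_mult[of "P b Y k" "int n" 1]
      by (simp add: add.commute)
    finally show ?case .
  qed
  have neg: "P b Y (\<lambda>y. - l y) = inv (P b Y l)" for l by (rule P_neg) (rule assms)
  have Pc: "P b Y k \<in> carrier H" by (intro A_carrier P_closed assms)
  show ?thesis
  proof (cases "m \<ge> 0")
    case True then show ?thesis using nat[of "nat m"] by simp
  next
    case False
    then have "P b Y (\<lambda>y. m * k y) = P b Y (\<lambda>y. - (int (nat (- m)) * k y))" by simp
    also have "\<dots> = inv (P b Y k [^] int (nat (- m)))" by (simp only: neg nat)
    also have "\<dots> = P b Y k [^] m"
      using H.int_pow_neg[OF Pc, of "- m"] False by simp
    finally show ?thesis .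
  qed
qed

lemma P_single:
  assumes "\<And>y. y \<in> Y \<Longrightarrow> b y \<in> A" "finite Y" "y \<in> Y"
  shows "P b Y (\<lambda>z. of_bool (z = y)) = b y"
proof -
  have "P b Y (\<lambda>z. of_bool (z = y)) = finprod AG (\<lambda>z. if z = y then b z else \<one>\<^bsub>AG\<^esub>) Y"
    unfolding P_def by (rule AG.finprod_cong') (use assms in auto)
  also have "\<dots> = b y"
    using AG.finprod_singleton_swap[OF assms(3,2), of b] assms(1) by auto
  finally show ?thesis .
qed

lemma x_P:
  assumes "finite Y" "\<And>y. y \<in> Y \<Longrightarrow> b y \<in> A" "N > 0" "i \<in> I"
  shows "[x N (P b Y k) i = (\<Sum>y\<in>Y. k y * x N (b y) i)] (mod int N)"
  using assms(1,2)
proof (induction Y)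
  case empty
  then show ?case using x_one[OF assms(3,4)] by (simp add: P_def)
next
  case (insert y Y)
  have "P b (insert y Y) k = b y [^] k y \<otimes> P b Y k"
    unfolding P_def using insert AG.finprod_insert[of Y y "\<lambda>y. b y [^] k y"] by auto
  moreover have "[x N (b y [^] k y \<otimes> P b Y k) i = x N (b y [^] k y) i + x N (P b Y k) i] (mod int N)"
    using insert.prems assms(3,4) by (intro x_A_mult) auto
  moreover have "[x N (b y [^] k y) i + x N (P b Y k) i = k y * x N (b y) i + (\<Sum>y\<in>Y. k y * x N (b y) i)] (mod int N)"
    using insert assms(3,4) by (intro cong_add x_A_pow) auto
  ultimately show ?case using insert.hyps by (auto intro: cong_trans)
qed

text \<open>Schreier generators. With a transversal \<open>r\<close>, the elements \<open>t\<close>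
  satisfy \<open>t g (h1 h2) = t g h1 * t (g h1) h2\<close>, so the induction over words must be
  stated for all \<open>g\<close>. The normalisation of \<open>r\<close> at the identity makes
  \<open>t\<close> at the identity of \<open>G\<close> act as the identity on
  \<open>A\<close>.\<close>

lemma A_generators: "\<exists>Y. finite Y \<and> Y \<subseteq> A \<and> (\<forall>a\<in>A. \<exists>k. a = P (\<lambda>y. y) Y k)"
proof -
  obtain X where X: "finite X" "X \<subseteq> carrier H" "generate H X = carrier H"
    using H_fg by (auto simp: finitely_generated_group_def)
  have "\<exists>h\<in>carrier H. \<omega> h = g" if "g \<in> carrier G" for g using x_surj[of 1 g] that by auto
  then obtain r0 where r0: "\<And>g. g \<in> carrier G \<Longrightarrow> r0 g \<in> carrier H \<and> \<omega> (r0 g) = g" by metis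
  define r where "r g = (if g = \<one>\<^bsub>G\<^esub> then \<one> else r0 g)" for g
  have r: "g \<in> carrier G \<Longrightarrow> r g \<in> carrier H" "g \<in> carrier G \<Longrightarrow> \<omega> (r g) = g" "r \<one>\<^bsub>G\<^esub> = \<one>" for g
    using r0 by (auto simp: r_def)
  define t where "t g h = r g \<otimes> h \<otimes> inv (r (g \<otimes>\<^bsub>G\<^esub> \<omega> h))" for g h
  have tA: "t g h \<in> A" if "g \<in> carrier G" "h \<in> carrier H" for g h
    unfolding t_def
    by (rule A_memI) (use that r in simp_all)
  \<comment> \<open>Inverses are adjoined because \<open>generate\<close> treats them as letters of
    their own.\<close>
  define X' where "X' = X \<union> m_inv H ` X"
  define Y where "Y = (\<lambda>(g, h). t g h) ` (carrier G \<times> X')"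
  have X': "X' \<subseteq> carrier H" using X(2) by (auto simp: X'_def)
  have Y: "finite Y" "Y \<subseteq> A" using finite_G X(1) X' tA by (auto simp: Y_def X'_def)
  have YA: "\<And>y. y \<in> Y \<Longrightarrow> y \<in> A" using Y(2) by blast
  have base: "\<exists>k. y = P (\<lambda>y. y) Y k" if "y \<in> Y" for y
    using P_single[of Y "\<lambda>y. y" y] YA Y(1) that by (intro exI[of _ "\<lambda>z. of_bool (z = y)"]) simp
  have "\<forall>g\<in>carrier G. \<exists>k. t g h = P (\<lambda>y. y) Y k" if "h \<in> generate H X" for h
    using that
  proof (induction rule: generate.induct)
    case one
    have "t g \<one> = \<one>" if "g \<in> carrier G" for g using that r by (simp add: t_def)
    then show ?case by (intro ballI exI[of _ "\<lambda>_. 0"]) (simp add: P_zero)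
  next
    case (incl h)
    then have "t g h \<in> Y" if "g \<in> carrier G" for g using that by (auto simp: Y_def X'_def)
    then show ?case using base by blast
  next
    case (inv h)
    then have "t g (inv h) \<in> Y" if "g \<in> carrier G" for g using that by (auto simp: Y_def X'_def)
    then show ?case using base by blast
  next
    case (eng h1 h2)
    then have h: "h1 \<in> carrier H" "h2 \<in> carrier H" using X(3) by auto
    show ?case
    proof
      fix g assume g: "g \<in> carrier G"
      have g1: "g \<otimes>\<^bsub>G\<^esub> \<omega> h1 \<in> carrier G" using g h by simp
      have "t g (h1 \<otimes> h2) = t g h1 \<otimes> t (g \<otimes>\<^bsub>G\<^esub> \<omega> h1) h2"
      proof -
        have "inv (r (g \<otimes>\<^bsub>G\<^esub> \<omega> h1)) \<otimes> (r (g \<otimes>\<^bsub>G\<^esub> \<omega> h1) \<otimes> z) = z" if "z \<in> carrier H" for z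
          using r(1)[OF g1] that by (simp add: H.m_assoc[symmetric])
        then show ?thesis using g h g1 r(1) by (simp add: t_def H.m_assoc G.m_assoc)
      qed
      moreover obtain k1 k2 where "t g h1 = P (\<lambda>y. y) Y k1" "t (g \<otimes>\<^bsub>G\<^esub> \<omega> h1) h2 = P (\<lambda>y. y) Y k2"
        using eng.IH g g1 by metis
      ultimately have "t g (h1 \<otimes> h2) = P (\<lambda>y. y) Y (\<lambda>y. k1 y + k2 y)"
        using P_add[of Y "\<lambda>y. y" k1 k2] YA by simp
      then show "\<exists>k. t g (h1 \<otimes> h2) = P (\<lambda>y. y) Y k" by blast
    qed
  qed
  moreover have "t \<one>\<^bsub>G\<^esub> a = a" if "a \<in> A" for a using that r by (simp add: t_def)
  ultimately have "\<forall>a\<in>A. \<exists>k. a = P (\<lambda>y. y) Y k" using X(3) by (metis A_carrier G.one_closed)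
  then show ?thesis using Y by blast
qed

definition powers :: "nat \<Rightarrow> 'h set" where "powers N = (\<lambda>a. a [^] int N) ` A"

text \<open>Finite generation of \<open>A\<close> bounds the number of cosets, since exponents may
  be reduced modulo \<open>N\<close>. The result makes \<open>cofinal\<close> applicable to the
  subgroup of \<open>N\<close>-th powers.\<close>

lemma powers_finite_index:
  assumes "N > 0"
  shows "powers N \<in> finite_index_normals H"
proof -
  obtain Y where Y: "finite Y" "Y \<subseteq> A" "\<And>a. a \<in> A \<Longrightarrow> \<exists>k. a = P (\<lambda>y. y) Y k" using A_generators by blast
  have "\<exists>h\<in>carrier H. \<omega> h = g" if "g \<in> carrier G" for g using x_surj[of 1 g] that by auto
  then obtain r where r: "\<And>g. g \<in> carrier G \<Longrightarrow> r g \<in> carrier H \<and> \<omega> (r g) = g" by metis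
  have sub: "subgroup (powers N) H"
  proof (rule H.subgroupI)
    show "powers N \<subseteq> carrier H" by (auto simp: powers_def)
    show "powers N \<noteq> {}" using imageI[OF A_closed(2), of "\<lambda>a. a [^] int N"] unfolding powers_def by blast
    fix a assume "a \<in> powers N"
    then obtain a' where a': "a' \<in> A" "a = a' [^] int N" by (auto simp: powers_def)
    then have "inv a = (inv a') [^] int N" by (simp add: H.int_pow_inv)
    then show "inv a \<in> powers N" using a' by (auto simp: powers_def)
    fix b assume "b \<in> powers N"
    then obtain b' where b': "b' \<in> A" "b = b' [^] int N" by (auto simp: powers_def)
    then have "a \<otimes> b = (a' \<otimes> b') [^] int N" using a' by (simp add: pow_mult_A)
    then show "a \<otimes> b \<in> powers N" using a' b' by (auto simp: powers_def)
  qed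
  have "powers N \<lhd> H"
  proof (rule H.normal_invI[OF sub])
    fix h a assume h: "h \<in> carrier H" "a \<in> powers N"
    then obtain a' where a': "a' \<in> A" "a = a' [^] int N" by (auto simp: powers_def)
    have "h \<otimes> a \<otimes> inv h = (h \<otimes> a' \<otimes> inv h) [^] int N"
    proof (rule separated_eq)
      fix M :: nat and i assume M: "M > 0" "i \<in> I"
      have "[x M (h \<otimes> a \<otimes> inv h) i = lattice_act I (R (\<omega> h)) (x M a) i] (mod int M)"
        using M h a' by (intro x_conj) auto
      also have "[lattice_act I (R (\<omega> h)) (x M a) i = lattice_act I (R (\<omega> h)) (\<lambda>j. int N * x M a' j) i] (mod int M)"
        unfolding a'(2) using M a' by (intro lattice_act_cong_mod x_A_pow) auto
      also have "[lattice_act I (R (\<omega> h)) (\<lambda>j. int N * x M a' j) i = int N * x M (h \<otimes> a' \<otimes> inv h) i] (mod int M)"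
        unfolding lattice_act_scale using M h a' by (intro cong_mult cong_refl cong_sym[OF x_conj]) auto
      also have "[int N * x M (h \<otimes> a' \<otimes> inv h) i = x M ((h \<otimes> a' \<otimes> inv h) [^] int N) i] (mod int M)"
        using M h a' by (intro cong_sym[OF x_A_pow]) auto
      finally show "[x M (h \<otimes> a \<otimes> inv h) i = x M ((h \<otimes> a' \<otimes> inv h) [^] int N) i] (mod int M)" .
    qed (use h a' in auto)
    then show "h \<otimes> a \<otimes> inv h \<in> powers N" using h a' A_conj by (auto simp: powers_def)
  qed
  moreover have "finite (rcosets (powers N))"
  proof (rule finite_subset)
    let ?F = "(\<lambda>(k, g). powers N #> (P (\<lambda>y. y) Y k \<otimes> r g)) ` ((Y \<rightarrow>\<^sub>E {0..<int N}) \<times> carrier G)"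
    show "finite ?F" using Y(1) finite_G by (intro finite_imageI finite_cartesian_product finite_PiE) auto
    show "rcosets (powers N) \<subseteq> ?F"
    proof
      fix C assume "C \<in> rcosets (powers N)"
      then obtain h where h: "h \<in> carrier H" "C = powers N #> h" by (auto simp: RCOSETS_def)
      define g where "g = \<omega> h"
      have g: "g \<in> carrier G" "r g \<in> carrier H" "\<omega> (r g) = g" using h r by (auto simp: g_def)
      then have "h \<otimes> inv (r g) \<in> A" using h by (intro A_memI) (simp_all add: g_def)
      then obtain k where k: "h \<otimes> inv (r g) = P (\<lambda>y. y) Y k" using Y(3) by blast
      let ?k = "\<lambda>y\<in>Y. k y mod int N"
      have YA: "\<And>y. y \<in> Y \<Longrightarrow> y \<in> A" using Y(2) by auto
      have "P (\<lambda>y. y) Y k = P (\<lambda>y. y) Y (\<lambda>y. int N * (k y div int N) + ?k y)"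
        by (rule P_cong) (use YA in auto)
      also have "\<dots> = P (\<lambda>y. y) Y (\<lambda>y. k y div int N) [^] int N \<otimes> P (\<lambda>y. y) Y ?k"
        by (simp only: P_add[of Y "\<lambda>y. y", OF YA] P_pow[of Y "\<lambda>y. y", OF YA])
      finally have k': "P (\<lambda>y. y) Y k = P (\<lambda>y. y) Y (\<lambda>y. k y div int N) [^] int N \<otimes> P (\<lambda>y. y) Y ?k" .
      define q where "q = P (\<lambda>y. y) Y (\<lambda>y. k y div int N) [^] int N"
      have PA: "P (\<lambda>y. y) Y l \<in> A" for l using YA by simp
      then have q: "q \<in> powers N" "q \<in> carrier H" by (simp_all add: powers_def q_def)
      have z: "P (\<lambda>y. y) Y ?k \<otimes> r g \<in> carrier H" using PA g(2) by simp
      have "h = h \<otimes> inv (r g) \<otimes> r g" using h(1) g(2) by (simp add: H.m_assoc)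
      also have "\<dots> = q \<otimes> (P (\<lambda>y. y) Y ?k \<otimes> r g)"
        unfolding k k' q_def[symmetric] using q(2) PA g(2) by (simp add: H.m_assoc)
      finally have "powers N #> h = powers N #> (q \<otimes> (P (\<lambda>y. y) Y ?k \<otimes> r g))" by simp
      also have "\<dots> = powers N #> q #> (P (\<lambda>y. y) Y ?k \<otimes> r g)"
        by (rule H.coset_mult_assoc[symmetric, OF subgroup.subset[OF sub] q(2) z])
      also have "powers N #> q = powers N" by (rule H.coset_join2[OF q(2) sub q(1)])
      finally have C: "C = powers N #> (P (\<lambda>y. y) Y ?k \<otimes> r g)" unfolding h(2) .
      have "?k \<in> Y \<rightarrow>\<^sub>E {0..<int N}" using assms by auto
      with g(1) show "C \<in> ?F"
        by (intro image_eqI[of _ _ "(?k, g)"] SigmaI) (simp_all only: C prod.case)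
    qed
  qed
  ultimately show ?thesis by (simp add: finite_index_normals_def)
qed

lemma A_surj:
  assumes "N > 0"
  shows "\<exists>a\<in>A. \<forall>i\<in>I. [x N a i = v i] (mod int N)"
proof -
  obtain a where "a \<in> carrier H" "\<omega> a = \<one>\<^bsub>G\<^esub>" "\<forall>i\<in>I. [x N a i = v i] (mod int N)"
    using x_surj[OF assms G.one_closed, of v] by blast
  then show ?thesis by (intro bexI[of _ a] A_memI)
qed

text \<open>Divisibility in the completed lattice descends to \<open>A\<close>: density provides a
  \<open>b\<close> whose coordinates are the quotients by \<open>N\<close> up to a level so fine
  that, by \<open>cofinal\<close>, the remaining error is itself an \<open>N\<close>-th
  power.\<close>

lemma root_exists:
  assumes N: "N > 0" and a: "a \<in> A" "\<And>i. i \<in> I \<Longrightarrow> [x N a i = 0] (mod int N)"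
  shows "\<exists>b\<in>A. a = b [^] int N"
proof -
  obtain M where "M > 0 \<and> (\<forall>h\<in>carrier H. \<omega> h = \<one>\<^bsub>G\<^esub> \<and> (\<forall>i\<in>I. [x M h i = 0] (mod int M)) \<longrightarrow> h \<in> powers N)"
    using cofinal[OF powers_finite_index[OF N]] by (rule exE)
  then have M: "M > 0" "h \<in> carrier H \<Longrightarrow> \<omega> h = \<one>\<^bsub>G\<^esub> \<Longrightarrow> \<forall>i\<in>I. [x M h i = 0] (mod int M) \<Longrightarrow> h \<in> powers N" for h
    by simp_all
  \<comment> \<open>At level \<open>M * N\<close> the coordinates of \<open>a\<close> are still
    divisible by \<open>N\<close>, and an error that vanishes there vanishes modulo
    \<open>M\<close>.\<close>
  define L where "L = M * N"
  have L: "L > 0" "N dvd L" "M dvd L" using M N by (simp_all add: L_def)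
  have "int N dvd x L a i" if "i \<in> I" for i
    using cong_trans[OF x_coherent[OF L(2,1) A_carrier[OF a(1)] that] a(2)[OF that]] by (simp add: cong_0_iff)
  then have v: "x L a i = int N * (x L a i div int N)" if "i \<in> I" for i using that by simp
  obtain b where b: "b \<in> A" "\<And>i. i \<in> I \<Longrightarrow> [x L b i = x L a i div int N] (mod int L)"
    using A_surj[OF L(1), of "\<lambda>i. x L a i div int N"] by blast
  have "a \<otimes> inv (b [^] int N) \<in> powers N"
  proof (rule M(2))
    show "\<forall>i\<in>I. [x M (a \<otimes> inv (b [^] int N)) i = 0] (mod int M)"
    proof
      fix i assume i: "i \<in> I"
      have "[x L (a \<otimes> inv (b [^] int N)) i = x L a i + x L (inv (b [^] int N)) i] (mod int L)"
        using L a b i by (intro x_A_mult) auto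
      also have "[x L a i + x L (inv (b [^] int N)) i = x L a i + - x L (b [^] int N) i] (mod int L)"
        using L b i by (intro cong_add cong_refl x_A_inv) auto
      also have "[x L a i + - x L (b [^] int N) i = x L a i + - (int N * x L b i)] (mod int L)"
        unfolding cong_add_lcancel cong_minus_minus_iff using L b i by (intro x_A_pow) auto
      also have "[x L a i + - (int N * x L b i) = x L a i + - (int N * (x L a i div int N))] (mod int L)"
        unfolding cong_add_lcancel cong_minus_minus_iff using b(2)[OF i] by (rule cong_mult[OF cong_refl])
      finally have "[x L (a \<otimes> inv (b [^] int N)) i = 0] (mod int L)" using v[OF i] by simp
      then have "[x L (a \<otimes> inv (b [^] int N)) i = 0] (mod int M)"
        using L(3) cong_dvd_modulus by (metis of_nat_dvd_iff)
      moreover have "[x L (a \<otimes> inv (b [^] int N)) i = x M (a \<otimes> inv (b [^] int N)) i] (mod int M)"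
        using L a b i by (intro x_coherent) auto
      ultimately show "[x M (a \<otimes> inv (b [^] int N)) i = 0] (mod int M)" by (metis cong_sym cong_trans)
    qed
  qed (use a b in auto)
  then obtain d where d: "d \<in> A" "a \<otimes> inv (b [^] int N) = d [^] int N" by (auto simp: powers_def)
  then have "a = d [^] int N \<otimes> b [^] int N"
    using a b by (metis A_carrier A_int_pow H.inv_closed H.inv_solve_right' H.int_pow_closed)
  then have "a = (d \<otimes> b) [^] int N" using b d by (simp add: pow_mult_A)
  then show ?thesis using b(1) d(1) by (intro bexI[of _ "d \<otimes> b"]) simp_all
qed

text \<open>If \<open>D\<close> fills \<open>A\<close> modulo \<open>p\<close>, then the quotient of
  \<open>A\<close> by \<open>D\<close> has finite exponent. Passing to exponent vectors over a
  finite generating set reduces this to \<open>nakayama_int\<close>.\<close>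

lemma nakayama:
  assumes D: "subgroup D H" "D \<subseteq> A"
    and p: "prime p" "\<And>a. a \<in> A \<Longrightarrow> \<exists>d\<in>D. \<exists>b\<in>A. a = d \<otimes> b [^] (p::int)"
  shows "\<exists>m. m \<noteq> 0 \<and> (\<forall>a\<in>A. a [^] (m::int) \<in> D)"
proof -
  obtain Y where Y: "finite Y" "Y \<subseteq> A" "\<And>a. a \<in> A \<Longrightarrow> \<exists>k. a = P (\<lambda>y. y) Y k" using A_generators by blast
  have YA: "\<And>y. y \<in> Y \<Longrightarrow> y \<in> A" using Y(2) by auto
  let ?F = "P (\<lambda>y. y) Y"
  define E where "E = {k. ?F k \<in> D}"
  have add: "(\<lambda>z. k z + l z) \<in> E" if "k \<in> E" "l \<in> E" for k l
    using that subgroup.m_closed[OF D(1)] YA by (simp add: E_def P_add)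
  have mult: "(\<lambda>z. m * k z) \<in> E" if "k \<in> E" for k m
    using that H.subgroup_int_pow_closed[OF D(1)] YA by (simp add: E_def P_pow)
  have "\<exists>u e. \<not> p dvd u \<and> (\<forall>z. z \<notin> Y \<longrightarrow> e z = 0) \<and> (\<lambda>z. u * of_bool (z = y) - p * e z) \<in> E"
    if y: "y \<in> Y" for y
  proof -
    obtain d b where db: "d \<in> D" "b \<in> A" "y = d \<otimes> b [^] p" using p(2)[OF YA[OF y]] by blast
    obtain e0 where e0: "b = ?F e0" using Y(3)[OF db(2)] by blast
    define e where "e z = (if z \<in> Y then e0 z else 0)" for z
    have e: "b = ?F e" unfolding e0 by (rule P_cong) (use YA in \<open>auto simp: e_def\<close>)
    have "?F (\<lambda>z. 1 * of_bool (z = y) - p * e z) = ?F (\<lambda>z. of_bool (z = y) + - (p * e z))"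
      by (rule P_cong) (use YA in auto)
    also have "\<dots> = ?F (\<lambda>z. of_bool (z = y)) \<otimes> ?F (\<lambda>z. - (p * e z))" by (rule P_add) (rule YA)
    also have "?F (\<lambda>z. - (p * e z)) = inv (?F (\<lambda>z. p * e z))" by (rule P_neg) (rule YA)
    also have "?F (\<lambda>z. p * e z) = b [^] p" unfolding e by (rule P_pow) (rule YA)
    also have "?F (\<lambda>z. of_bool (z = y)) = y" by (rule P_single[OF _ Y(1) y]) (rule YA)
    also have "y \<otimes> inv (b [^] p) = d"
      unfolding db(3) using db(2) subsetD[OF D(2) db(1)] by (simp add: H.m_assoc)
    finally have "(\<lambda>z. 1 * of_bool (z = y) - p * e z) \<in> E" using db(1) by (simp add: E_def)
    moreover have "\<not> p dvd 1" using p(1) not_prime_unit by blast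
    ultimately show ?thesis by (intro exI[of _ 1] exI[of _ e]) (simp add: e_def)
  qed
  then obtain m where m: "m \<noteq> 0" "\<And>y. y \<in> Y \<Longrightarrow> (\<lambda>z. m * of_bool (z = y)) \<in> E"
    using nakayama_int[OF p(1) Y(1) add mult] by blast
  have zero: "(\<lambda>_. 0) \<in> E" using subgroup.one_closed[OF D(1)] by (simp add: E_def P_zero)
  have "a [^] m \<in> D" if a: "a \<in> A" for a
  proof -
    obtain k where k: "a = ?F k" using Y(3)[OF a] by blast
    have "(\<lambda>z. \<Sum>y\<in>Z. k y * (m * of_bool (z = y))) \<in> E" if "finite Z" "Z \<subseteq> Y" for Z
      using that by (induction Z) (auto intro!: add mult m(2) zero)
    then have "?F (\<lambda>z. \<Sum>y\<in>Y. k y * (m * of_bool (z = y))) \<in> D" using Y(1) by (simp add: E_def)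
    also have "?F (\<lambda>z. \<Sum>y\<in>Y. k y * (m * of_bool (z = y))) = ?F (\<lambda>z. m * k z)"
    proof (rule P_cong)
      fix z assume z: "z \<in> Y"
      have "(\<Sum>y\<in>Y. k y * (m * of_bool (z = y))) = (\<Sum>y\<in>Y. if z = y then m * k z else 0)"
        by (intro sum.cong) auto
      then show "(\<Sum>y\<in>Y. k y * (m * of_bool (z = y))) = m * k z" using z Y(1) by simp
    qed (use YA in auto)
    also have "\<dots> = a [^] m" using YA by (simp add: P_pow k)
    finally show ?thesis .
  qed
  then show ?thesis using m(1) by blast
qed

end

lemma zero_if_divisible:
  assumes "\<And>N. N > 0 \<Longrightarrow> int N dvd z"
  shows "z = 0"
proof (rule ccontr)
  assume "z \<noteq> 0"
  have "int (nat \<bar>z\<bar> + 1) dvd z" by (rule assms) simp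
  then show False using zdvd_imp_le[of "int (nat \<bar>z\<bar> + 1)" "\<bar>z\<bar>"] \<open>z \<noteq> 0\<close> by simp
qed

section \<open>Lines of the lattice cut out by the reflections\<close>

context profinite_lattice_data begin

definition lift :: "'g \<Rightarrow> 'h" where "lift g = (SOME h. h \<in> carrier H \<and> \<omega> h = g)"

lemma lift: "g \<in> carrier G \<Longrightarrow> lift g \<in> carrier H" "g \<in> carrier G \<Longrightarrow> \<omega> (lift g) = g"
proof -
  assume "g \<in> carrier G"
  then have "\<exists>h. h \<in> carrier H \<and> \<omega> h = g" using x_surj[of 1 g] by auto
  from someI_ex[OF this] show "lift g \<in> carrier H" "\<omega> (lift g) = g" by (simp_all add: lift_def)
qed

text \<open>The pairing with the \<open>i\<close>-th root; \<open>s i\<close> subtracts it from the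
  coordinate \<open>i\<close>.\<close>

definition dot :: "'i \<Rightarrow> ('i \<Rightarrow> int) \<Rightarrow> int" where "dot i v = (\<Sum>k\<in>I. c i k * v k)"

lemma lattice_act_s:
  assumes "i \<in> I" "j \<in> I"
  shows "lattice_act I (R (s i)) v j = v j - (if j = i then dot i v else 0)"
proof -
  have "lattice_act I (R (s i)) v j = (\<Sum>k\<in>I. (if j = k then v k else 0) - (if j = i then c i k * v k else 0))"
    unfolding lattice_act_def using assms by (auto intro!: sum.cong simp: R_s algebra_simps)
  also have "\<dots> = v j - (if j = i then dot i v else 0)"
    using assms finite_I by (simp add: sum_subtractf dot_def)
  finally show ?thesis .
qed

lemma dot_cong: "(\<And>k. k \<in> I \<Longrightarrow> [v k = w k] (mod n)) \<Longrightarrow> [dot i v = dot i w] (mod n)"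
  unfolding dot_def by (intro cong_sum cong_mult cong_refl)

text \<open>\<open>D i\<close> is \<open>1 - s i\<close> on the lattice \<open>A\<close>.\<close>

definition D :: "'i \<Rightarrow> 'h \<Rightarrow> 'h" where
  "D i a = a \<otimes> inv (lift (s i) \<otimes> a \<otimes> inv (lift (s i)))"

lemma D_A [simp]: "i \<in> I \<Longrightarrow> a \<in> A \<Longrightarrow> D i a \<in> A"
  unfolding D_def by (intro A_closed A_conj lift s_mem)

lemma x_D:
  assumes "N > 0" "i \<in> I" "a \<in> A" "j \<in> I"
  shows "[x N (D i a) j = (if j = i then dot i (x N a) else 0)] (mod int N)"
proof -
  let ?h = "lift (s i)"
  have h: "?h \<in> carrier H" "\<omega> ?h = s i" using assms(2) by (simp_all add: lift s_mem)
  have "[x N (D i a) j = x N a j + x N (inv (?h \<otimes> a \<otimes> inv ?h)) j] (mod int N)"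
    unfolding D_def using assms h by (intro x_A_mult) auto
  also have "[x N a j + x N (inv (?h \<otimes> a \<otimes> inv ?h)) j = x N a j + - x N (?h \<otimes> a \<otimes> inv ?h) j] (mod int N)"
    using assms h by (intro cong_add cong_refl x_A_inv) auto
  also have "[x N a j + - x N (?h \<otimes> a \<otimes> inv ?h) j = x N a j + - lattice_act I (R (\<omega> ?h)) (x N a) j] (mod int N)"
    unfolding cong_add_lcancel cong_minus_minus_iff using assms h by (intro x_conj) auto
  finally show ?thesis unfolding h(2) lattice_act_s[OF assms(2,4)] by simp
qed

text \<open>The part of \<open>A\<close> on the profinite line of the \<open>i\<close>-th coroot. It
  contains the image of \<open>D i\<close> and reduces computations to one coordinate.\<close>

definition B :: "'i \<Rightarrow> 'h set" where
  "B i = {a \<in> A. \<forall>N>0. \<forall>j\<in>I. j \<noteq> i \<longrightarrow> [x N a j = 0] (mod int N)}"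

lemma B_A: "a \<in> B i \<Longrightarrow> a \<in> A"
  by (simp add: B_def)

lemma B_coord: "a \<in> B i \<Longrightarrow> N > 0 \<Longrightarrow> j \<in> I \<Longrightarrow> j \<noteq> i \<Longrightarrow> [x N a j = 0] (mod int N)"
  by (simp add: B_def)

lemma B_I: "a \<in> A \<Longrightarrow> (\<And>N j. N > 0 \<Longrightarrow> j \<in> I \<Longrightarrow> j \<noteq> i \<Longrightarrow> [x N a j = 0] (mod int N)) \<Longrightarrow> a \<in> B i"
  by (simp add: B_def)

lemma B_eqI:
  assumes "a \<in> B i" "b \<in> B i" "\<And>N. N > 0 \<Longrightarrow> [x N a i = x N b i] (mod int N)"
  shows "a = b"
proof (rule separated_eq[OF B_A[OF assms(1)] B_A[OF assms(2)]])
  fix N :: nat and j assume N: "N > 0" "j \<in> I"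
  show "[x N a j = x N b j] (mod int N)"
  proof (cases "j = i")
    case True then show ?thesis using assms(3)[OF N(1)] by simp
  next
    case False
    show ?thesis by (rule cong_trans[OF B_coord[OF assms(1) N False] cong_sym[OF B_coord[OF assms(2) N False]]])
  qed
qed

lemma D_B: "i \<in> I \<Longrightarrow> a \<in> A \<Longrightarrow> D i a \<in> B i"
proof (rule B_I)
  fix N :: nat and j assume "i \<in> I" "a \<in> A" "N > 0" "j \<in> I" "j \<noteq> i"
  then show "[x N (D i a) j = 0] (mod int N)" using x_D[of N i a j] by simp
qed simp

lemma B_mult: "a \<in> B i \<Longrightarrow> b \<in> B i \<Longrightarrow> a \<otimes> b \<in> B i"
proof (rule B_I)
  fix N :: nat and j assume *: "a \<in> B i" "b \<in> B i" "N > 0" "j \<in> I" "j \<noteq> i"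
  have "[x N (a \<otimes> b) j = x N a j + x N b j] (mod int N)"
    using * B_A by (intro x_A_mult) auto
  also have "[x N a j + x N b j = 0 + 0] (mod int N)" using * by (intro cong_add B_coord) auto
  finally show "[x N (a \<otimes> b) j = 0] (mod int N)" by simp
qed (simp add: B_A)

lemma B_pow: "a \<in> B i \<Longrightarrow> a [^] (k::int) \<in> B i"
proof (rule B_I)
  fix N :: nat and j assume *: "a \<in> B i" "N > 0" "j \<in> I" "j \<noteq> i"
  have "[x N (a [^] k) j = k * x N a j] (mod int N)" using * B_A by (intro x_A_pow) auto
  also have "[k * x N a j = k * 0] (mod int N)" using * by (intro cong_mult cong_refl B_coord) auto
  finally show "[x N (a [^] k) j = 0] (mod int N)" by simp
qed (simp add: B_A)

text \<open>\<open>B i\<close> is pure in \<open>A\<close>, again because the profinite coordinates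
  are torsion free.\<close>

lemma B_root:
  assumes "a \<in> A" "a [^] (k::int) \<in> B i" "k \<noteq> 0"
  shows "a \<in> B i"
proof (rule B_I[OF assms(1)])
  fix N :: nat and j assume N: "N > 0" "j \<in> I" "j \<noteq> i"
  let ?M = "nat \<bar>k\<bar> * N"
  have M: "?M > 0" using N assms(3) by simp
  have "[k * x ?M a j = 0] (mod int ?M)"
    by (rule cong_trans[OF cong_sym[OF x_A_pow[OF M assms(1) N(2)]] B_coord[OF assms(2) M N(2,3)]])
  then show "[x N a j = 0] (mod int N)" by (rule coherent_zero[OF N(1) assms(3) A_carrier[OF assms(1)] N(2)])
qed

lemma D_mult:
  assumes "i \<in> I" "a \<in> A" "b \<in> A"
  shows "D i (a \<otimes> b) = D i a \<otimes> D i b"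
proof (rule B_eqI)
  fix N :: nat assume N: "N > 0"
  have "[x N (D i (a \<otimes> b)) i = dot i (x N (a \<otimes> b))] (mod int N)"
    using x_D[OF N assms(1) A_closed(1)[OF assms(2,3)] assms(1)] by simp
  also have "[dot i (x N (a \<otimes> b)) = dot i (\<lambda>k. x N a k + x N b k)] (mod int N)"
    using N assms by (intro dot_cong x_A_mult) auto
  also have "dot i (\<lambda>k. x N a k + x N b k) = dot i (x N a) + dot i (x N b)"
    by (simp add: dot_def distrib_left sum.distrib)
  also have "[dot i (x N a) + dot i (x N b) = x N (D i a) i + x N (D i b) i] (mod int N)"
    using x_D[OF N assms(1,2,1)] x_D[OF N assms(1,3,1)] by (intro cong_add) (simp_all add: cong_sym)
  also have "[x N (D i a) i + x N (D i b) i = x N (D i a \<otimes> D i b) i] (mod int N)"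
    using N assms by (intro cong_sym[OF x_A_mult]) auto
  finally show "[x N (D i (a \<otimes> b)) i = x N (D i a \<otimes> D i b) i] (mod int N)" .
qed (use assms in \<open>auto intro!: D_B B_mult\<close>)

lemma D_pow:
  assumes "i \<in> I" "a \<in> A"
  shows "D i (a [^] (k::int)) = D i a [^] k"
proof (rule B_eqI)
  fix N :: nat assume N: "N > 0"
  have "[x N (D i (a [^] k)) i = dot i (x N (a [^] k))] (mod int N)"
    using x_D[OF N assms(1) A_int_pow[OF assms(2)] assms(1)] by simp
  also have "[dot i (x N (a [^] k)) = dot i (\<lambda>j. k * x N a j)] (mod int N)"
    using N assms by (intro dot_cong x_A_pow) auto
  also have "dot i (\<lambda>j. k * x N a j) = k * dot i (x N a)"
    by (simp add: dot_def sum_distrib_left mult_ac)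
  also have "[k * dot i (x N a) = k * x N (D i a) i] (mod int N)"
    using x_D[OF N assms(1,2,1)] by (intro cong_mult cong_refl) (simp add: cong_sym)
  also have "[k * x N (D i a) i = x N (D i a [^] k) i] (mod int N)"
    using N assms by (intro cong_sym[OF x_A_pow]) auto
  finally show "[x N (D i (a [^] k)) i = x N (D i a [^] k) i] (mod int N)" .
qed (use assms in \<open>auto intro!: D_B B_pow\<close>)

lemma dot_single:
  assumes "i \<in> I" "j \<in> I" "\<And>k. k \<in> I \<Longrightarrow> k \<noteq> j \<Longrightarrow> [v k = 0] (mod n)"
  shows "[dot i v = c i j * v j] (mod n)"
proof -
  have "[dot i v = dot i (\<lambda>k. if k = j then v j else 0)] (mod n)"
    using assms(3) by (intro dot_cong) auto
  also have "dot i (\<lambda>k. if k = j then v j else 0) = (\<Sum>k\<in>I. if k = j then c i j * v j else 0)"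
    unfolding dot_def by (intro sum.cong) auto
  also have "\<dots> = c i j * v j" using assms(2) finite_I by simp
  finally show ?thesis .
qed

lemma x_D_B:
  assumes "N > 0" "i \<in> I" "j \<in> I" "b \<in> B j"
  shows "[x N (D i b) i = c i j * x N b j] (mod int N)"
proof -
  have "[x N (D i b) i = dot i (x N b)] (mod int N)"
    using x_D[OF assms(1,2) B_A[OF assms(4)] assms(2)] by simp
  also have "[dot i (x N b) = c i j * x N b j] (mod int N)"
    using assms by (intro dot_single B_coord) auto
  finally show ?thesis .
qed

lemma D_on_B:
  assumes "i \<in> I" "b \<in> B i"
  shows "D i b = b [^] (2::int)"
proof (rule B_eqI)
  fix N :: nat assume N: "N > 0"
  have "[x N (D i b) i = 2 * x N b i] (mod int N)"
    using x_D_B[OF N assms(1,1,2)] c_diag[OF assms(1)] by simp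
  also have "[2 * x N b i = x N (b [^] (2::int)) i] (mod int N)"
    using N assms B_A by (intro cong_sym[OF x_A_pow]) auto
  finally show "[x N (D i b) i = x N (b [^] (2::int)) i] (mod int N)" .
qed (use assms B_A in \<open>auto intro!: D_B B_pow\<close>)

lemma pow_commute: "a \<in> A \<Longrightarrow> (a [^] (k::int)) [^] (l::int) = (a [^] l) [^] k"
  by (simp add: H.int_pow_pow mult.commute)

text \<open>\<open>D i\<close> maps \<open>A\<close> into \<open>B i\<close> and is multiplication
  by 2 there. The elements whose image is a power of one \<open>c0\<close> fill \<open>A\<close>
  modulo 3, so by \<open>nakayama\<close> a fixed power of each element of \<open>A\<close> is of
  this kind. Hence a fixed power of each element of \<open>B i\<close> is a power of
  \<open>c0\<close>, and the exponents embed the torsion free group \<open>B i\<close> in the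
  integers.\<close>

lemma B_cyclic:
  assumes i: "i \<in> I"
  shows "\<exists>\<beta>\<in>B i. \<beta> \<noteq> \<one> \<and> (\<forall>b\<in>B i. \<exists>k::int. b = \<beta> [^] k)"
proof -
  \<comment> \<open>The prime 3 is used because 2 is invertible modulo 3: the image of
    \<open>a0\<close> under \<open>D i\<close> has coordinate 2, a unit.\<close>
  obtain a0 where a0: "a0 \<in> A" "\<forall>j\<in>I. [x 3 a0 j = of_bool (j = i)] (mod int 3)"
    using A_surj[of 3 "\<lambda>j. of_bool (j = i)"] by auto
  define c0 where "c0 = D i a0"
  have c0: "c0 \<in> A" "c0 \<in> B i" using i a0 by (simp_all add: c0_def D_B)
  have x_c0: "[x 3 c0 i = 2] (mod int 3)"
  proof -
    have "[x 3 c0 i = dot i (x 3 a0)] (mod int 3)" using x_D[of 3 i a0 i] i a0 by (simp add: c0_def)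
    also have "[dot i (x 3 a0) = dot i (\<lambda>j. of_bool (j = i))] (mod int 3)"
      using a0(2) by (intro dot_cong) auto
    also have "[dot i (\<lambda>j. of_bool (j = i)) = c i i * of_bool (i = i)] (mod int 3)"
      using i by (intro dot_single) auto
    finally show ?thesis using c_diag[OF i] by simp
  qed
  have c0_ne: "c0 \<noteq> \<one>"
  proof
    assume "c0 = \<one>"
    then have "[0 = 2] (mod int 3)" using x_c0 x_one[of 3 i] i by (metis cong_sym cong_trans zero_less_numeral)
    then show False by (simp add: cong_def)
  qed
  define E where "E = {a \<in> A. \<exists>e::int. D i a = c0 [^] e}"
  have E_sub: "subgroup E H"
  proof (rule H.subgroupI)
    show "E \<subseteq> carrier H" by (auto simp: E_def)
    have "D i a0 = c0 [^] (1::int)" using c0 by (simp add: c0_def[symmetric])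
    then show "E \<noteq> {}" using a0 unfolding E_def by blast
    fix a assume "a \<in> E"
    then obtain e :: int where a: "a \<in> A" "D i a = c0 [^] e" by (auto simp: E_def)
    have "D i (inv a) = c0 [^] (- e)"
      using D_pow[OF i a(1), of "-1"] a c0 H.int_pow_neg[of a 1] H.int_pow_pow[of c0 e "-1"] by simp
    then show "inv a \<in> E" using a by (auto simp: E_def)
    fix b assume "b \<in> E"
    then obtain f :: int where b: "b \<in> A" "D i b = c0 [^] f" by (auto simp: E_def)
    have "D i (a \<otimes> b) = c0 [^] (e + f)" using D_mult[OF i a(1) b(1)] a b c0 by (simp add: H.int_pow_mult)
    then show "a \<otimes> b \<in> E" using a b by (auto simp: E_def)
  qed
  have div3: "\<exists>d\<in>E. \<exists>b\<in>A. a = d \<otimes> b [^] (3::int)" if a: "a \<in> A" for a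
  proof -
    define t where "t = x 3 (D i a) i"
    \<comment> \<open>Since 2 * 2 = 1 modulo 3, removing \<open>2 * t\<close> copies of
      \<open>c0\<close> cancels the coordinate \<open>t\<close> of \<open>D i a\<close>.\<close>
    define u where "u = a \<otimes> a0 [^] (- 2 * t)"
    have u: "u \<in> A" using a a0 by (simp add: u_def)
    have Du: "D i u = D i a \<otimes> c0 [^] (- 2 * t)"
      unfolding u_def D_mult[OF i a A_int_pow[OF a0(1)]] D_pow[OF i a0(1)] c0_def ..
    have "\<exists>b\<in>A. D i u = b [^] int 3"
    proof (rule root_exists)
      show "D i u \<in> A" using i u by simp
      fix j assume j: "j \<in> I"
      show "[x 3 (D i u) j = 0] (mod int 3)"
      proof (cases "j = i")
        case False then show ?thesis using B_coord[OF D_B[OF i u] _ j False, of 3] by simp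
      next
        case True
        have "[x 3 (D i u) i = x 3 (D i a) i + x 3 (c0 [^] (- 2 * t)) i] (mod int 3)"
          unfolding Du using i a c0 by (intro x_A_mult) auto
        also have "[x 3 (D i a) i + x 3 (c0 [^] (- 2 * t)) i = t + (- 2 * t) * x 3 c0 i] (mod int 3)"
          unfolding t_def using i c0 by (intro cong_add cong_refl x_A_pow) auto
        also have "[t + (- 2 * t) * x 3 c0 i = t + (- 2 * t) * 2] (mod int 3)"
          by (intro cong_add cong_mult cong_refl x_c0)
        also have "[t + (- 2 * t) * 2 = 0] (mod int 3)" by (simp add: cong_0_iff)
        finally show ?thesis using True by simp
      qed
    qed simp
    then obtain b where b: "b \<in> A" "D i u = b [^] (3::int)" by auto
    have "b [^] (3::int) \<in> B i" using D_B[OF i u] b(2) by simp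
    then have bB: "b \<in> B i" by (rule B_root[OF b(1)]) simp
    \<comment> \<open>Additively, \<open>D u = 3 b\<close> and \<open>D b = 2 b\<close>, so
      \<open>u - b\<close> is a preimage of \<open>b\<close>, and three times it has the same image
      as \<open>u\<close>.\<close>
    define a' where "a' = u \<otimes> b [^] (-1::int)"
    have a': "a' \<in> A" using u b by (simp add: a'_def)
    have "D i a' = b [^] (3::int) \<otimes> (b [^] (2::int)) [^] (-1::int)"
      unfolding a'_def D_mult[OF i u A_int_pow[OF b(1)]] D_pow[OF i b(1)] D_on_B[OF i bB] b(2) ..
    also have "\<dots> = b [^] (1::int)"
      using b(1) H.int_pow_mult[of b 3 "-2"] H.int_pow_pow[of b 2 "-1"] by simp
    finally have Da': "D i a' = b" using b(1) by simp
    define d where "d = a \<otimes> a' [^] (-3::int)"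
    have d: "d \<in> A" using a a' by (simp add: d_def)
    have "D i d = D i a \<otimes> (D i u) [^] (-1::int)"
      unfolding d_def D_mult[OF i a A_int_pow[OF a']] D_pow[OF i a'] Da' b(2)
      using b(1) H.int_pow_pow[of b 3 "-1"] by simp
    also have "(D i u) [^] (-1::int) = D i a [^] (-1::int) \<otimes> (c0 [^] (- 2 * t)) [^] (-1::int)"
      unfolding Du using i a c0 by (intro pow_mult_A) auto
    also have "D i a \<otimes> (D i a [^] (-1::int) \<otimes> (c0 [^] (- 2 * t)) [^] (-1::int)) = c0 [^] (2 * t)"
    proof -
      have "D i a \<otimes> D i a [^] (-1::int) = \<one>"
        using i a H.int_pow_neg[of "D i a" 1] by simp
      then show ?thesis
        using i a c0 H.int_pow_pow[of c0 "- 2 * t" "-1"] by (simp add: H.m_assoc[symmetric])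
    qed
    finally have "d \<in> E" using d by (auto simp: E_def)
    moreover have "a = d \<otimes> a' [^] (3::int)"
      using a a' H.int_pow_mult[of a' "-3" 3] by (simp add: d_def H.m_assoc)
    ultimately show ?thesis using a' by blast
  qed
  have "prime (3::int)" by simp
  then obtain m where m: "m \<noteq> 0" "\<And>a. a \<in> A \<Longrightarrow> a [^] (m::int) \<in> E"
    using nakayama[OF E_sub _ _ div3] by (auto simp: E_def)
  \<comment> \<open>The factor 2 comes from applying \<open>D i\<close> on
    \<open>B i\<close>.\<close>
  define M where "M = 2 * m"
  have M: "M \<noteq> 0" using m by (simp add: M_def)
  have pow_c0: "\<exists>e::int. b [^] M = c0 [^] e" if b: "b \<in> B i" for b
  proof -
    have "D i (b [^] m) = b [^] M"
      unfolding D_pow[OF i B_A[OF b]] D_on_B[OF i b] M_def using B_A[OF b] by (simp add: H.int_pow_pow)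
    then show ?thesis using m(2)[OF B_A[OF b]] by (auto simp: E_def)
  qed
  \<comment> \<open>The exponents over \<open>c0\<close> identify \<open>B i\<close> with a subgroup
    of the integers.\<close>
  define K where "K = {e::int. \<exists>b\<in>B i. b [^] M = c0 [^] e}"
  have "\<exists>g\<in>K. \<forall>a\<in>K. g dvd a"
  proof (rule int_subgroup_cyclic)
    have "c0 [^] (0::int) \<in> B i" by (rule B_pow[OF c0(2)])
    then have "\<one> \<in> B i" by simp
    moreover have "\<one> [^] M = c0 [^] (0::int)" by simp
    ultimately show "0 \<in> K" unfolding K_def by blast
    fix e f assume "e \<in> K" "f \<in> K"
    then obtain b b' where b: "b \<in> B i" "b [^] M = c0 [^] e" "b' \<in> B i" "b' [^] M = c0 [^] f"
      by (auto simp: K_def)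
    have "(b \<otimes> b' [^] (-1::int)) [^] M = b [^] M \<otimes> (b' [^] M) [^] (-1::int)"
      unfolding pow_mult_A[OF B_A[OF b(1)] A_int_pow[OF B_A[OF b(3)]]] pow_commute[OF B_A[OF b(3)], of "-1" M] ..
    also have "\<dots> = c0 [^] (e - f)"
      unfolding b using c0 H.int_pow_mult[of c0 e "- f"] by (simp add: H.int_pow_pow)
    finally show "e - f \<in> K" using B_mult[OF b(1) B_pow[OF b(3)]] by (auto simp: K_def)
  qed
  then obtain g where g: "g \<in> K" "\<And>a. a \<in> K \<Longrightarrow> g dvd a" by blast
  then obtain \<beta> where \<beta>: "\<beta> \<in> B i" "\<beta> [^] M = c0 [^] g" by (auto simp: K_def)
  have gen: "\<exists>k::int. b = \<beta> [^] k" if b: "b \<in> B i" for b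
  proof -
    obtain e :: int where e: "b [^] M = c0 [^] e" using pow_c0[OF b] by blast
    then have "e \<in> K" using b by (auto simp: K_def)
    then obtain k where k: "e = g * k" using g(2) by (auto elim: dvdE)
    have A: "b \<in> A" "\<beta> \<in> A" using b \<beta> B_A by auto
    have "(b \<otimes> \<beta> [^] (- k)) [^] M = b [^] M \<otimes> (\<beta> [^] M) [^] (- k)"
      unfolding pow_mult_A[OF A(1) A_int_pow[OF A(2)]] pow_commute[OF A(2), of "- k" M] ..
    also have "\<dots> = c0 [^] (e + g * (- k))"
      unfolding e \<beta>(2) using c0 H.int_pow_mult[of c0 e "- (g * k)"] by (simp add: H.int_pow_pow)
    also have "\<dots> = \<one>" by (simp add: k)
    finally have "b \<otimes> \<beta> [^] (- k) = \<one>" using A_torsion_free[OF _ _ M] A by simp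
    then have "b \<otimes> \<beta> [^] (- k) \<otimes> \<beta> [^] k = \<beta> [^] k" using A by simp
    moreover have "\<beta> [^] (- k) \<otimes> \<beta> [^] k = \<one>"
      using A H.int_pow_mult[of \<beta> "- k" k, symmetric] by simp
    moreover have "b \<otimes> \<beta> [^] (- k) \<otimes> \<beta> [^] k = b \<otimes> (\<beta> [^] (- k) \<otimes> \<beta> [^] k)"
      by (intro H.m_assoc A_carrier A_int_pow A)
    ultimately have "b = \<beta> [^] k" using A by (simp only: H.r_one A_carrier)
    then show ?thesis by blast
  qed
  have "\<beta> \<noteq> \<one>" using gen[OF c0(2)] c0_ne by auto
  then show ?thesis using \<beta>(1) gen by blast
qed

section \<open>The profinite unit of a line, and its comparison with those of adjacent lines\<close>

definition beta :: "'i \<Rightarrow> 'h" where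
  "beta i = (SOME \<beta>. \<beta> \<in> B i \<and> \<beta> \<noteq> \<one> \<and> (\<forall>b\<in>B i. \<exists>k::int. b = \<beta> [^] k))"

lemma beta:
  assumes "i \<in> I"
  shows "beta i \<in> B i" "beta i \<noteq> \<one>" "b \<in> B i \<Longrightarrow> \<exists>k::int. b = beta i [^] k"
proof -
  have "\<exists>\<beta>. \<beta> \<in> B i \<and> \<beta> \<noteq> \<one> \<and> (\<forall>b\<in>B i. \<exists>k::int. b = \<beta> [^] k)" using B_cyclic[OF assms] by blast
  from someI_ex[OF this] show "beta i \<in> B i" "beta i \<noteq> \<one>" "b \<in> B i \<Longrightarrow> \<exists>k::int. b = beta i [^] k"
    by (simp_all add: beta_def)
qed

abbreviation beta_coord :: "nat \<Rightarrow> 'i \<Rightarrow> int" where "beta_coord N i \<equiv> x N (beta i) i"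

text \<open>A common prime factor \<open>p\<close> would make \<open>beta i\<close> a
  \<open>p\<close>-th power in \<open>A\<close> by \<open>root_exists\<close>, hence in
  \<open>B i\<close> by purity. That is impossible for a generator of infinite order.\<close>

lemma w_coprime:
  assumes i: "i \<in> I" and N: "N > 0"
  shows "coprime (beta_coord N i) (int N)"
proof (rule ccontr)
  assume "\<not> coprime (beta_coord N i) (int N)"
  then have "gcd (beta_coord N i) (int N) \<noteq> 1" by (simp add: coprime_iff_gcd_eq_1)
  moreover have "gcd (beta_coord N i) (int N) \<noteq> 0" using N by simp
  ultimately obtain q where q: "q dvd gcd (beta_coord N i) (int N)" "prime q"
    using prime_divisor_exists[of "gcd (beta_coord N i) (int N)"] by auto
  define p where "p = nat q"
  have p: "p > 0" "int p = q" using q(2) prime_gt_0_int[of q] by (simp_all add: p_def)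
  have bA: "beta i \<in> A" by (rule B_A[OF beta(1)[OF i]])
  have "p dvd N" using q(1) p(2) by (metis gcd_greatest_iff of_nat_dvd_iff)
  then have coh: "[beta_coord N i = beta_coord p i] (mod int p)" by (intro x_coherent[OF _ N A_carrier[OF bA] i])
  have "q dvd beta_coord N i" using q(1) by simp
  then have "[beta_coord N i = 0] (mod int p)" unfolding p(2) cong_0_iff .
  with cong_sym[OF coh] have wp: "[beta_coord p i = 0] (mod int p)" by (rule cong_trans)
  have "\<exists>b\<in>A. beta i = b [^] int p"
  proof (rule root_exists[OF p(1) bA])
    fix j assume j: "j \<in> I"
    show "[x p (beta i) j = 0] (mod int p)"
      using wp B_coord[OF beta(1)[OF i] p(1) j] by (cases "j = i") auto
  qed
  then obtain b where b: "b \<in> A" "beta i = b [^] int p" by blast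
  have "b [^] int p \<in> B i" using beta(1)[OF i] b(2) by simp
  then have "b \<in> B i" using B_root[OF b(1)] p(1) by simp
  then obtain k :: int where k: "b = beta i [^] k" using beta(3)[OF i] by blast
  have "beta i [^] (k * int p) = beta i" using b(2) k bA by (simp add: H.int_pow_pow)
  then have "beta i [^] (k * int p + - 1) = \<one>"
    using bA H.int_pow_mult[of "beta i" "k * int p" "- 1"] H.int_pow_neg[of "beta i" 1] by simp
  moreover have "k * int p + - 1 \<noteq> 0"
  proof
    assume "k * int p + - 1 = 0"
    then have "q * k = 1" using p(2) by (simp add: mult.commute)
    moreover have "q dvd q * k" by simp
    ultimately have "is_unit q" by (simp only:)
    then show False using q(2) not_prime_unit by blast
  qed
  ultimately show False using A_torsion_free[OF bA] beta(2)[OF i] by blast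
qed

text \<open>\<open>D i (beta j)\<close> lies in \<open>B i\<close> and is therefore a power of
  \<open>beta i\<close>; its coordinate is computed in two ways.\<close>

lemma w_relation:
  assumes "i \<in> I" "j \<in> I"
  shows "\<exists>m. \<forall>N>0. [c i j * beta_coord N j = m * beta_coord N i] (mod int N)"
proof -
  have bj: "beta j \<in> B j" "beta j \<in> A" and bi: "beta i \<in> A" using beta(1) B_A assms by blast+
  obtain m :: int where m: "D i (beta j) = beta i [^] m" using beta(3)[OF assms(1) D_B[OF assms(1) bj(2)]] by blast
  have "[c i j * beta_coord N j = m * beta_coord N i] (mod int N)" if N: "N > 0" for N
  proof -
    have "[c i j * beta_coord N j = x N (D i (beta j)) i] (mod int N)"
      by (rule cong_sym[OF x_D_B[OF N assms bj(1)]])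
    also have "[x N (D i (beta j)) i = m * beta_coord N i] (mod int N)"
      unfolding m by (rule x_A_pow[OF N bi assms(1)])
    finally show ?thesis .
  qed
  then show ?thesis by blast
qed

text \<open>At level \<open>|a|\<close> the left side vanishes, and the unit on the right can be
  cancelled. If \<open>a = 0\<close>, this works at every level and gives
  \<open>b = 0\<close>.\<close>

lemma multiplier_dvd:
  assumes rel: "\<And>N. N > 0 \<Longrightarrow> [a * beta_coord N j = b * beta_coord N i] (mod int N)" and i: "i \<in> I"
  shows "a dvd b"
proof (cases "a = 0")
  case True
  have "b = 0"
  proof (rule zero_if_divisible)
    fix N :: nat assume N: "N > 0"
    have "[b * beta_coord N i = 0] (mod int N)" using rel[OF N] True by (simp add: cong_sym)
    then show "int N dvd b" using w_coprime[OF i N] by (simp add: cong_0_iff coprime_dvd_mult_left_iff coprime_commute)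
  qed
  then show ?thesis by simp
next
  case False
  define N where "N = nat \<bar>a\<bar>"
  have N: "N > 0" using False by (simp add: N_def)
  have "int N dvd a * beta_coord N j" by (simp add: N_def)
  then have "int N dvd b * beta_coord N i" using rel[OF N] by (simp add: cong_dvd_iff)
  then have "int N dvd b" using w_coprime[OF i N] by (simp add: coprime_dvd_mult_left_iff coprime_commute)
  then show ?thesis by (simp add: N_def)
qed

text \<open>The Cartan integer and the multiplier from \<open>w_relation\<close> divide each other,
  so they differ by a sign.\<close>

lemma w_sign:
  assumes "i \<in> I" "j \<in> I" "c i j \<noteq> 0"
  shows "\<exists>\<epsilon>\<in>{1, -1}. \<forall>N>0. [beta_coord N j = \<epsilon> * beta_coord N i] (mod int N)"
proof -
  obtain m where m: "\<And>N. N > 0 \<Longrightarrow> [c i j * beta_coord N j = m * beta_coord N i] (mod int N)"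
    using w_relation[OF assms(1,2)] by blast
  have cm: "c i j dvd m" by (rule multiplier_dvd[OF m assms(1)])
  have "m dvd c i j" by (rule multiplier_dvd[OF cong_sym[OF m] assms(2)])
  then have "\<bar>m\<bar> = \<bar>c i j\<bar>" by (rule zdvd_antisym_abs[OF _ cm])
  then have "m = c i j * 1 \<or> m = c i j * (- 1)" by (simp add: abs_eq_iff)
  then obtain \<epsilon> :: int where \<epsilon>: "\<epsilon> \<in> {1, -1}" "m = c i j * \<epsilon>" by blast
  have "[beta_coord N j = \<epsilon> * beta_coord N i] (mod int N)" if N: "N > 0" for N
  proof -
    \<comment> \<open>The extra factor in the level is spent on cancelling
      \<open>c i j\<close>.\<close>
    define M where "M = nat \<bar>c i j\<bar> * N"
    have M: "M > 0" "N dvd M" "int M = \<bar>c i j\<bar> * int N" using N assms(3) by (simp_all add: M_def)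
    have "int M dvd c i j * (beta_coord M j - \<epsilon> * beta_coord M i)"
      using m[OF M(1)] by (simp add: \<epsilon>(2) cong_iff_dvd_diff right_diff_distrib mult.assoc)
    then have "c i j * int N dvd c i j * (beta_coord M j - \<epsilon> * beta_coord M i)"
      unfolding M(3) by (cases "c i j \<ge> 0") auto
    then have 1: "[beta_coord M j = \<epsilon> * beta_coord M i] (mod int N)" using assms(3) by (simp add: cong_iff_dvd_diff)
    have coh: "[beta_coord M k = beta_coord N k] (mod int N)" if "k \<in> I" for k
      by (rule x_coherent[OF M(2,1) A_carrier[OF B_A[OF beta(1)[OF that]]] that])
    show ?thesis
      by (rule cong_trans[OF cong_sym[OF coh[OF assms(2)]]
            cong_trans[OF 1 cong_mult[OF cong_refl coh[OF assms(1)]]]])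
  qed
  then show ?thesis using \<epsilon>(1) by blast
qed

text \<open>The coordinates of the \<open>beta i\<close> are units of the profinite integers. Units at adjacent nodes
  agree up to sign, since the only rational units are \<open>1\<close> and \<open>-1\<close>; fixing the signs makes them equal.\<close>

lemma adjusted_basis:
  "\<exists>b. (\<forall>i\<in>I. b i \<in> B i \<and> (\<forall>N>0. coprime (x N (b i) i) (int N))) \<and>
    (\<forall>i\<in>I. \<forall>j\<in>I. c i j \<noteq> 0 \<longrightarrow> (\<forall>N>0. [x N (b j) j = x N (b i) i] (mod int N)))"
proof -
  define rel where "rel i j \<longleftrightarrow> (\<exists>\<epsilon>\<in>{1, -1::int}. \<forall>N>0. [beta_coord N j = \<epsilon> * beta_coord N i] (mod int N))" for i j
  have rel_refl: "rel i i" for i unfolding rel_def by (intro bexI[of _ 1]) auto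
  have rel_sym: "rel j i" if r: "rel i j" for i j
  proof -
    obtain \<epsilon> :: int where e: "\<epsilon> \<in> {1, -1}" "\<And>N. N > 0 \<Longrightarrow> [beta_coord N j = \<epsilon> * beta_coord N i] (mod int N)"
      using r unfolding rel_def by blast
    have "[beta_coord N i = \<epsilon> * beta_coord N j] (mod int N)" if N: "N > 0" for N
    proof -
      have "[\<epsilon> * beta_coord N j = \<epsilon> * (\<epsilon> * beta_coord N i)] (mod int N)" by (rule cong_mult[OF cong_refl e(2)[OF N]])
      moreover have "\<epsilon> * (\<epsilon> * beta_coord N i) = beta_coord N i" using e(1) by auto
      ultimately show ?thesis by (simp add: cong_sym)
    qed
    then show ?thesis using e(1) unfolding rel_def by blast
  qed
  have rel_trans: "rel i k" if r: "rel i j" "rel j k" for i j k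
  proof -
    obtain \<epsilon> :: int where e: "\<epsilon> \<in> {1, -1}" "\<And>N. N > 0 \<Longrightarrow> [beta_coord N j = \<epsilon> * beta_coord N i] (mod int N)"
      using r(1) unfolding rel_def by blast
    obtain \<delta> :: int where d: "\<delta> \<in> {1, -1}" "\<And>N. N > 0 \<Longrightarrow> [beta_coord N k = \<delta> * beta_coord N j] (mod int N)"
      using r(2) unfolding rel_def by blast
    have "[beta_coord N k = (\<delta> * \<epsilon>) * beta_coord N i] (mod int N)" if N: "N > 0" for N
      using cong_trans[OF d(2)[OF N] cong_mult[OF cong_refl e(2)[OF N]]] by (simp add: mult.assoc)
    moreover have "\<delta> * \<epsilon> \<in> {1, -1}" using d(1) e(1) by auto
    ultimately show ?thesis unfolding rel_def by blast
  qed
  \<comment> \<open>Measuring all signs against one representative of each class keeps them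
    consistent.\<close>
  define rep where "rep i = (SOME k. rel k i)" for i
  have rep: "rel (rep i) i" for i unfolding rep_def by (rule someI[of "\<lambda>k. rel k i" i]) (rule rel_refl)
  have rep_eq: "rep i = rep j" if r: "rel i j" for i j
  proof -
    have "(\<lambda>k. rel k i) = (\<lambda>k. rel k j)" 
      by (intro ext iffI) (erule rel_trans[OF _ r], erule rel_trans[OF _ rel_sym[OF r]])
    then show ?thesis by (simp add: rep_def)
  qed
  have "\<exists>\<epsilon>. \<epsilon> \<in> {1, -1::int} \<and> (\<forall>N>0. [beta_coord N i = \<epsilon> * beta_coord N (rep i)] (mod int N))" for i
    using rep[of i] unfolding rel_def Bex_def .
  from choice[OF allI[OF this]]
  obtain \<epsilon> where "\<forall>i. \<epsilon> i \<in> {1, -1::int} \<and> (\<forall>N>0. [beta_coord N i = \<epsilon> i * beta_coord N (rep i)] (mod int N))"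
    by (rule exE)
  then have \<epsilon>: "\<epsilon> i \<in> {1, -1::int}" "N > 0 \<Longrightarrow> [beta_coord N i = \<epsilon> i * beta_coord N (rep i)] (mod int N)" for i N
    by blast+
  define b where "b i = beta i [^] \<epsilon> i" for i
  have xb: "[x N (b i) i = \<epsilon> i * beta_coord N i] (mod int N)" if "N > 0" "i \<in> I" for N i
    unfolding b_def using that beta(1) B_A by (intro x_A_pow) auto
  have xb': "[x N (b i) i = beta_coord N (rep i)] (mod int N)" if N: "N > 0" "i \<in> I" for N i
  proof -
    have "[x N (b i) i = \<epsilon> i * (\<epsilon> i * beta_coord N (rep i))] (mod int N)"
      by (rule cong_trans[OF xb[OF N] cong_mult[OF cong_refl \<epsilon>(2)[OF N(1)]]])
    moreover have "\<epsilon> i * (\<epsilon> i * beta_coord N (rep i)) = beta_coord N (rep i)" using \<epsilon>(1)[of i] by auto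
    ultimately show ?thesis by simp
  qed
  have "b i \<in> B i" if "i \<in> I" for i unfolding b_def by (rule B_pow[OF beta(1)[OF that]])
  moreover have "coprime (x N (b i) i) (int N)" if N: "N > 0" "i \<in> I" for N i
  proof -
    have "coprime (\<epsilon> i * beta_coord N i) (int N)" using \<epsilon>(1)[of i] w_coprime[OF N(2,1)] by auto
    then show ?thesis using cong_imp_coprime[OF cong_sym[OF xb[OF N]]] by simp
  qed
  moreover have "[x N (b j) j = x N (b i) i] (mod int N)" if "i \<in> I" "j \<in> I" "c i j \<noteq> 0" "N > 0" for i j N
  proof -
    have "rep i = rep j" using w_sign[OF that(1-3)] by (intro rep_eq) (simp add: rel_def)
    then have "[beta_coord N (rep j) = x N (b i) i] (mod int N)" using cong_sym[OF xb'[OF that(4,1)]] by (simp only:)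
    then show ?thesis by (rule cong_trans[OF xb'[OF that(4,2)]])
  qed
  ultimately show ?thesis by (intro exI[of _ b]) blast
qed

end

section \<open>Rescaled coordinates and the splitting of the extension\<close>

locale profinite_lattice_basis = profinite_lattice_data +
  fixes b
  assumes b_B: "i \<in> I \<Longrightarrow> b i \<in> B i"
    and b_coprime: "i \<in> I \<Longrightarrow> N > 0 \<Longrightarrow> coprime (x N (b i) i) (int N)"
    and b_cartan: "i \<in> I \<Longrightarrow> j \<in> I \<Longrightarrow> c i j \<noteq> 0 \<Longrightarrow> N > 0 \<Longrightarrow>
      [x N (b j) j = x N (b i) i] (mod int N)"
begin

lemma b_A: "i \<in> I \<Longrightarrow> b i \<in> A"
  by (rule B_A[OF b_B])

abbreviation u :: "nat \<Rightarrow> 'a \<Rightarrow> int" where "u N i \<equiv> x N (b i) i"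

abbreviation F :: "('a \<Rightarrow> int) \<Rightarrow> 'c" where "F \<equiv> P b I"

lemma F_A: "F v \<in> A"
  by (rule P_closed) (rule b_A)

lemma F_add: "F (\<lambda>i. v i + w i) = F v \<otimes> F w"
  by (rule P_add) (rule b_A)

lemma F_cong: "(\<And>i. i \<in> I \<Longrightarrow> v i = w i) \<Longrightarrow> F v = F w"
  by (rule P_cong[OF b_A])

lemma x_F:
  assumes "N > 0" "i \<in> I"
  shows "[x N (F v) i = v i * u N i] (mod int N)"
proof -
  have "[x N (F v) i = (\<Sum>j\<in>I. v j * x N (b j) i)] (mod int N)"
    by (rule x_P[OF finite_I b_A assms])
  also have "[(\<Sum>j\<in>I. v j * x N (b j) i) = (\<Sum>j\<in>I. if j = i then v i * u N i else 0)] (mod int N)"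
  proof (rule cong_sum)
    fix j assume j: "j \<in> I"
    show "[v j * x N (b j) i = (if j = i then v i * u N i else 0)] (mod int N)"
    proof (cases "j = i")
      case False
      have "[v j * x N (b j) i = v j * 0] (mod int N)"
        using False by (intro cong_mult cong_refl B_coord[OF b_B[OF j] assms]) auto
      then show ?thesis using False by simp
    qed simp
  qed
  also have "(\<Sum>j\<in>I. if j = i then v i * u N i else 0) = v i * u N i" using assms(2) finite_I by simp
  finally show ?thesis .
qed

lemma F_eqD:
  assumes "F v = F w" "i \<in> I"
  shows "v i = w i"
proof -
  have "v i - w i = 0"
  proof (rule zero_if_divisible)
    fix N :: nat assume N: "N > 0"
    have "[v i * u N i = x N (F v) i] (mod int N)" by (rule cong_sym[OF x_F[OF N assms(2)]])
    also have "[x N (F v) i = w i * u N i] (mod int N)" unfolding assms(1) by (rule x_F[OF N assms(2)])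
    finally have "int N dvd (v i - w i) * u N i" by (simp add: cong_iff_dvd_diff left_diff_distrib)
    then show "int N dvd v i - w i"
      using b_coprime[OF assms(2) N] by (simp add: coprime_dvd_mult_left_iff coprime_commute)
  qed
  then show ?thesis by simp
qed

text \<open>Modulo \<open>N\<close> the units can be inverted, so suitable exponents reproduce all
  coordinates of \<open>a\<close>; \<open>root_exists\<close> turns the difference into an
  \<open>N\<close>-th power.\<close>

lemma F_approx:
  assumes N: "N > 0" and a: "a \<in> A"
  shows "\<exists>v. \<exists>a'\<in>A. a = F v \<otimes> a' [^] int N"
proof -
  have "\<exists>k. [k * u N i = x N a i] (mod int N)" if i: "i \<in> I" for i
  proof -
    obtain y where "[u N i * y = 1] (mod int N)"
      using cong_solve_coprime_int[OF b_coprime[OF i N]] by blast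
    then have "[u N i * y * x N a i = 1 * x N a i] (mod int N)" by (rule cong_mult[OF _ cong_refl])
    then show ?thesis by (intro exI[of _ "y * x N a i"]) (simp add: mult_ac)
  qed
  then obtain v where v: "\<And>i. i \<in> I \<Longrightarrow> [v i * u N i = x N a i] (mod int N)" by metis
  have iA: "inv (F v) \<in> A" by (rule A_closed(3)[OF F_A])
  have "\<exists>a'\<in>A. inv (F v) \<otimes> a = a' [^] int N"
  proof (rule root_exists[OF N])
    show "inv (F v) \<otimes> a \<in> A" by (rule A_closed(1)[OF iA a])
    fix i assume i: "i \<in> I"
    have "[x N (inv (F v) \<otimes> a) i = x N (inv (F v)) i + x N a i] (mod int N)"
      by (rule x_A_mult[OF N iA A_carrier[OF a] i])
    also have "[x N (inv (F v)) i + x N a i = - x N (F v) i + v i * u N i] (mod int N)"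
      by (intro cong_add x_A_inv[OF N F_A i] cong_sym[OF v[OF i]])
    also have "[- x N (F v) i + v i * u N i = - (v i * u N i) + v i * u N i] (mod int N)"
      by (intro cong_add cong_refl) (simp only: cong_minus_minus_iff x_F[OF N i])
    finally show "[x N (inv (F v) \<otimes> a) i = 0] (mod int N)" by simp
  qed
  then obtain a' where a': "a' \<in> A" "inv (F v) \<otimes> a = a' [^] int N" by blast
  have "F v \<otimes> (inv (F v) \<otimes> a) = a"
    using A_carrier[OF F_A[of v]] A_carrier[OF a] by (simp add: H.m_assoc[symmetric])
  then show ?thesis using a' by metis
qed

text \<open>Approximation modulo 3 and \<open>nakayama\<close> place all \<open>m\<close>-th powers
  in the range, and a second approximation modulo \<open>|m|\<close> leaves only such a power. Any
  prime could take the place of 3 here.\<close>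

lemma F_surj:
  assumes a: "a \<in> A"
  shows "\<exists>v. a = F v"
proof -
  have sub: "subgroup (range F) H"
  proof (rule H.subgroupI)
    show "range F \<subseteq> carrier H" using F_A by auto
    fix a assume "a \<in> range F"
    then obtain v where v: "a = F v" by blast
    have "inv a = F (\<lambda>i. - v i)" unfolding v by (rule P_neg[symmetric, OF b_A])
    then show "inv a \<in> range F" by blast
    fix b assume "b \<in> range F"
    then obtain w where w: "b = F w" by blast
    have "a \<otimes> b = F (\<lambda>i. v i + w i)" unfolding v w by (rule F_add[symmetric])
    then show "a \<otimes> b \<in> range F" by blast
  qed blast
  have "\<exists>d\<in>range F. \<exists>b\<in>A. a = d \<otimes> b [^] (3::int)" if a: "a \<in> A" for a
    using F_approx[OF _ a, of 3] by auto
  moreover have "prime (3::int)" by simp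
  moreover have "range F \<subseteq> A" using F_A by auto
  ultimately obtain m where m: "m \<noteq> 0" "\<And>a. a \<in> A \<Longrightarrow> a [^] (m::int) \<in> range F"
    using nakayama[OF sub, of 3] by blast
  have "nat \<bar>m\<bar> > 0" using m(1) by simp
  from F_approx[OF this a] obtain v a' where v: "a' \<in> A" "a = F v \<otimes> a' [^] int (nat \<bar>m\<bar>)" by blast
  have "a' [^] int (nat \<bar>m\<bar>) \<in> range F"
  proof (cases "m \<ge> 0")
    case True then show ?thesis using m(2)[OF v(1)] by simp
  next
    case False
    then have "a' [^] int (nat \<bar>m\<bar>) = inv (a' [^] m)" using v(1) by (simp add: H.int_pow_neg)
    then show ?thesis using subgroup.m_inv_closed[OF sub m(2)[OF v(1)]] by simp
  qed
  then have "a \<in> range F" unfolding v(2) by (intro subgroup.m_closed[OF sub]) auto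
  then show ?thesis by blast
qed

text \<open>This says that the diagonal matrix of the units commutes with each \<open>R g\<close>.
  For a reflection an entry off the diagonal is nonzero only where \<open>c i j\<close> is, and
  there the units agree; the property passes to products.\<close>

lemma u_cong:
  assumes "g \<in> carrier G" "i \<in> I" "j \<in> I" "N > 0"
  shows "[R g i j * u N j = R g i j * u N i] (mod int N)"
proof -
  obtain S where S: "S \<subseteq> carrier G" "generate G S = carrier G"
    "\<And>t. t \<in> S \<Longrightarrow> t \<otimes>\<^bsub>G\<^esub> t = \<one>\<^bsub>G\<^esub>"
    "\<And>t. t \<in> S \<Longrightarrow> (\<exists>i\<in>I. t = s i) \<or> (\<forall>i\<in>I. \<forall>k\<in>I. R t i k = (if i = k then 1 else 0))"
    using generated by blast
  have base: "\<forall>i\<in>I. \<forall>j\<in>I. [R t i j * u N j = R t i j * u N i] (mod int N)" if t: "t \<in> S" for t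
  proof (intro ballI)
    fix i j assume ij: "i \<in> I" "j \<in> I"
    show "[R t i j * u N j = R t i j * u N i] (mod int N)"
    proof (cases "i = j \<or> R t i j = 0")
      case False
      then obtain k where k: "k \<in> I" "t = s k" using S(4)[OF t] ij by auto
      then have "i = k" "c k j \<noteq> 0" using False R_s[OF k(1) ij] by (auto split: if_splits)
      then show ?thesis using b_cartan[OF k(1) ij(2) _ assms(4)] by (auto intro: cong_mult)
    qed auto
  qed
  have "g \<in> generate G S" using assms(1) S(2) by simp
  then have "\<forall>i\<in>I. \<forall>j\<in>I. [R g i j * u N j = R g i j * u N i] (mod int N)"
  proof (induction rule: generate.induct)
    case one then show ?case by (auto simp: R_one)
  next
    case (incl h) then show ?case by (rule base)
  next
    case (inv h)
    have "inv\<^bsub>G\<^esub> h = h" using S(1) S(3)[OF inv] inv by (intro G.inv_equality) auto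
    then show ?case using base[OF inv] by simp
  next
    case (eng h1 h2)
    have h: "h1 \<in> carrier G" "h2 \<in> carrier G" using eng.hyps S(2) by auto
    show ?case
    proof (intro ballI)
      fix i k assume ik: "i \<in> I" "k \<in> I"
      have "[R h1 i j * R h2 j k * u N k = R h1 i j * R h2 j k * u N i] (mod int N)" if j: "j \<in> I" for j
      proof -
        have "[R h1 i j * (R h2 j k * u N k) = R h1 i j * (R h2 j k * u N j)] (mod int N)"
          by (rule cong_mult[OF cong_refl]) (use eng.IH(2) j ik in blast)
        also have "R h1 i j * (R h2 j k * u N j) = R h2 j k * (R h1 i j * u N j)" by (simp add: mult_ac)
        also have "[R h2 j k * (R h1 i j * u N j) = R h2 j k * (R h1 i j * u N i)] (mod int N)"
          by (rule cong_mult[OF cong_refl]) (use eng.IH(1) j ik in blast)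
        finally show ?thesis by (simp add: mult_ac)
      qed
      then have "[(\<Sum>j\<in>I. R h1 i j * R h2 j k * u N k) = (\<Sum>j\<in>I. R h1 i j * R h2 j k * u N i)] (mod int N)"
        by (rule cong_sum)
      then show "[R (h1 \<otimes>\<^bsub>G\<^esub> h2) i k * u N k = R (h1 \<otimes>\<^bsub>G\<^esub> h2) i k * u N i] (mod int N)"
        by (simp add: R_mult[OF h ik] sum_distrib_right)
    qed
  qed
  then show ?thesis using assms(2,3) by blast
qed

text \<open>The action on the coordinates commutes with the rescaling by \<open>u_cong\<close>, so
  \<open>F\<close> carries the integral action to conjugation.\<close>

lemma F_conj:
  assumes h: "h \<in> carrier H"
  shows "h \<otimes> F v \<otimes> inv h = F (lattice_act I (R (\<omega> h)) v)"
proof (rule separated_eq[OF A_conj[OF F_A h] F_A])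
  fix N :: nat and i assume N: "N > 0" "i \<in> I"
  have "[x N (h \<otimes> F v \<otimes> inv h) i = lattice_act I (R (\<omega> h)) (x N (F v)) i] (mod int N)"
    by (rule x_conj[OF N(1) F_A h N(2)])
  also have "[lattice_act I (R (\<omega> h)) (x N (F v)) i = lattice_act I (R (\<omega> h)) (\<lambda>j. v j * u N j) i] (mod int N)"
    by (intro lattice_act_cong_mod x_F N(1))
  also have "lattice_act I (R (\<omega> h)) (\<lambda>j. v j * u N j) i = (\<Sum>j\<in>I. v j * (R (\<omega> h) i j * u N j))"
    using N(2) by (simp add: lattice_act_def mult_ac)
  also have "[(\<Sum>j\<in>I. v j * (R (\<omega> h) i j * u N j)) = (\<Sum>j\<in>I. v j * (R (\<omega> h) i j * u N i))] (mod int N)"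
    using N h by (intro cong_sum cong_mult cong_refl u_cong) auto
  also have "(\<Sum>j\<in>I. v j * (R (\<omega> h) i j * u N i)) = lattice_act I (R (\<omega> h)) v i * u N i"
    using N(2) by (simp add: lattice_act_def sum_distrib_left sum_distrib_right mult_ac)
  also have "[lattice_act I (R (\<omega> h)) v i * u N i = x N (F (lattice_act I (R (\<omega> h)) v)) i] (mod int N)"
    by (rule cong_sym[OF x_F[OF N]])
  finally show "[x N (h \<otimes> F v \<otimes> inv h) i = x N (F (lattice_act I (R (\<omega> h)) v)) i] (mod int N)" .
qed

lemma F_commute:
  assumes h: "h \<in> carrier H"
  shows "h \<otimes> F v = F (lattice_act I (R (\<omega> h)) v) \<otimes> h"
  unfolding F_conj[OF h, symmetric] using h A_carrier[OF F_A[of v]] by (simp add: H.m_assoc)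

text \<open>Multiplication by the order of \<open>G\<close> kills the extension class: a section landing in the
  preimage of the complement modulo \<open>card G\<close> has a cocycle divisible by \<open>card G\<close>, which is
  then a coboundary by averaging.\<close>

lemma section_exists:
  "\<exists>\<sigma>. (\<forall>g\<in>carrier G. \<sigma> g \<in> carrier H \<and> \<omega> (\<sigma> g) = g) \<and>
    (\<forall>g\<in>carrier G. \<forall>h\<in>carrier G. \<sigma> (g \<otimes>\<^bsub>G\<^esub> h) = \<sigma> g \<otimes> \<sigma> h)"
proof -
  define k where "k = card (carrier G)"
  have k: "k > 0" unfolding k_def using finite_G G.one_closed by (auto simp: card_gt_0_iff)
  \<comment> \<open>Density provides lifts that look modulo \<open>k\<close> like the complement
    \<open>G\<close> in the semidirect product.\<close>
  have "\<forall>g\<in>carrier G. \<exists>h. h \<in> carrier H \<and> \<omega> h = g \<and> (\<forall>i\<in>I. [x k h i = 0] (mod int k))"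
    using x_surj[OF k, of _ "\<lambda>_. 0"] by blast
  then obtain \<tau> where \<tau>: "\<And>g. g \<in> carrier G \<Longrightarrow> \<tau> g \<in> carrier H" "\<And>g. g \<in> carrier G \<Longrightarrow> \<omega> (\<tau> g) = g"
    "\<And>g i. g \<in> carrier G \<Longrightarrow> i \<in> I \<Longrightarrow> [x k (\<tau> g) i = 0] (mod int k)"
    by metis
  have "\<exists>d. \<tau> g \<otimes> \<tau> h = F (\<lambda>i. int k * d i) \<otimes> \<tau> (g \<otimes>\<^bsub>G\<^esub> h)"
    if gh: "g \<in> carrier G" "h \<in> carrier G" for g h
  proof -
    have gh': "g \<otimes>\<^bsub>G\<^esub> h \<in> carrier G" using gh by simp
    note mem = \<tau>(1)[OF gh(1)] \<tau>(1)[OF gh(2)] \<tau>(1)[OF gh']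
    define t where "t = \<tau> g \<otimes> \<tau> h \<otimes> inv (\<tau> (g \<otimes>\<^bsub>G\<^esub> h))"
    have tA: "t \<in> A" unfolding t_def using mem gh gh' by (intro A_memI) (simp_all add: \<tau>(2))
    have eq: "\<tau> g \<otimes> \<tau> h = t \<otimes> \<tau> (g \<otimes>\<^bsub>G\<^esub> h)" unfolding t_def using mem by (simp add: H.m_assoc)
    have "\<exists>a\<in>A. t = a [^] int k"
    proof (rule root_exists[OF k tA])
      fix i assume i: "i \<in> I"
      have "[x k t i + 0 = x k t i + x k (\<tau> (g \<otimes>\<^bsub>G\<^esub> h)) i] (mod int k)"
        by (intro cong_add cong_refl cong_sym[OF \<tau>(3)[OF gh' i]])
      also have "[x k t i + x k (\<tau> (g \<otimes>\<^bsub>G\<^esub> h)) i = x k (\<tau> g \<otimes> \<tau> h) i] (mod int k)"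
        unfolding eq by (rule cong_sym[OF x_A_mult[OF k tA mem(3) i]])
      also have "[x k (\<tau> g \<otimes> \<tau> h) i = x k (\<tau> g) i + lattice_act I (R (\<omega> (\<tau> g))) (x k (\<tau> h)) i] (mod int k)"
        by (rule x_mult[OF k mem(1,2) i])
      also have "[x k (\<tau> g) i + lattice_act I (R (\<omega> (\<tau> g))) (x k (\<tau> h)) i
          = 0 + lattice_act I (R (\<omega> (\<tau> g))) (\<lambda>_. 0) i] (mod int k)"
        by (intro cong_add lattice_act_cong_mod \<tau>(3) gh i)
      finally show "[x k t i = 0] (mod int k)" using i by (simp add: lattice_act_def)
    qed
    then obtain a where a: "a \<in> A" "t = a [^] int k" by blast
    obtain v where v: "a = F v" using F_surj[OF a(1)] by blast
    have "t = F (\<lambda>i. int k * v i)" unfolding a(2) v by (rule P_pow[symmetric, OF b_A])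
    then show ?thesis using eq by blast
  qed
  then obtain d where d: "\<And>g h. g \<in> carrier G \<Longrightarrow> h \<in> carrier G \<Longrightarrow>
      \<tau> g \<otimes> \<tau> h = F (\<lambda>i. int k * d g h i) \<otimes> \<tau> (g \<otimes>\<^bsub>G\<^esub> h)"
    by metis
  have Fc: "F v \<in> carrier H" for v by (rule A_carrier[OF F_A])
  have cocycle: "d g h i + d (g \<otimes>\<^bsub>G\<^esub> h) l i = lattice_act I (R g) (d h l) i + d g (h \<otimes>\<^bsub>G\<^esub> l) i"
    if g: "g \<in> carrier G" "h \<in> carrier G" "l \<in> carrier G" and i: "i \<in> I" for g h l i
  proof -
    have gs: "g \<otimes>\<^bsub>G\<^esub> h \<in> carrier G" "h \<otimes>\<^bsub>G\<^esub> l \<in> carrier G" "g \<otimes>\<^bsub>G\<^esub> h \<otimes>\<^bsub>G\<^esub> l \<in> carrier G" using g by simp_all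
    note mem = \<tau>(1)[OF g(1)] \<tau>(1)[OF g(2)] \<tau>(1)[OF g(3)] \<tau>(1)[OF gs(1)] \<tau>(1)[OF gs(2)] \<tau>(1)[OF gs(3)]
    let ?A = "\<lambda>i. int k * d g h i" and ?B = "\<lambda>i. int k * d (g \<otimes>\<^bsub>G\<^esub> h) l i"
      and ?C = "\<lambda>i. int k * d h l i" and ?D = "\<lambda>i. int k * d g (h \<otimes>\<^bsub>G\<^esub> l) i"
    let ?ghl = "\<tau> (g \<otimes>\<^bsub>G\<^esub> h \<otimes>\<^bsub>G\<^esub> l)"
    have "\<tau> g \<otimes> \<tau> h \<otimes> \<tau> l = F ?A \<otimes> (\<tau> (g \<otimes>\<^bsub>G\<^esub> h) \<otimes> \<tau> l)"
      unfolding d[OF g(1,2)] using mem Fc by (simp add: H.m_assoc)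
    also have "\<dots> = F (\<lambda>i. ?A i + ?B i) \<otimes> ?ghl"
      unfolding d[OF gs(1) g(3)] F_add using mem Fc by (simp add: H.m_assoc)
    finally have 1: "\<tau> g \<otimes> \<tau> h \<otimes> \<tau> l = F (\<lambda>i. ?A i + ?B i) \<otimes> ?ghl" .
    have "\<tau> g \<otimes> \<tau> h \<otimes> \<tau> l = \<tau> g \<otimes> (\<tau> h \<otimes> \<tau> l)" using mem by (simp add: H.m_assoc)
    also have "\<dots> = (\<tau> g \<otimes> F ?C) \<otimes> \<tau> (h \<otimes>\<^bsub>G\<^esub> l)"
      unfolding d[OF g(2,3)] using mem Fc by (simp add: H.m_assoc)
    also have "\<dots> = F (lattice_act I (R g) ?C) \<otimes> (\<tau> g \<otimes> \<tau> (h \<otimes>\<^bsub>G\<^esub> l))"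
      unfolding F_commute[OF mem(1)] \<tau>(2)[OF g(1)] using mem Fc by (simp add: H.m_assoc)
    also have "\<dots> = F (\<lambda>i. lattice_act I (R g) ?C i + ?D i) \<otimes> ?ghl"
      unfolding d[OF g(1) gs(2)] F_add using mem Fc g by (simp add: H.m_assoc G.m_assoc)
    finally have "F (\<lambda>i. ?A i + ?B i) \<otimes> ?ghl = F (\<lambda>i. lattice_act I (R g) ?C i + ?D i) \<otimes> ?ghl"
      unfolding 1 .
    then have "F (\<lambda>i. ?A i + ?B i) = F (\<lambda>i. lattice_act I (R g) ?C i + ?D i)"
      using mem(6) Fc H.right_cancel by blast
    from F_eqD[OF this i] have "int k * (d g h i + d (g \<otimes>\<^bsub>G\<^esub> h) l i) = int k * (lattice_act I (R g) (d h l) i + d g (h \<otimes>\<^bsub>G\<^esub> l) i)"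
      by (simp add: lattice_act_scale distrib_left)
    then show ?thesis using k by simp
  qed
  \<comment> \<open>Summing the cocycle identity over the last argument exhibits
    \<open>k * d\<close> as the coboundary of the integral function \<open>e\<close>. As
    \<open>k * d\<close> is precisely the cocycle of \<open>\<tau>\<close>, no division by
    \<open>k\<close> is needed.\<close>
  define e where "e g i = (\<Sum>l\<in>carrier G. d g l i)" for g i
  have e: "int k * d g h i + e (g \<otimes>\<^bsub>G\<^esub> h) i = lattice_act I (R g) (e h) i + e g i"
    if g: "g \<in> carrier G" "h \<in> carrier G" and i: "i \<in> I" for g h i
  proof -
    have "int k * d g h i + e (g \<otimes>\<^bsub>G\<^esub> h) i = (\<Sum>l\<in>carrier G. d g h i + d (g \<otimes>\<^bsub>G\<^esub> h) l i)"
      by (simp add: sum.distrib k_def e_def)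
    also have "\<dots> = (\<Sum>l\<in>carrier G. lattice_act I (R g) (d h l) i + d g (h \<otimes>\<^bsub>G\<^esub> l) i)"
      using cocycle g i by (intro sum.cong) auto
    also have "\<dots> = (\<Sum>l\<in>carrier G. lattice_act I (R g) (d h l) i) + (\<Sum>l\<in>carrier G. d g (h \<otimes>\<^bsub>G\<^esub> l) i)"
      by (rule sum.distrib)
    also have "(\<Sum>l\<in>carrier G. d g (h \<otimes>\<^bsub>G\<^esub> l) i) = e g i"
      unfolding e_def
    proof (rule sum.reindex_bij_betw)
      show "bij_betw (\<lambda>l. h \<otimes>\<^bsub>G\<^esub> l) (carrier G) (carrier G)"
      proof (rule bij_betw_byWitness[where f' = "\<lambda>l. inv\<^bsub>G\<^esub> h \<otimes>\<^bsub>G\<^esub> l"])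
        show "\<forall>l\<in>carrier G. inv\<^bsub>G\<^esub> h \<otimes>\<^bsub>G\<^esub> (h \<otimes>\<^bsub>G\<^esub> l) = l"
          "\<forall>l\<in>carrier G. h \<otimes>\<^bsub>G\<^esub> (inv\<^bsub>G\<^esub> h \<otimes>\<^bsub>G\<^esub> l) = l"
          using g by (simp_all add: G.m_assoc[symmetric])
      qed (use g in auto)
    qed
    also have "(\<Sum>l\<in>carrier G. lattice_act I (R g) (d h l) i) = lattice_act I (R g) (e h) i"
      using i unfolding lattice_act_def e_def by (simp add: sum_distrib_left sum.swap[of _ I "carrier G"])
    finally show ?thesis .
  qed
  define \<sigma> where "\<sigma> g = F (\<lambda>i. - e g i) \<otimes> \<tau> g" for g
  have "\<sigma> g \<in> carrier H \<and> \<omega> (\<sigma> g) = g" if "g \<in> carrier G" for g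
    unfolding \<sigma>_def using that \<tau>(1,2)[OF that] F_A A_\<omega>[OF F_A] Fc by simp
  moreover have "\<sigma> (g \<otimes>\<^bsub>G\<^esub> h) = \<sigma> g \<otimes> \<sigma> h" if g: "g \<in> carrier G" "h \<in> carrier G" for g h
  proof -
    have gh: "g \<otimes>\<^bsub>G\<^esub> h \<in> carrier G" using g by simp
    note mem = \<tau>(1)[OF g(1)] \<tau>(1)[OF g(2)] \<tau>(1)[OF gh]
    have "\<sigma> g \<otimes> \<sigma> h = F (\<lambda>i. - e g i) \<otimes> ((\<tau> g \<otimes> F (\<lambda>i. - e h i)) \<otimes> \<tau> h)"
      unfolding \<sigma>_def using mem Fc by (simp add: H.m_assoc)
    also have "\<dots> = F (\<lambda>i. - e g i) \<otimes> (F (lattice_act I (R g) (\<lambda>i. - e h i)) \<otimes> (\<tau> g \<otimes> \<tau> h))"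
      unfolding F_commute[OF mem(1)] \<tau>(2)[OF g(1)] using mem Fc by (simp add: H.m_assoc)
    also have "\<dots> = F (\<lambda>i. - e g i + (lattice_act I (R g) (\<lambda>i. - e h i) i + int k * d g h i)) \<otimes> \<tau> (g \<otimes>\<^bsub>G\<^esub> h)"
      unfolding d[OF g] F_add using mem Fc by (simp add: H.m_assoc)
    also have "F (\<lambda>i. - e g i + (lattice_act I (R g) (\<lambda>i. - e h i) i + int k * d g h i)) = F (\<lambda>i. - e (g \<otimes>\<^bsub>G\<^esub> h) i)"
    proof (rule F_cong)
      fix i assume i: "i \<in> I"
      have "lattice_act I (R g) (\<lambda>i. - e h i) i = - lattice_act I (R g) (e h) i"
        using lattice_act_scale[of I "R g" "- 1" "e h" i] by simp
      then show "- e g i + (lattice_act I (R g) (\<lambda>i. - e h i) i + int k * d g h i) = - e (g \<otimes>\<^bsub>G\<^esub> h) i"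
        using e[OF g i] by simp
    qed
    finally show ?thesis by (simp add: \<sigma>_def)
  qed
  ultimately show ?thesis by (intro exI[of _ \<sigma>]) blast
qed

theorem semidirect_iso: "lattice_semidirect I G R \<cong> H"
proof -
  let ?M = "lattice_semidirect I G R"
  obtain \<sigma> where \<sigma>0: "(\<forall>g\<in>carrier G. \<sigma> g \<in> carrier H \<and> \<omega> (\<sigma> g) = g) \<and>
    (\<forall>g\<in>carrier G. \<forall>h\<in>carrier G. \<sigma> (g \<otimes>\<^bsub>G\<^esub> h) = \<sigma> g \<otimes> \<sigma> h)"
    using section_exists by (rule exE)
  then have \<sigma>: "g \<in> carrier G \<Longrightarrow> \<sigma> g \<in> carrier H" "g \<in> carrier G \<Longrightarrow> \<omega> (\<sigma> g) = g"
    "g \<in> carrier G \<Longrightarrow> h \<in> carrier G \<Longrightarrow> \<sigma> (g \<otimes>\<^bsub>G\<^esub> h) = \<sigma> g \<otimes> \<sigma> h" for g h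
    by blast+
  have Fc: "F v \<in> carrier H" for v by (rule A_carrier[OF F_A])
  have F\<omega>: "\<omega> (F v) = \<one>\<^bsub>G\<^esub>" for v by (rule A_\<omega>[OF F_A])
  let ?f = "\<lambda>(v, g). F v \<otimes> \<sigma> g"
  have hom: "?f \<in> hom ?M H"
  proof (rule homI)
    fix y assume "y \<in> carrier ?M"
    then obtain v g where y: "y = (v, g)" "g \<in> carrier G" by (auto simp: lattice_semidirect_def)
    show "?f y \<in> carrier H" using y Fc \<sigma>(1) by simp
    fix z assume "z \<in> carrier ?M"
    then obtain v' h where z: "z = (v', h)" "h \<in> carrier G" by (auto simp: lattice_semidirect_def)
    note mem = \<sigma>(1)[OF y(2)] \<sigma>(1)[OF z(2)]
    have "F v \<otimes> \<sigma> g \<otimes> (F v' \<otimes> \<sigma> h) = F v \<otimes> ((\<sigma> g \<otimes> F v') \<otimes> \<sigma> h)"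
      using mem Fc by (simp add: H.m_assoc)
    also have "\<dots> = F (\<lambda>i. v i + lattice_act I (R g) v' i) \<otimes> \<sigma> (g \<otimes>\<^bsub>G\<^esub> h)"
      unfolding F_commute[OF mem(1)] \<sigma>(2)[OF y(2)] F_add \<sigma>(3)[OF y(2) z(2)]
      using mem Fc by (simp add: H.m_assoc)
    finally show "?f (y \<otimes>\<^bsub>?M\<^esub> z) = ?f y \<otimes> ?f z" by (simp add: y z lattice_semidirect_def)
  qed
  moreover have "bij_betw ?f (carrier ?M) (carrier H)"
  proof (rule bij_betw_imageI)
    show "inj_on ?f (carrier ?M)"
    proof (rule inj_onI)
      fix y z assume "y \<in> carrier ?M" "z \<in> carrier ?M" and eq: "?f y = ?f z"
      then obtain v g v' h where y: "y = (v, g)" "g \<in> carrier G" "\<And>i. i \<notin> I \<Longrightarrow> v i = 0"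
        and z: "z = (v', h)" "h \<in> carrier G" "\<And>i. i \<notin> I \<Longrightarrow> v' i = 0"
        by (auto simp: lattice_semidirect_def)
      have eq': "F v \<otimes> \<sigma> g = F v' \<otimes> \<sigma> h" using eq by (simp add: y(1) z(1))
      have "\<omega> (F v \<otimes> \<sigma> g) = g" "\<omega> (F v' \<otimes> \<sigma> h) = h"
        using Fc F\<omega> \<sigma>(1,2)[OF y(2)] \<sigma>(1,2)[OF z(2)] y(2) z(2) by simp_all
      then have gh: "g = h" using eq' by simp
      then have "F v = F v'" using eq' Fc \<sigma>(1)[OF z(2)] H.right_cancel by blast
      then have "v i = v' i" for i using F_eqD[of v v' i] y(3)[of i] z(3)[of i] by (cases "i \<in> I") simp_all
      then show "y = z" using y(1) z(1) gh by (simp add: fun_eq_iff)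
    qed
    show "?f ` carrier ?M = carrier H"
    proof
      show "?f ` carrier ?M \<subseteq> carrier H" by (rule hom_carrier[OF hom])
      show "carrier H \<subseteq> ?f ` carrier ?M"
      proof
        fix h assume h: "h \<in> carrier H"
        then have g: "\<omega> h \<in> carrier G" by simp
        note mem = \<sigma>(1)[OF g]
        have "h \<otimes> inv (\<sigma> (\<omega> h)) \<in> A" using h g mem \<sigma>(2)[OF g] by (intro A_memI) simp_all
        then obtain v where v: "h \<otimes> inv (\<sigma> (\<omega> h)) = F v" using F_surj by blast
        let ?v = "\<lambda>i. if i \<in> I then v i else 0"
        have "F ?v = F v" by (rule F_cong) simp
        then have "F ?v \<otimes> \<sigma> (\<omega> h) = h" unfolding v[symmetric] using h mem by (simp add: H.m_assoc)
        moreover have "(?v, \<omega> h) \<in> carrier ?M" using g by (simp add: lattice_semidirect_def)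
        ultimately show "h \<in> ?f ` carrier ?M" by (intro image_eqI[of _ _ "(?v, \<omega> h)"]) simp_all
      qed
    qed
  qed
  ultimately show ?thesis by (auto simp: is_iso_def iso_def)
qed

end

context profinite_lattice_data begin

theorem lattice_semidirect_iso: "lattice_semidirect I G R \<cong> H"
proof -
  obtain b where b: "\<forall>i\<in>I. b i \<in> B i \<and> (\<forall>N>0. coprime (x N (b i) i) (int N))"
    "\<forall>i\<in>I. \<forall>j\<in>I. c i j \<noteq> 0 \<longrightarrow> (\<forall>N>0. [x N (b j) j = x N (b i) i] (mod int N))"
    using adjusted_basis by blast
  interpret profinite_lattice_basis I G R s c H \<omega> x b
    by unfold_locales (use b in auto)
  show ?thesis by (rule semidirect_iso)
qed

end

section \<open>Profinite completions\<close>

lemma finite_image_refine: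
  assumes "finite (f ` A)" "\<And>a b. a \<in> A \<Longrightarrow> b \<in> A \<Longrightarrow> f a = f b \<Longrightarrow> g a = g b"
  shows "finite (g ` A)"
proof (rule finite_surj[OF assms(1)])
  show "g ` A \<subseteq> (\<lambda>y. g (SOME a. a \<in> A \<and> f a = y)) ` (f ` A)"
  proof
    fix z assume "z \<in> g ` A"
    then obtain a where a: "a \<in> A" "z = g a" by blast
    define a' where "a' = (SOME a'. a' \<in> A \<and> f a' = f a)"
    have "\<exists>a'. a' \<in> A \<and> f a' = f a" using a(1) by blast
    from someI_ex[OF this] have a': "a' \<in> A" "f a' = f a" by (simp_all add: a'_def)
    have "z = g a'" unfolding a(2) by (rule assms(2)[OF a(1) a'(1) a'(2)[symmetric]])
    then show "z \<in> (\<lambda>y. g (SOME a. a \<in> A \<and> f a = y)) ` (f ` A)"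
      using a(1) by (simp add: a'_def)
  qed
qed

lemma rcosets_image: "rcosets\<^bsub>G\<^esub> N = (\<lambda>x. N #>\<^bsub>G\<^esub> x) ` carrier G"
  by (auto simp: RCOSETS_def)

locale plain_group = group G for G :: "'a monoid" (structure)
begin

lemma finite_index_normals_D:
  assumes "N \<in> finite_index_normals G"
  shows "N \<lhd> G" "subgroup N G" "finite (rcosets N)"
  using assms normal_imp_subgroup by (auto simp: finite_index_normals_def)

lemma coset_eq_iff:
  assumes "subgroup N G" "x \<in> carrier G" "y \<in> carrier G"
  shows "N #> x = N #> y \<longleftrightarrow> x \<otimes> inv y \<in> N"
proof
  assume "N #> x = N #> y"
  then have "x \<in> N #> y" using rcos_self[OF assms(2,1)] by simp
  then obtain n where "n \<in> N" "x = n \<otimes> y" by (auto simp: r_coset_def)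
  then show "x \<otimes> inv y \<in> N" using assms subgroup.mem_carrier[OF assms(1)] by (simp add: m_assoc)
next
  assume n: "x \<otimes> inv y \<in> N"
  have "x = (x \<otimes> inv y) \<otimes> y" using assms by (simp add: m_assoc)
  then have "x \<in> N #> y" using n unfolding r_coset_def by blast
  then show "N #> x = N #> y" using repr_independence[OF _ assms(3,1)] by simp
qed

lemma carrier_finite_index: "carrier G \<in> finite_index_normals G"
proof -
  have "carrier G #> x = carrier G" if "x \<in> carrier G" for x
    using coset_join2[OF that subgroup_self that] .
  then have "rcosets (carrier G) \<subseteq> {carrier G}" by (auto simp: RCOSETS_def)
  then have "finite (rcosets (carrier G))" by (rule finite_subset) simp
  then show ?thesis using normal_self by (simp add: finite_index_normals_def)
qed

lemma Int_finite_index: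
  assumes "N \<in> finite_index_normals G" "M \<in> finite_index_normals G"
  shows "N \<inter> M \<in> finite_index_normals G"
proof -
  note N = finite_index_normals_D[OF assms(1)] and M = finite_index_normals_D[OF assms(2)]
  have sub: "subgroup (N \<inter> M) G" by (rule subgroups_Inter_pair[OF N(2) M(2)])
  have "N \<inter> M \<lhd> G"
    using sub normal_invE(2)[OF N(1)] normal_invE(2)[OF M(1)] by (auto simp: normal_inv_iff)
  moreover have "finite ((\<lambda>x. (N \<inter> M) #> x) ` carrier G)"
  proof (rule finite_image_refine)
    show "finite ((\<lambda>x. (N #> x, M #> x)) ` carrier G)"
    proof (rule finite_subset)
      show "(\<lambda>x. (N #> x, M #> x)) ` carrier G \<subseteq> (rcosets N) \<times> (rcosets M)" by (auto simp: RCOSETS_def)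
      show "finite ((rcosets N) \<times> (rcosets M))" using N(3) M(3) by simp
    qed
    fix a b assume ab: "a \<in> carrier G" "b \<in> carrier G" "(N #> a, M #> a) = (N #> b, M #> b)"
    then have "N #> a = N #> b" "M #> a = M #> b" by simp_all
    then show "(N \<inter> M) #> a = (N \<inter> M) #> b"
      using coset_eq_iff[OF N(2) ab(1,2)] coset_eq_iff[OF M(2) ab(1,2)] coset_eq_iff[OF sub ab(1,2)] by blast
  qed
  ultimately show ?thesis by (simp add: finite_index_normals_def rcosets_image)
qed

lemma Inter_finite_index:
  "finite \<F> \<Longrightarrow> \<F> \<subseteq> finite_index_normals G \<Longrightarrow> \<exists>N\<in>finite_index_normals G. \<forall>M\<in>\<F>. N \<subseteq> M"
proof (induction \<F> rule: finite_induct)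
  case empty then show ?case using carrier_finite_index by blast
next
  case (insert M \<F>)
  then obtain N where N: "N \<in> finite_index_normals G" "\<forall>M\<in>\<F>. N \<subseteq> M" by blast
  then have "N \<inter> M \<in> finite_index_normals G" using insert.prems by (intro Int_finite_index) auto
  then show ?case using N(2) by (intro bexI[of _ "N \<inter> M"]) auto
qed

lemma profinite_carrier_D:
  assumes "y \<in> carrier (profinite_completion G)" "N \<in> finite_index_normals G"
  shows "y N \<in> carrier (G Mod N)"
    and "M \<in> finite_index_normals G \<Longrightarrow> N \<subseteq> M \<Longrightarrow> y N \<subseteq> y M"
  using assms by (auto simp: profinite_completion_def)

lemma topspace_profinite: "topspace (profinite_topology G) = carrier (profinite_completion G)"
  by (auto simp: profinite_topology_def profinite_completion_def)

lemma openin_level: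
  assumes "N \<in> finite_index_normals G" "C \<in> carrier (G Mod N)"
  shows "openin (profinite_topology G) {y \<in> carrier (profinite_completion G). y N = C}"
proof -
  let ?X = "product_topology (\<lambda>N. discrete_topology (carrier (G Mod N))) (finite_index_normals G)"
  have "continuous_map (profinite_topology G) (discrete_topology (carrier (G Mod N))) (\<lambda>y. y N)"
    unfolding profinite_topology_def
    by (intro continuous_map_from_subtopology continuous_map_product_projection assms(1))
  then have "openin (profinite_topology G) {y \<in> topspace (profinite_topology G). y N \<in> {C}}"
    using assms(2) by (intro openin_continuous_map_preimage) auto
  then show ?thesis by (simp add: topspace_profinite)
qed

text \<open>A basic open set restricts finitely many levels, and one finite index normal subgroup
  lies below all of them. Compatible families that agree there agree at all those levels.\<close>

lemma openin_profinite_D: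
  assumes U: "openin (profinite_topology G) U" and x: "x \<in> U"
  shows "\<exists>N\<in>finite_index_normals G. \<forall>y\<in>carrier (profinite_completion G). y N = x N \<longrightarrow> y \<in> U"
proof -
  let ?I = "finite_index_normals G"
  let ?X = "\<lambda>N. discrete_topology (carrier (G Mod N))"
  obtain T where T: "openin (product_topology ?X ?I) T" "U = T \<inter> carrier (profinite_completion G)"
    using U unfolding profinite_topology_def openin_subtopology by blast
  have xT: "x \<in> T" "x \<in> carrier (profinite_completion G)" using x T(2) by auto
  have "\<exists>V. finite {i\<in>?I. V i \<noteq> topspace (?X i)} \<and> (\<forall>i\<in>?I. openin (?X i) (V i)) \<and> x \<in> Pi\<^sub>E ?I V \<and> Pi\<^sub>E ?I V \<subseteq> T"
    using T(1) xT(1) unfolding openin_product_topology_alt by blast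
  then obtain V where V: "finite {i\<in>?I. V i \<noteq> topspace (?X i)}" "x \<in> Pi\<^sub>E ?I V" "Pi\<^sub>E ?I V \<subseteq> T" by blast
  obtain N where N: "N \<in> ?I" "\<forall>M\<in>{i\<in>?I. V i \<noteq> topspace (?X i)}. N \<subseteq> M"
    using Inter_finite_index[OF V(1)] by blast
  have "y \<in> U" if y: "y \<in> carrier (profinite_completion G)" "y N = x N" for y
  proof -
    have "y M \<in> V M" if M: "M \<in> ?I" for M
    proof (cases "V M = topspace (?X M)")
      case True then show ?thesis using profinite_carrier_D(1)[OF y(1) M] by simp
    next
      case False
      then have NM: "N \<subseteq> M" using N(2) M by blast
      have sub: "x N \<subseteq> x M" "x N \<subseteq> y M"
        using profinite_carrier_D(2)[OF xT(2) N(1) M NM] profinite_carrier_D(2)[OF y(1) N(1) M NM] y(2) by simp_all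
      obtain a where a: "a \<in> carrier G" "x N = N #> a"
        using profinite_carrier_D(1)[OF xT(2) N(1)] by (auto simp: carrier_FactGroup)
      then have "a \<in> x N" using rcos_self[OF a(1) finite_index_normals_D(2)[OF N(1)]] by simp
      then have a2: "a \<in> x M" "a \<in> y M" using sub by auto
      have "C = M #> a" if C: "C \<in> carrier (G Mod M)" "a \<in> C" for C
      proof -
        obtain c where "c \<in> carrier G" "C = M #> c" using C(1) by (auto simp: carrier_FactGroup)
        then show ?thesis using repr_independence[of a M c] C(2) finite_index_normals_D(2)[OF M] by simp
      qed
      then have "y M = x M" using a2 profinite_carrier_D(1)[OF xT(2) M] profinite_carrier_D(1)[OF y(1) M] by metis
      then show ?thesis using V(2) M by (auto simp: PiE_iff)
    qed
    moreover have "y \<in> extensional ?I" using y(1) by (auto simp: profinite_completion_def PiE_iff)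
    ultimately have "y \<in> Pi\<^sub>E ?I V" by (simp add: PiE_iff)
    then show ?thesis using V(3) T(2) y(1) by blast
  qed
  then show ?thesis using N(1) by blast
qed

text \<open>The canonical map to the completion, restricted because elements of the completion are
  extensional functions.\<close>

definition eta :: "'a \<Rightarrow> 'a set \<Rightarrow> 'a set" where
  "eta h = (\<lambda>N\<in>finite_index_normals G. N #> h)"

lemma eta_mem: "h \<in> carrier G \<Longrightarrow> eta h \<in> carrier (profinite_completion G)"
  by (auto simp: eta_def profinite_completion_def carrier_FactGroup r_coset_def)

lemma eta_mult:
  assumes "h \<in> carrier G" "h' \<in> carrier G"
  shows "eta (h \<otimes> h') = eta h \<otimes>\<^bsub>profinite_completion G\<^esub> eta h'"
proof -
  have "N #> (h \<otimes> h') = (N #> h) <#> (N #> h')" if "N \<in> finite_index_normals G" for N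
    using normal.rcos_sum[OF finite_index_normals_D(1)[OF that] assms] by simp
  then show ?thesis by (auto simp: eta_def profinite_completion_def product_group_def intro!: restrict_ext)
qed

end

lemma profinite_mult_level:
  "N \<in> finite_index_normals G \<Longrightarrow>
    (x \<otimes>\<^bsub>profinite_completion G\<^esub> y) N = x N \<otimes>\<^bsub>G Mod N\<^esub> y N"
  by (simp add: profinite_completion_def product_group_def)

text \<open>An isomorphism of profinite completions is remembered only through the induced compatible
  family of epimorphisms of \<open>H\<close> onto the finite quotients of \<open>W\<close>.\<close>

lemma profinite_isomorphism_family:
  assumes H: "group H" and W: "group W" and iso: "isomorphic_profinite_completions H W"
  shows "\<exists>p. (\<forall>K\<in>finite_index_normals W. p K \<in> hom H (W Mod K) \<and> p K ` carrier H = carrier (W Mod K)) \<and>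
    (\<forall>K\<in>finite_index_normals W. \<forall>L\<in>finite_index_normals W. K \<subseteq> L \<longrightarrow> (\<forall>h\<in>carrier H. p K h \<subseteq> p L h)) \<and>
    (\<forall>U\<in>finite_index_normals H. \<exists>K\<in>finite_index_normals W. \<forall>h\<in>carrier H. p K h = K \<longrightarrow> h \<in> U)"
proof -
  interpret H: plain_group H by (rule plain_group.intro[OF H])
  interpret W: plain_group W by (rule plain_group.intro[OF W])
  let ?HH = "profinite_completion H" and ?WW = "profinite_completion W"
  obtain \<phi> where \<phi>: "\<phi> \<in> iso ?HH ?WW" "homeomorphic_map (profinite_topology H) (profinite_topology W) \<phi>"
    using iso by (auto simp: isomorphic_profinite_completions_def)
  have \<phi>_hom: "\<phi> (x \<otimes>\<^bsub>?HH\<^esub> y) = \<phi> x \<otimes>\<^bsub>?WW\<^esub> \<phi> y" if "x \<in> carrier ?HH" "y \<in> carrier ?HH" for x y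
    using \<phi>(1) that by (auto simp: iso_def hom_def)
  have \<phi>_bij: "bij_betw \<phi> (carrier ?HH) (carrier ?WW)" using \<phi>(1) by (simp add: iso_def)
  have \<phi>_mem: "\<phi> x \<in> carrier ?WW" if "x \<in> carrier ?HH" for x using bij_betwE[OF \<phi>_bij] that by blast
  define p where "p K h = \<phi> (H.eta h) K" for K h
  have p_hom: "p K \<in> hom H (W Mod K)" if K: "K \<in> finite_index_normals W" for K
  proof (rule homI)
    fix h assume h: "h \<in> carrier H"
    show "p K h \<in> carrier (W Mod K)" unfolding p_def
      by (rule W.profinite_carrier_D(1)[OF \<phi>_mem[OF H.eta_mem[OF h]] K])
    fix h' assume h': "h' \<in> carrier H"
    show "p K (h \<otimes>\<^bsub>H\<^esub> h') = p K h \<otimes>\<^bsub>W Mod K\<^esub> p K h'"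
      unfolding p_def H.eta_mult[OF h h'] \<phi>_hom[OF H.eta_mem[OF h] H.eta_mem[OF h']]
      by (rule profinite_mult_level[OF K])
  qed
  have p_surj: "C \<in> p K ` carrier H" if K: "K \<in> finite_index_normals W" and C: "C \<in> carrier (W Mod K)" for K C
  proof -
    obtain v where v: "v \<in> carrier W" "C = K #>\<^bsub>W\<^esub> v" using C by (auto simp: carrier_FactGroup)
    then have "W.eta v \<in> \<phi> ` carrier ?HH" using W.eta_mem \<phi>_bij by (simp add: bij_betw_def)
    then obtain x where x: "x \<in> carrier ?HH" "\<phi> x = W.eta v" by auto
    have "W.eta v K = C" using K v by (simp add: W.eta_def)
    then have x2: "\<phi> x K = C" using x(2) by simp
    \<comment> \<open>This set is open and contains \<open>x\<close>. Density of \<open>H\<close> in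
      its completion replaces \<open>x\<close> by the image of an element of
      \<open>H\<close>.\<close>
    let ?S = "{x \<in> topspace (profinite_topology H). \<phi> x \<in> {y \<in> carrier ?WW. y K = C}}"
    have "openin (profinite_topology H) ?S"
      using homeomorphic_imp_continuous_map[OF \<phi>(2)] W.openin_level[OF K C] by (rule openin_continuous_map_preimage)
    moreover have "x \<in> ?S" using x(1) x2 \<phi>_mem by (simp add: H.topspace_profinite)
    ultimately have "\<exists>N\<in>finite_index_normals H. \<forall>y\<in>carrier ?HH. y N = x N \<longrightarrow> y \<in> ?S"
      by (rule H.openin_profinite_D)
    then obtain N where N: "N \<in> finite_index_normals H" "\<And>y. y \<in> carrier ?HH \<Longrightarrow> y N = x N \<Longrightarrow> y \<in> ?S" by blast
    obtain h where h: "h \<in> carrier H" "x N = N #>\<^bsub>H\<^esub> h"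
      using H.profinite_carrier_D(1)[OF x(1) N(1)] by (auto simp: carrier_FactGroup)
    have "H.eta h N = x N" using N(1) h(2) by (simp add: H.eta_def)
    then have "H.eta h \<in> ?S" by (rule N(2)[OF H.eta_mem[OF h(1)]])
    then have "p K h = C" by (simp add: p_def)
    then show ?thesis using h(1) by blast
  qed
  have p_coh: "p K h \<subseteq> p L h"
    if "K \<in> finite_index_normals W" "L \<in> finite_index_normals W" "K \<subseteq> L" "h \<in> carrier H" for K L h
    unfolding p_def by (rule W.profinite_carrier_D(2)[OF \<phi>_mem[OF H.eta_mem[OF that(4)]] that(1-3)])
  have p_one: "p K \<one>\<^bsub>H\<^esub> = K" if K: "K \<in> finite_index_normals W" for K
  proof -
    interpret q: group_hom H "W Mod K" "p K"
      using normal.factorgroup_is_group[OF W.finite_index_normals_D(1)[OF K]] p_hom[OF K] H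
      by (simp add: group_hom_def group_hom_axioms_def)
    show ?thesis using q.hom_one by simp
  qed
  have p_cof: "\<exists>K\<in>finite_index_normals W. \<forall>h\<in>carrier H. p K h = K \<longrightarrow> h \<in> U" if U: "U \<in> finite_index_normals H" for U
  proof -
    have UC: "U \<in> carrier (H Mod U)"
      using H.coset_mult_one[OF subgroup.subset[OF H.finite_index_normals_D(2)[OF U]]]
      by (force simp: carrier_FactGroup)
    \<comment> \<open>Its image is open because the isomorphism is a homeomorphism, and so contains
      a whole level set around the image of the identity.\<close>
    let ?S = "{x \<in> carrier ?HH. x U = U}"
    have "openin (profinite_topology W) (\<phi> ` ?S)"
      using homeomorphic_imp_open_map[OF \<phi>(2)] H.openin_level[OF U UC] by (simp add: open_map_def)
    moreover have "H.eta \<one>\<^bsub>H\<^esub> U = U"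
      using U H.coset_mult_one[OF subgroup.subset[OF H.finite_index_normals_D(2)[OF U]]] by (simp add: H.eta_def)
    then have "\<phi> (H.eta \<one>\<^bsub>H\<^esub>) \<in> \<phi> ` ?S"
      by (intro imageI CollectI conjI H.eta_mem H.one_closed)
    ultimately have "\<exists>K\<in>finite_index_normals W. \<forall>y\<in>carrier ?WW. y K = \<phi> (H.eta \<one>\<^bsub>H\<^esub>) K \<longrightarrow> y \<in> \<phi> ` ?S"
      by (rule W.openin_profinite_D)
    then obtain K where K0: "K \<in> finite_index_normals W"
      "\<forall>y\<in>carrier ?WW. y K = \<phi> (H.eta \<one>\<^bsub>H\<^esub>) K \<longrightarrow> y \<in> \<phi> ` ?S" by (rule bexE)
    note K = K0(1) K0(2)[rule_format]
    have "h \<in> U" if h: "h \<in> carrier H" "p K h = K" for h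
    proof -
      have "\<phi> (H.eta h) K = \<phi> (H.eta \<one>\<^bsub>H\<^esub>) K" using h(2) p_one[OF K(1)] by (simp add: p_def)
      then have "\<phi> (H.eta h) \<in> \<phi> ` ?S" by (rule K(2)[OF \<phi>_mem[OF H.eta_mem[OF h(1)]]])
      then obtain x where x: "x \<in> carrier ?HH" "x U = U" "\<phi> (H.eta h) = \<phi> x" by blast
      then have "H.eta h = x" using inj_onD[OF bij_betw_imp_inj_on[OF \<phi>_bij] x(3) H.eta_mem[OF h(1)]] by simp
      then have "H.eta h U = U" using x(2) by (simp only:)
      then have "U #>\<^bsub>H\<^esub> h = U" using U by (simp add: H.eta_def)
      then show ?thesis by (rule H.coset_join1[OF _ h(1) H.finite_index_normals_D(2)[OF U]])
    qed
    then show ?thesis using K(1) by blast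
  qed
  have "p K ` carrier H = carrier (W Mod K)" if K: "K \<in> finite_index_normals W" for K
    using p_surj[OF K] hom_carrier[OF p_hom[OF K]] by blast
  then show ?thesis
    by (intro exI[of _ p] conjI ballI impI) (rule p_hom p_coh p_cof | assumption)+
qed

text \<open>The epimorphisms are evaluated at congruence subgroups \<open>K N\<close> of
  \<open>W\<close>: an element of \<open>H\<close> determines a coset in \<open>W\<close>, and a
  representative of this coset supplies its component in \<open>G\<close> and its coordinates modulo
  \<open>N\<close>.\<close>

lemma profinite_rigidity_semidirect:
  fixes I :: "'i set" and G :: "'g monoid" and W :: "'w monoid" and H :: "'h monoid"
  assumes lat: "reflection_lattice I G R s c"
    and W: "group W" and W_iso: "W \<cong> lattice_semidirect I G R"
    and H: "finitely_generated_group H" "residually_finite H"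
    and prof: "isomorphic_profinite_completions H W"
  shows "lattice_semidirect I G R \<cong> H"
proof -
  interpret reflection_lattice I G R s c by (rule lat)
  interpret G: group G by (rule group_G)
  interpret W: plain_group W by (rule plain_group.intro[OF W])
  have gH: "group H" using H(1) by (simp add: finitely_generated_group_def)
  interpret H: group H by (rule gH)
  let ?M = "lattice_semidirect I G R"
  obtain \<theta> where \<theta>: "\<theta> \<in> hom W ?M" "bij_betw \<theta> (carrier W) (carrier ?M)"
    using W_iso by (auto simp: is_iso_def iso_def)
  define vec where "vec w = fst (\<theta> w)" for w
  define ang where "ang w = snd (\<theta> w)" for w
  have \<theta>_mem: "\<theta> w \<in> carrier ?M" if "w \<in> carrier W" for w using \<theta>(1) that by (auto simp: hom_def)
  have \<theta>_eq: "\<theta> w = (vec w, ang w)" for w by (simp add: vec_def ang_def)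
  have ang_mem: "ang w \<in> carrier G" and vec_off: "i \<notin> I \<Longrightarrow> vec w i = 0" if "w \<in> carrier W" for w i
    using \<theta>_mem[OF that] unfolding \<theta>_eq by (simp_all add: lattice_semidirect_def)
  have \<theta>_mult: "\<theta> (w \<otimes>\<^bsub>W\<^esub> w') = \<theta> w \<otimes>\<^bsub>?M\<^esub> \<theta> w'" if "w \<in> carrier W" "w' \<in> carrier W" for w w'
    using \<theta>(1) that by (auto simp: hom_def)
  have vec_mult: "vec (w \<otimes>\<^bsub>W\<^esub> w') i = vec w i + lattice_act I (R (ang w)) (vec w') i"
    and ang_mult: "ang (w \<otimes>\<^bsub>W\<^esub> w') = ang w \<otimes>\<^bsub>G\<^esub> ang w'"
    if "w \<in> carrier W" "w' \<in> carrier W" for w w' i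
    using \<theta>_mult[OF that] unfolding \<theta>_eq by (simp_all add: lattice_semidirect_def)
  have act_one: "lattice_act I (R \<one>\<^bsub>G\<^esub>) v i = v i" if "i \<in> I" for v i
  proof -
    have "(\<Sum>j\<in>I. R \<one>\<^bsub>G\<^esub> i j * v j) = (\<Sum>j\<in>I. if i = j then v j else 0)"
      using that by (intro sum.cong) (auto simp: R_one)
    then show ?thesis using that finite_I by (simp add: lattice_act_def)
  qed
  have vec_mult1: "vec (w \<otimes>\<^bsub>W\<^esub> w') i = vec w i + vec w' i"
    if "w \<in> carrier W" "w' \<in> carrier W" "ang w = \<one>\<^bsub>G\<^esub>" "i \<in> I" for w w' i
    using vec_mult[OF that(1,2)] act_one[OF that(4)] that(3) by simp
  have \<theta>_surj: "\<exists>w\<in>carrier W. vec w = v \<and> ang w = g" if "g \<in> carrier G" "\<And>i. i \<notin> I \<Longrightarrow> v i = 0" for v g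
  proof -
    have "(v, g) \<in> \<theta> ` carrier W"
      using that bij_betw_imp_surj_on[OF \<theta>(2)] by (simp add: lattice_semidirect_def)
    then obtain w where "w \<in> carrier W" "\<theta> w = (v, g)" by force
    then show ?thesis by (intro bexI[of _ w]) (simp_all add: vec_def ang_def)
  qed
  have ang_one: "ang \<one>\<^bsub>W\<^esub> = \<one>\<^bsub>G\<^esub>"
  proof -
    have "ang \<one>\<^bsub>W\<^esub> \<otimes>\<^bsub>G\<^esub> ang \<one>\<^bsub>W\<^esub> = ang \<one>\<^bsub>W\<^esub>" using ang_mult[of "\<one>\<^bsub>W\<^esub>" "\<one>\<^bsub>W\<^esub>"] by simp
    then show ?thesis using ang_mem[OF W.one_closed] G.r_cancel_one by blast
  qed
  have vec_one: "vec \<one>\<^bsub>W\<^esub> i = 0" if "i \<in> I" for i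
    using vec_mult1[OF W.one_closed W.one_closed ang_one that] by simp
  \<comment> \<open>The preimage of \<open>N\<close> times the lattice. These subgroups are cofinal
    among the finite index normal subgroups of \<open>W\<close>.\<close>
  define K where "K N = {w \<in> carrier W. ang w = \<one>\<^bsub>G\<^esub> \<and> (\<forall>i\<in>I. int N dvd vec w i)}" for N :: nat
  have K_sub: "subgroup (K N) W" for N
  proof (rule W.subgroupI)
    show "K N \<subseteq> carrier W" by (auto simp: K_def)
    have "\<one>\<^bsub>W\<^esub> \<in> K N" using ang_one vec_one by (simp add: K_def)
    then show "K N \<noteq> {}" by blast
    fix a assume a: "a \<in> K N"
    then have a': "a \<in> carrier W" "ang a = \<one>\<^bsub>G\<^esub>" "\<And>i. i \<in> I \<Longrightarrow> int N dvd vec a i" by (auto simp: K_def)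
    have ia: "ang (inv\<^bsub>W\<^esub> a) = \<one>\<^bsub>G\<^esub>"
      using ang_mult[of "inv\<^bsub>W\<^esub> a" a] a' ang_one ang_mem[of "inv\<^bsub>W\<^esub> a"] by simp
    have "vec (inv\<^bsub>W\<^esub> a) i = - vec a i" if "i \<in> I" for i
      using vec_mult1[of "inv\<^bsub>W\<^esub> a" a i] a' ia that vec_one[OF that] by simp
    then show "inv\<^bsub>W\<^esub> a \<in> K N" using a' ia by (simp add: K_def)
    fix b assume "b \<in> K N"
    then have b': "b \<in> carrier W" "ang b = \<one>\<^bsub>G\<^esub>" "\<And>i. i \<in> I \<Longrightarrow> int N dvd vec b i" by (auto simp: K_def)
    show "a \<otimes>\<^bsub>W\<^esub> b \<in> K N"
      using a' b' ang_mult[OF a'(1) b'(1)] vec_mult1[OF a'(1) b'(1) a'(2)] by (simp add: K_def)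
  qed
  have K_coset: "K N #>\<^bsub>W\<^esub> w = K N #>\<^bsub>W\<^esub> w' \<longleftrightarrow> ang w = ang w' \<and> (\<forall>i\<in>I. [vec w i = vec w' i] (mod int N))"
    if w: "w \<in> carrier W" "w' \<in> carrier W" for w w' N
  proof -
    define k where "k = w \<otimes>\<^bsub>W\<^esub> inv\<^bsub>W\<^esub> w'"
    have k: "k \<in> carrier W" "w = k \<otimes>\<^bsub>W\<^esub> w'" using w by (simp_all add: k_def W.m_assoc)
    have ang_k: "ang k = \<one>\<^bsub>G\<^esub> \<longleftrightarrow> ang w = ang w'"
      using ang_mult[OF k(1) w(2)] k(2) ang_mem[OF k(1)] ang_mem[OF w(2)] G.l_cancel_one by simp
    have vec_k: "vec w i = vec k i + vec w' i" if "ang k = \<one>\<^bsub>G\<^esub>" "i \<in> I" for i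
      using vec_mult1[OF k(1) w(2) that] k(2) by simp
    have "K N #>\<^bsub>W\<^esub> w = K N #>\<^bsub>W\<^esub> w' \<longleftrightarrow> k \<in> K N"
      unfolding k_def by (rule W.coset_eq_iff[OF K_sub w])
    also have "\<dots> \<longleftrightarrow> ang k = \<one>\<^bsub>G\<^esub> \<and> (\<forall>i\<in>I. int N dvd vec k i)" using k(1) by (simp add: K_def)
    also have "\<dots> \<longleftrightarrow> ang k = \<one>\<^bsub>G\<^esub> \<and> (\<forall>i\<in>I. [vec w i = vec w' i] (mod int N))"
      using vec_k by (auto simp: cong_iff_dvd_diff)
    finally show ?thesis unfolding ang_k .
  qed
  have K_fin: "K N \<in> finite_index_normals W" if N: "N > 0" for N
  proof -
    have "K N \<lhd> W"
    proof (rule W.normal_invI[OF K_sub])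
      fix x h assume x: "x \<in> carrier W" and "h \<in> K N"
      then have h: "h \<in> carrier W" "ang h = \<one>\<^bsub>G\<^esub>" "\<And>i. i \<in> I \<Longrightarrow> int N dvd vec h i" by (auto simp: K_def)
      define z where "z = x \<otimes>\<^bsub>W\<^esub> h \<otimes>\<^bsub>W\<^esub> inv\<^bsub>W\<^esub> x"
      have z: "z \<in> carrier W" "z \<otimes>\<^bsub>W\<^esub> x = x \<otimes>\<^bsub>W\<^esub> h" using x h by (simp_all add: z_def W.m_assoc)
      have "ang z \<otimes>\<^bsub>G\<^esub> ang x = ang x"
        using ang_mult[OF z(1) x] ang_mult[OF x h(1)] z(2) h(2) ang_mem[OF x] by simp
      then have az: "ang z = \<one>\<^bsub>G\<^esub>" using ang_mem[OF z(1)] ang_mem[OF x] G.l_cancel_one by simp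
      have "int N dvd vec z i" if i: "i \<in> I" for i
      proof -
        have "vec z i = lattice_act I (R (ang x)) (vec h) i"
          using vec_mult1[OF z(1) x az i] vec_mult[OF x h(1), of i] z(2) by simp
        also have "int N dvd \<dots>" unfolding lattice_act_def using h(3) by (auto intro!: dvd_sum)
        finally show ?thesis .
      qed
      then have "z \<in> K N" using z(1) az by (simp add: K_def)
      then show "x \<otimes>\<^bsub>W\<^esub> h \<otimes>\<^bsub>W\<^esub> inv\<^bsub>W\<^esub> x \<in> K N" by (simp add: z_def)
    qed
    moreover have "finite ((\<lambda>x. K N #>\<^bsub>W\<^esub> x) ` carrier W)"
    proof (rule finite_image_refine)
      let ?f = "\<lambda>w. (\<lambda>i\<in>I. vec w i mod int N, ang w)"
      show "finite (?f ` carrier W)"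
      proof (rule finite_subset)
        show "?f ` carrier W \<subseteq> (I \<rightarrow>\<^sub>E {0..<int N}) \<times> carrier G" using N ang_mem by auto
        show "finite ((I \<rightarrow>\<^sub>E {0..<int N}) \<times> carrier G)"
          by (intro finite_cartesian_product finite_PiE finite_I finite_G) simp
      qed
      fix a b assume ab: "a \<in> carrier W" "b \<in> carrier W" "?f a = ?f b"
      have ab3: "(\<lambda>i\<in>I. vec a i mod int N) = (\<lambda>i\<in>I. vec b i mod int N)" using ab(3) by (rule conjunct1[OF prod.inject[THEN iffD1]])
      have "vec a i mod int N = vec b i mod int N" if "i \<in> I" for i
        using fun_cong[OF ab3, of i] that by (simp only: restrict_apply if_True)
      then show "K N #>\<^bsub>W\<^esub> a = K N #>\<^bsub>W\<^esub> b" unfolding K_coset[OF ab(1,2)] using ab(3) by (simp add: cong_def)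
    qed
    ultimately show ?thesis by (simp add: finite_index_normals_def rcosets_image)
  qed
  have K_mono: "K M \<subseteq> K N" if "N dvd M" for N M
    using that by (auto simp: K_def intro: dvd_trans[of "int N" "int M"])
  have K_cofinal: "\<exists>N>0. K N \<subseteq> U" if U: "U \<in> finite_index_normals W" for U
  proof -
    note U' = W.finite_index_normals_D[OF U]
    interpret U: normal U W by (rule U'(1))
    interpret Q: group "W Mod U" by (rule U.factorgroup_is_group)
    \<comment> \<open>Every element of \<open>K N\<close> is the \<open>N\<close>-th power of a
      translation, and the order of the quotient kills such powers modulo \<open>U\<close>.\<close>
    define N where "N = Coset.order (W Mod U)"
    have fin: "finite (carrier (W Mod U))" using U'(3) by (simp add: FactGroup_def)
    have N: "N > 0" unfolding N_def using Q.order_gt_0_iff_finite fin by blast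
    have "K N \<subseteq> U"
    proof
      fix w assume "w \<in> K N"
      then have w: "w \<in> carrier W" "ang w = \<one>\<^bsub>G\<^esub>" "\<And>i. i \<in> I \<Longrightarrow> int N dvd vec w i" by (auto simp: K_def)
      obtain w' where w': "w' \<in> carrier W" "vec w' = (\<lambda>i. if i \<in> I then vec w i div int N else 0)" "ang w' = \<one>\<^bsub>G\<^esub>"
        using \<theta>_surj[OF G.one_closed, of "\<lambda>i. if i \<in> I then vec w i div int N else 0"] by auto
      have pow: "ang (w' [^]\<^bsub>W\<^esub> n) = \<one>\<^bsub>G\<^esub> \<and> (\<forall>i\<in>I. vec (w' [^]\<^bsub>W\<^esub> n) i = int n * vec w' i)" for n :: nat
      proof (induction n)
        case 0 then show ?case using ang_one vec_one by simp
      next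
        case (Suc n)
        have c: "w' [^]\<^bsub>W\<^esub> n \<in> carrier W" using w'(1) by simp
        show ?case using Suc ang_mult[OF c w'(1)] vec_mult1[OF c w'(1)] w'(3) by (simp add: algebra_simps)
      qed
      have c: "w' [^]\<^bsub>W\<^esub> N \<in> carrier W" using w'(1) by simp
      have "vec (w' [^]\<^bsub>W\<^esub> N) i = vec w i" for i
      proof (cases "i \<in> I")
        case True then show ?thesis using pow[of N] w'(2) w(3)[OF True] by simp
      next
        case False then show ?thesis using vec_off[OF c False] vec_off[OF w(1) False] by simp
      qed
      then have "\<theta> (w' [^]\<^bsub>W\<^esub> N) = \<theta> w" unfolding \<theta>_eq using pow[of N] w(2) by (simp add: fun_eq_iff)
      then have weq: "w' [^]\<^bsub>W\<^esub> N = w" using inj_onD[OF bij_betw_imp_inj_on[OF \<theta>(2)] _ c w(1)] by simp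
      have "U #>\<^bsub>W\<^esub> w' \<in> carrier (W Mod U)" using w'(1) by (auto simp: carrier_FactGroup)
      then have "(U #>\<^bsub>W\<^esub> w') [^]\<^bsub>W Mod U\<^esub> N = \<one>\<^bsub>W Mod U\<^esub>" unfolding N_def by (rule Q.pow_order_eq_1)
      then have "U #>\<^bsub>W\<^esub> w = U" using U.FactGroup_pow[OF w'(1), of N] weq by simp
      then show "w \<in> U" by (rule W.coset_join1[OF _ w(1) U'(2)])
    qed
    then show ?thesis using N by blast
  qed
  obtain p where p0: "(\<forall>K\<in>finite_index_normals W. p K \<in> hom H (W Mod K) \<and> p K ` carrier H = carrier (W Mod K)) \<and>
    (\<forall>K\<in>finite_index_normals W. \<forall>L\<in>finite_index_normals W. K \<subseteq> L \<longrightarrow> (\<forall>h\<in>carrier H. p K h \<subseteq> p L h)) \<and>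
    (\<forall>U\<in>finite_index_normals H. \<exists>K\<in>finite_index_normals W. \<forall>h\<in>carrier H. p K h = K \<longrightarrow> h \<in> U)"
    using profinite_isomorphism_family[OF gH W prof] by (rule exE)
  have p_hom: "p L \<in> hom H (W Mod L)" and p_surj: "p L ` carrier H = carrier (W Mod L)"
    if "L \<in> finite_index_normals W" for L
    by (rule conjunct1[OF bspec[OF conjunct1[OF p0] that]] conjunct2[OF bspec[OF conjunct1[OF p0] that]])+
  have p_coh: "p L h \<subseteq> p L' h" if "L \<in> finite_index_normals W" "L' \<in> finite_index_normals W" "L \<subseteq> L'" "h \<in> carrier H"
    for L L' h
    by (rule conjunct1[OF conjunct2[OF p0], THEN bspec, THEN bspec, THEN mp, THEN bspec, OF that])
  have p_cof: "\<exists>L\<in>finite_index_normals W. \<forall>h\<in>carrier H. p L h = L \<longrightarrow> h \<in> U" if "U \<in> finite_index_normals H" for U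
    by (rule conjunct2[OF conjunct2[OF p0], THEN bspec, OF that])
  have p_rep: "\<exists>w. w \<in> carrier W \<and> p L h = L #>\<^bsub>W\<^esub> w" if "L \<in> finite_index_normals W" "h \<in> carrier H" for L h
  proof -
    have "p L h \<in> carrier (W Mod L)" using p_hom[OF that(1)] that(2) by (auto simp: hom_def)
    then show ?thesis by (auto simp: carrier_FactGroup)
  qed
  define rep where "rep N h = (SOME w. w \<in> carrier W \<and> p (K N) h = K N #>\<^bsub>W\<^esub> w)" for N h
  have rep: "rep N h \<in> carrier W" "p (K N) h = K N #>\<^bsub>W\<^esub> rep N h" if "N > 0" "h \<in> carrier H" for N h
    using someI_ex[OF p_rep[OF K_fin[OF that(1)] that(2)]] by (simp_all add: rep_def)
  have same: "ang w = ang w' \<and> (\<forall>i\<in>I. [vec w i = vec w' i] (mod int N))"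
    if "w \<in> carrier W" "w' \<in> carrier W" "w \<in> K N #>\<^bsub>W\<^esub> w'" for w w' N
  proof -
    have "K N #>\<^bsub>W\<^esub> w = K N #>\<^bsub>W\<^esub> w'" using W.repr_independence[OF that(3,2) K_sub] by simp
    then show ?thesis unfolding K_coset[OF that(1,2)] .
  qed
  have coh: "ang (rep M h) = ang (rep N h) \<and> (\<forall>i\<in>I. [vec (rep M h) i = vec (rep N h) i] (mod int N))"
    if NM: "N dvd M" "M > 0" and h: "h \<in> carrier H" for N M h
  proof (rule same)
    have N: "N > 0" using NM by (cases "N = 0") auto
    show "rep M h \<in> carrier W" "rep N h \<in> carrier W" using rep NM N h by simp_all
    have "rep M h \<in> p (K M) h" unfolding rep(2)[OF NM(2) h] by (rule W.rcos_self[OF rep(1)[OF NM(2) h] K_sub])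
    then have "rep M h \<in> p (K N) h" using p_coh[OF K_fin[OF NM(2)] K_fin[OF N] K_mono[OF NM(1)] h] by blast
    then show "rep M h \<in> K N #>\<^bsub>W\<^esub> rep N h" unfolding rep(2)[OF N h] .
  qed
  \<comment> \<open>At level 1 the coset remembers only the component in \<open>G\<close>, and
    coherence makes that component the same at all levels.\<close>
  define \<omega> where "\<omega> h = ang (rep 1 h)" for h
  have ang_rep: "ang (rep N h) = \<omega> h" if "N > 0" "h \<in> carrier H" for N h
    unfolding \<omega>_def using coh[of 1 N h] that by simp
  have mult: "ang (rep N (h \<otimes>\<^bsub>H\<^esub> h')) = ang (rep N h \<otimes>\<^bsub>W\<^esub> rep N h') \<and>
      (\<forall>i\<in>I. [vec (rep N (h \<otimes>\<^bsub>H\<^esub> h')) i = vec (rep N h \<otimes>\<^bsub>W\<^esub> rep N h') i] (mod int N))"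
    if N: "N > 0" and h: "h \<in> carrier H" "h' \<in> carrier H" for N h h'
  proof (rule same)
    have hh: "h \<otimes>\<^bsub>H\<^esub> h' \<in> carrier H" using h by simp
    note r = rep(1)[OF N h(1)] rep(1)[OF N h(2)] rep(1)[OF N hh]
    show "rep N (h \<otimes>\<^bsub>H\<^esub> h') \<in> carrier W" "rep N h \<otimes>\<^bsub>W\<^esub> rep N h' \<in> carrier W" using r by simp_all
    have "p (K N) (h \<otimes>\<^bsub>H\<^esub> h') = p (K N) h \<otimes>\<^bsub>W Mod K N\<^esub> p (K N) h'"
      using p_hom[OF K_fin[OF N]] h by (auto simp: hom_def)
    also have "\<dots> = K N #>\<^bsub>W\<^esub> (rep N h \<otimes>\<^bsub>W\<^esub> rep N h')"
      unfolding rep(2)[OF N h(1)] rep(2)[OF N h(2)]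
      using normal.rcos_sum[OF W.finite_index_normals_D(1)[OF K_fin[OF N]] r(1,2)] by simp
    finally have "K N #>\<^bsub>W\<^esub> rep N (h \<otimes>\<^bsub>H\<^esub> h') = K N #>\<^bsub>W\<^esub> (rep N h \<otimes>\<^bsub>W\<^esub> rep N h')"
      unfolding rep(2)[OF N hh] .
    then show "rep N (h \<otimes>\<^bsub>H\<^esub> h') \<in> K N #>\<^bsub>W\<^esub> (rep N h \<otimes>\<^bsub>W\<^esub> rep N h')"
      using W.rcos_self[OF r(3) K_sub[of N]] by simp
  qed
  interpret profinite_lattice_data I G R s c H \<omega> "\<lambda>N h. vec (rep N h)"
  proof (intro profinite_lattice_data.intro profinite_lattice_data_axioms.intro)
    show "reflection_lattice I G R s c" by (rule lat)
    show "group H" by (rule gH)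
    show "finitely_generated_group H" "residually_finite H" by (rule H)+
    show "\<omega> \<in> hom H G"
    proof (rule homI)
      fix h assume h: "h \<in> carrier H"
      show "\<omega> h \<in> carrier G" unfolding \<omega>_def by (rule ang_mem[OF rep(1)[OF _ h]]) simp
      fix h' assume h': "h' \<in> carrier H"
      have "ang (rep 1 (h \<otimes>\<^bsub>H\<^esub> h')) = ang (rep 1 h \<otimes>\<^bsub>W\<^esub> rep 1 h')" using mult[of 1 h h'] h h' by simp
      also have "\<dots> = ang (rep 1 h) \<otimes>\<^bsub>G\<^esub> ang (rep 1 h')" using rep(1)[of 1] h h' by (intro ang_mult) simp_all
      finally show "\<omega> (h \<otimes>\<^bsub>H\<^esub> h') = \<omega> h \<otimes>\<^bsub>G\<^esub> \<omega> h'" by (simp add: \<omega>_def)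
    qed
    show "[vec (rep M h) i = vec (rep N h) i] (mod int N)"
      if "N dvd M" "M > 0" "h \<in> carrier H" "i \<in> I" for N M h i
      using coh[OF that(1-3)] that(4) by blast
    show "[vec (rep N (h \<otimes>\<^bsub>H\<^esub> h')) i = vec (rep N h) i + lattice_act I (R (\<omega> h)) (vec (rep N h')) i] (mod int N)"
      if "N > 0" "h \<in> carrier H" "h' \<in> carrier H" "i \<in> I" for N h h' i
    proof -
      have "[vec (rep N (h \<otimes>\<^bsub>H\<^esub> h')) i = vec (rep N h \<otimes>\<^bsub>W\<^esub> rep N h') i] (mod int N)"
        using mult[OF that(1-3)] that(4) by blast
      then show ?thesis
        unfolding vec_mult[OF rep(1)[OF that(1,2)] rep(1)[OF that(1,3)]] ang_rep[OF that(1,2)] .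
    qed
    show "\<exists>h\<in>carrier H. \<omega> h = g \<and> (\<forall>i\<in>I. [vec (rep N h) i = v i] (mod int N))"
      if N: "N > 0" and g: "g \<in> carrier G" for N g v
    proof -
      obtain w where w: "w \<in> carrier W" "vec w = (\<lambda>i. if i \<in> I then v i else 0)" "ang w = g"
        using \<theta>_surj[OF g, of "\<lambda>i. if i \<in> I then v i else 0"] by auto
      have "K N #>\<^bsub>W\<^esub> w \<in> p (K N) ` carrier H"
        unfolding p_surj[OF K_fin[OF N]] using w(1) by (auto simp: carrier_FactGroup)
      then obtain h where h: "h \<in> carrier H" "p (K N) h = K N #>\<^bsub>W\<^esub> w" by auto
      have "rep N h \<in> K N #>\<^bsub>W\<^esub> w"
        using W.rcos_self[OF rep(1)[OF N h(1)] K_sub[of N]] rep(2)[OF N h(1)] h(2) by simp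
      from same[OF rep(1)[OF N h(1)] w(1) this] show ?thesis
        using h(1) ang_rep[OF N h(1)] w(2,3) by (intro bexI[of _ h]) auto
    qed
    show "\<exists>N>0. \<forall>h\<in>carrier H. \<omega> h = \<one>\<^bsub>G\<^esub> \<and> (\<forall>i\<in>I. [vec (rep N h) i = 0] (mod int N)) \<longrightarrow> h \<in> U"
      if U: "U \<in> finite_index_normals H" for U
    proof -
      obtain L where L: "L \<in> finite_index_normals W" "\<forall>h\<in>carrier H. p L h = L \<longrightarrow> h \<in> U" using p_cof[OF U] by (rule bexE)
      obtain N where N: "N > 0" "K N \<subseteq> L" using K_cofinal[OF L(1)] by (elim exE conjE)
      have "h \<in> U" if h: "h \<in> carrier H" "\<omega> h = \<one>\<^bsub>G\<^esub>" "\<forall>i\<in>I. [vec (rep N h) i = 0] (mod int N)" for h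
      proof -
        have "rep N h \<in> K N" using rep(1)[OF N(1) h(1)] ang_rep[OF N(1) h(1)] h(2,3) by (simp add: K_def cong_0_iff)
        then have rL: "rep N h \<in> L" using N(2) by blast
        have "rep N h \<in> p (K N) h" unfolding rep(2)[OF N(1) h(1)] by (rule W.rcos_self[OF rep(1)[OF N(1) h(1)] K_sub])
        then have rp: "rep N h \<in> p L h" by (rule subsetD[OF p_coh[OF K_fin[OF N(1)] L(1) N(2) h(1)]])
        obtain w where w: "w \<in> carrier W" "p L h = L #>\<^bsub>W\<^esub> w" using p_rep[OF L(1) h(1)] by (elim exE conjE)
        have "L #>\<^bsub>W\<^esub> w = L #>\<^bsub>W\<^esub> rep N h"
          using rp unfolding w(2) by (rule W.repr_independence[OF _ w(1) W.finite_index_normals_D(2)[OF L(1)]])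
        also have "\<dots> = L" by (rule W.coset_join2[OF rep(1)[OF N(1) h(1)] W.finite_index_normals_D(2)[OF L(1)] rL])
        finally have "p L h = L" unfolding w(2) .
        then show ?thesis by (rule L(2)[rule_format, OF h(1)])
      qed
      then show ?thesis by (intro exI[of _ N] conjI N(1) ballI impI) (elim conjE)
    qed
  qed
  show ?thesis by (rule lattice_semidirect_iso)
qed

section \<open>From discrete reflection groups to lattices, and the conclusion\<close>

lemma isolated_id_motions:
  fixes S :: "('e::euclidean_space \<Rightarrow> 'e) set"
  assumes "Isolated.discrete S" "id \<in> S"
  shows "\<exists>\<kappa>>0. \<forall>f\<in>S. (\<forall>x. norm (f x - x) \<le> \<kappa> * (1 + norm x)) \<longrightarrow> f = id"
proof -
  have "id isolated_in S" using assms unfolding Isolated.discrete_def by blast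
  then obtain T where T: "open T" "T \<inter> S = {id}" unfolding isolated_in_def by blast
  have idT: "id \<in> T" using T(2) by blast
  have "openin (product_topology (\<lambda>i::'e. euclidean :: 'e topology) UNIV) T" using T(1) by (simp only: open_fun_def)
  then have "\<exists>U. finite {i\<in>UNIV. U i \<noteq> topspace (euclidean :: 'e topology)} \<and>
      (\<forall>i\<in>UNIV. openin (euclidean :: 'e topology) (U i)) \<and> id \<in> Pi\<^sub>E UNIV U \<and> Pi\<^sub>E UNIV U \<subseteq> T"
    using idT unfolding openin_product_topology_alt by (rule bspec)
  then obtain U where U: "finite {i::'e. U i \<noteq> UNIV}" "\<And>i. open (U i)" "\<And>i::'e. i \<in> U i" "Pi\<^sub>E UNIV U \<subseteq> T"
    by (auto simp: PiE_iff)
  \<comment> \<open>Pointwise convergence restricts the values at finitely many points only, so a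
    minimum over these points is positive.\<close>
  let ?X = "{i::'e. U i \<noteq> UNIV}"
  have "\<exists>e>0. ball i e \<subseteq> U i" for i using U(2,3) open_contains_ball by blast
  then obtain e where e: "\<And>i. e i > 0" "\<And>i. ball i (e i) \<subseteq> U i" by metis
  \<comment> \<open>The factor 2 yields the strict inequality for an open ball; the inserted 1 keeps
    the minimum defined if no point is restricted.\<close>
  define \<kappa> where "\<kappa> = Min (insert 1 ((\<lambda>i. e i / (2 * (1 + norm i))) ` ?X))"
  have fin: "finite (insert 1 ((\<lambda>i. e i / (2 * (1 + norm i))) ` ?X))" using U(1) by simp
  have pos: "0 < 2 * (1 + norm i)" for i :: 'e by (simp add: add_pos_nonneg)
  have "\<kappa> > 0" unfolding \<kappa>_def using fin e(1) pos by (subst Min_gr_iff) (auto simp: divide_pos_pos)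
  moreover have "f = id" if f: "f \<in> S" "\<forall>x. norm (f x - x) \<le> \<kappa> * (1 + norm x)" for f
  proof -
    have "f i \<in> U i" for i
    proof (cases "i \<in> ?X")
      case False then show ?thesis by simp
    next
      case True
      have "\<kappa> \<le> e i / (2 * (1 + norm i))" unfolding \<kappa>_def using fin True by (intro Min_le) auto
      then have "\<kappa> * (2 * (1 + norm i)) \<le> e i" using pos[of i] by (simp only: pos_le_divide_eq)
      then have "\<kappa> * (1 + norm i) \<le> e i / 2" by (simp add: algebra_simps)
      also have "\<dots> < e i" using e(1)[of i] by simp
      finally have "norm (f i - i) < e i" using f(2) by (meson le_less_trans)
      then have "f i \<in> ball i (e i)" by (simp add: dist_norm norm_minus_commute)
      then show ?thesis using e(2) by blast
    qed
    then have "f \<in> T" using U(4) by (auto simp: PiE_iff)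
    then show ?thesis using T(2) f(1) by blast
  qed
  ultimately show ?thesis by blast
qed

lemma affine_reflection_refl_at:
  assumes "affine_reflection r"
  shows "\<exists>a p. norm a = 1 \<and> r = refl_at a p"
proof -
  obtain p a where a: "a \<noteq> 0" "r = (\<lambda>x. x - (2 * ((x - p) \<bullet> a) / (a \<bullet> a)) *\<^sub>R a)"
    using assms unfolding affine_reflection_def by blast
  have "r = refl_at (a /\<^sub>R norm a) p"
  proof
    fix x
    have "a \<bullet> a = norm a * norm a" by (simp add: dot_square_norm power2_eq_square)
    then show "r x = refl_at (a /\<^sub>R norm a) p x"
      using a(1) by (simp add: a(2) refl_at_def divide_inverse mult_ac)
  qed
  moreover have "norm (a /\<^sub>R norm a) = 1" using a(1) by simp
  ultimately show ?thesis by blast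
qed

lemma mult_BijGroup_UNIV: "f \<in> Bij UNIV \<Longrightarrow> g \<in> Bij UNIV \<Longrightarrow> f \<otimes>\<^bsub>BijGroup UNIV\<^esub> g = f \<circ> g"
  by (rule ext) (simp add: BijGroup_def compose_def)

text \<open>Reflections are their own inverses, so the generated subgroup consists of compositions
  of the generators, which is the form that \<open>discrete_reflections\<close> works with.\<close>

lemma discrete_reflection_group_lattice:
  fixes \<Gamma> :: "('e::euclidean_space \<Rightarrow> 'e) monoid"
  assumes "discrete_reflection_group \<Gamma>"
  shows "\<exists>(J :: 'e set) (G :: ('e \<Rightarrow> 'e) monoid) R s c.
    reflection_lattice J G R s c \<and> \<Gamma> \<cong> lattice_semidirect J G R"
proof -
  obtain Rs where Rs: "\<forall>r\<in>Rs. affine_reflection r" "\<Gamma> = subgroup_generated (BijGroup UNIV) Rs"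
    and disc: "Isolated.discrete (carrier \<Gamma>)"
    using assms unfolding discrete_reflection_group_def by blast
  interpret BG: group "BijGroup (UNIV :: 'e set)" by (rule group_BijGroup)
  let ?B = "BijGroup (UNIV :: 'e set)"
  have refl: "\<exists>a p. norm a = 1 \<and> r = refl_at a p" if "r \<in> Rs" for r
    using Rs(1) that affine_reflection_refl_at by blast
  have invol: "r \<circ> r = id" if "r \<in> Rs" for r using refl[OF that] refl_at_comp_self by metis
  have carB: "carrier ?B = {f. bij f}" by (auto simp: BijGroup_def Bij_def)
  have Rs_B: "Rs \<subseteq> carrier ?B" unfolding carB using invol o_bij by blast
  have mult: "f \<otimes>\<^bsub>?B\<^esub> g = f \<circ> g" if "f \<in> carrier ?B" "g \<in> carrier ?B" for f g
    by (rule mult_BijGroup_UNIV) (use that in \<open>simp_all add: BijGroup_def\<close>)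
  have one: "\<one>\<^bsub>?B\<^esub> = id" by (auto simp: BijGroup_def)
  have car: "carrier \<Gamma> = generate ?B Rs"
    unfolding Rs(2) carrier_subgroup_generated using Rs_B by (simp add: Int_absorb1)
  have gen_B: "generate ?B Rs \<subseteq> carrier ?B" by (rule BG.generate_incl[OF Rs_B])
  have comps: "carrier \<Gamma> = compositions Rs"
  proof
    show "carrier \<Gamma> \<subseteq> compositions Rs"
    proof
      fix f assume "f \<in> carrier \<Gamma>"
      then have "f \<in> generate ?B Rs" by (simp only: car)
      then show "f \<in> compositions Rs"
      proof (induction rule: generate.induct)
        case one show ?case unfolding \<open>\<one>\<^bsub>?B\<^esub> = id\<close> by (rule compositions.id)
      next
        case (incl h) then show ?case by (rule compositions_base)
      next
        case (inv h)
        have hB: "h \<in> carrier ?B" using inv Rs_B by blast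
        have "h \<otimes>\<^bsub>?B\<^esub> h = \<one>\<^bsub>?B\<^esub>" unfolding mult[OF hB hB] one by (rule invol[OF inv])
        then have "inv\<^bsub>?B\<^esub> h = h" by (rule BG.inv_equality[OF _ hB hB])
        then show ?case using compositions_base[OF inv] by (simp only:)
      next
        case (eng h1 h2)
        have "h1 \<in> carrier ?B" "h2 \<in> carrier ?B" using eng.hyps gen_B by blast+
        then show ?case using compositions_comp[OF eng.IH] by (simp only: mult)
      qed
    qed
    show "compositions Rs \<subseteq> carrier \<Gamma>"
    proof
      fix f assume "f \<in> compositions Rs"
      then show "f \<in> carrier \<Gamma>" unfolding car
      proof (induction rule: compositions.induct)
        case id show ?case using generate.one[of ?B Rs] by (simp only: one)
      next
        case (step r f)
        have "r \<in> carrier ?B" "f \<in> carrier ?B" using step Rs_B gen_B by blast+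
        then show ?case using generate.eng[OF generate.incl[OF step(1)] step(3)] by (simp only: mult)
      qed
    qed
  qed
  interpret discrete_reflections "carrier \<Gamma>"
  proof
    show "id \<in> carrier \<Gamma>" unfolding comps by (rule compositions.id)
    show "f \<circ> g \<in> carrier \<Gamma>" if "f \<in> carrier \<Gamma>" "g \<in> carrier \<Gamma>" for f g
      using that unfolding comps by (rule compositions_comp)
    show "\<exists>g\<in>carrier \<Gamma>. f \<circ> g = id \<and> g \<circ> f = id" if "f \<in> carrier \<Gamma>" for f
      using that unfolding comps by (rule compositions_inverse[rotated]) (rule invol)
    show "\<exists>C c. orthogonal_transformation C \<and> f = (\<lambda>x. C x + c)" if "f \<in> carrier \<Gamma>" for f
      using that unfolding comps
    proof (induction rule: compositions.induct)
      case id
      show ?case by (intro exI[of _ "\<lambda>x. x"] exI[of _ 0]) (simp add: orthogonal_transformation_id fun_eq_iff)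
    next
      case (step r f)
      obtain a p where a: "norm a = 1" "r = refl_at a p" using refl[OF step(1)] by blast
      obtain C d where C: "orthogonal_transformation C" "f = (\<lambda>x. C x + d)" using step(3) by blast
      have "(r \<circ> f) x = (refl_at a 0 \<circ> C) x + refl_at a p d" for x
        by (simp add: a(2) C(2) refl_at_def inner_add_left inner_diff_left algebra_simps)
      then have "r \<circ> f = (\<lambda>x. (refl_at a 0 \<circ> C) x + refl_at a p d)" by blast
      moreover have "orthogonal_transformation (refl_at a 0 \<circ> C)"
        by (intro orthogonal_transformation_compose orthogonal_transformation_refl_at a C)
      ultimately show ?case by blast
    qed
    show "\<exists>\<kappa>>0. \<forall>f\<in>carrier \<Gamma>. (\<forall>x. norm (f x - x) \<le> \<kappa> * (1 + norm x)) \<longrightarrow> f = id"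
      by (rule isolated_id_motions[OF disc]) (simp only: comps compositions.id)
    show "carrier \<Gamma> = compositions {r \<in> carrier \<Gamma>. \<exists>a p. norm a = 1 \<and> r = refl_at a p}"
    proof
      \<comment> \<open>The locale takes all reflections of the group as generators, which may be
        more than the given ones.\<close>
      have "Rs \<subseteq> {r \<in> carrier \<Gamma>. \<exists>a p. norm a = 1 \<and> r = refl_at a p}"
        using refl compositions_base[of _ Rs] comps by blast
      then have "Rs \<subseteq> compositions {r \<in> carrier \<Gamma>. \<exists>a p. norm a = 1 \<and> r = refl_at a p}"
        using compositions_base by blast
      then show "carrier \<Gamma> \<subseteq> compositions {r \<in> carrier \<Gamma>. \<exists>a p. norm a = 1 \<and> r = refl_at a p}"
        unfolding comps by (rule compositions_subset[OF _ compositions.id compositions_comp])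
      show "compositions {r \<in> carrier \<Gamma>. \<exists>a p. norm a = 1 \<and> r = refl_at a p} \<subseteq> carrier \<Gamma>"
        by (rule compositions_subset) (auto simp only: comps intro: compositions.id compositions_comp)
    qed
  qed
  obtain J :: "'e set" and G :: "('e \<Rightarrow> 'e) monoid" and R s c
    where lat: "reflection_lattice J G R s c" "lattice_semidirect J G R \<cong> map_group (carrier \<Gamma>)"
    using reflection_lattice_exists by blast
  have \<Gamma>_mult: "f \<otimes>\<^bsub>\<Gamma>\<^esub> g = f \<circ> g" if "f \<in> carrier \<Gamma>" "g \<in> carrier \<Gamma>" for f g
    using that gen_B mult[of f g] unfolding car by (simp add: Rs(2) subset_iff)
  have "(\<lambda>f. f) \<in> iso \<Gamma> (map_group (carrier \<Gamma>))"
    by (rule isoI) (simp_all add: hom_def \<Gamma>_mult bij_betw_def)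
  then have 1: "\<Gamma> \<cong> map_group (carrier \<Gamma>)" by (rule is_isoI)
  obtain f where f: "f \<in> iso (lattice_semidirect J G R) (map_group (carrier \<Gamma>))" using lat(2) by (auto simp: is_iso_def)
  \<comment> \<open>The semidirect product has not been shown to be a group, so the isomorphism is
    inverted by hand, using closure under products.\<close>
  have "map_group (carrier \<Gamma>) \<cong> lattice_semidirect J G R"
  proof -
    let ?M = "lattice_semidirect J G R"
    let ?g = "inv_into (carrier ?M) f"
    have bij: "bij_betw f (carrier ?M) (carrier \<Gamma>)" and hom: "f \<in> hom ?M (map_group (carrier \<Gamma>))"
      using f by (simp_all add: iso_def)
    have closed: "x \<otimes>\<^bsub>?M\<^esub> y \<in> carrier ?M" if "x \<in> carrier ?M" "y \<in> carrier ?M" for x y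
    proof -
      have "group G" using lat(1) by (rule reflection_lattice.group_G)
      then show ?thesis using that
        by (auto simp: lattice_semidirect_def lattice_act_def group.is_monoid monoid.m_closed)
    qed
    have "?g \<in> hom (map_group (carrier \<Gamma>)) ?M"
    proof (rule homI)
      fix x assume x: "x \<in> carrier (map_group (carrier \<Gamma>))"
      then show "?g x \<in> carrier ?M" using bij by (simp add: bij_betw_def inv_into_into)
      fix y assume y: "y \<in> carrier (map_group (carrier \<Gamma>))"
      have gx: "?g x \<in> carrier ?M" "f (?g x) = x" and gy: "?g y \<in> carrier ?M" "f (?g y) = y"
        using x y bij by (auto simp: bij_betw_def inv_into_into f_inv_into_f)
      have "f (?g x \<otimes>\<^bsub>?M\<^esub> ?g y) = x \<otimes>\<^bsub>map_group (carrier \<Gamma>)\<^esub> y"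
        using hom_mult[OF hom gx(1) gy(1)] gx(2) gy(2) by (simp only:)
      then show "?g (x \<otimes>\<^bsub>map_group (carrier \<Gamma>)\<^esub> y) = ?g x \<otimes>\<^bsub>?M\<^esub> ?g y"
        using inv_into_f_f[OF bij_betw_imp_inj_on[OF bij] closed[OF gx(1) gy(1)]] by metis
    qed
    moreover have "bij_betw ?g (carrier (map_group (carrier \<Gamma>))) (carrier ?M)"
      using bij_betw_inv_into[OF bij] by simp
    ultimately have "?g \<in> iso (map_group (carrier \<Gamma>)) ?M" by (rule isoI)
    then show ?thesis by (rule is_isoI)
  qed
  then show ?thesis using lat(1) iso_trans[OF 1] by blast
qed

theorem theorem1p2:
  fixes S :: "'s set" and m :: "'s \<Rightarrow> 's \<Rightarrow> enat" and H :: "'h monoid"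
  assumes "coxeter_matrix S m"
    and "irreducible_coxeter S m"
    and "affine_coxeter TYPE('e::euclidean_space) (coxeter_group S m)"
    and "finitely_generated_group H"
    and "residually_finite H"
    and "isomorphic_profinite_completions H (coxeter_group S m)"
  shows "H \<cong> coxeter_group S m"
proof -
  let ?W = "coxeter_group S m"
  have W: "group ?W" unfolding coxeter_group_def by (rule group_presented_group)
  obtain \<Gamma> :: "('e \<Rightarrow> 'e) monoid" where \<Gamma>: "discrete_reflection_group \<Gamma>" "?W \<cong> \<Gamma>"
    using assms(3) unfolding affine_coxeter_def by blast
  obtain J :: "'e set" and G :: "('e \<Rightarrow> 'e) monoid" and R s c
    where lat: "reflection_lattice J G R s c" "\<Gamma> \<cong> lattice_semidirect J G R"
    using discrete_reflection_group_lattice[OF \<Gamma>(1)] by blast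
  have WM: "?W \<cong> lattice_semidirect J G R" by (rule iso_trans[OF \<Gamma>(2) lat(2)])
  have "lattice_semidirect J G R \<cong> H"
    by (rule profinite_rigidity_semidirect[OF lat(1) W WM assms(4-6)])
  with WM have "?W \<cong> H" by (rule iso_trans)
  then show ?thesis by (rule group.iso_sym[OF W])
qed

end
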